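(* Let $F$ be an Orlicz function satisfying the $\Delta_2$-condition for large $u$, and let $w$ be a non-trivial weight on $[0,1]$ with associated sets $(\overline M_r)_{r\ge1}$ (defined in the context). Then the Orlicz space $L_F=L_F[0,1]$ is $w$-decomposable if and only if there exist $p\in[1,\infty)$ and a constant $C>0$ such that for every $n\in\mathbb N$, all measurable sets $A_k\subset\overline M_k$ and all reals $c_k$ ($1\le k\le n$), $$C^{-1}\Big\|\sum_{k=1}^nc_k\chi_{A_k}\Big\|_{L_F}^p\le\sum_{k=1}^n\|c_k\chi_{A_k}\|_{L_F}^p\le C\Big\|\sum_{k=1}^nc_k\chi_{A_k}\Big\|_{L_F}^p .$$ If, in addition, the complementary function $F^*$ satisfies the $\Delta_2$-condition for large $u$, then the $w$-decomposability of $L_F$ implies that $F$ is equivalent to an Orlicz function that is regularly varying at $\infty$ of order $p$ (with $p$ as in the displayed condition).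
   Context: $m$ is Lebesgue measure; functions are identified if they agree a.e., and supports and infima/suprema of $w$ over sets are understood up to null sets. An Orlicz function is a convex increasing $F:[0,\infty)\to[0,\infty)$ with $F(0)=0$. $L_F[0,1]$ is the space of measurable $x$ on $[0,1]$ with $\int_0^1F(c|x(t)|)\,dt<\infty$ for some $c>0$, with norm $\|x\|_{L_F}=\inf\{\lambda>0:\int_0^1F(|x(t)|/\lambda)\,dt\le1\}$. $F$ satisfies the $\Delta_2$-condition for large $u$ if there are $C\ge1$, $u_0\ge0$ with $F(2u)\le CF(u)$ for all $u\ge u_0$. $F^*(v)=\sup_{u\ge0}(uv-F(u))$. An Orlicz function $G$ is regularly varying at $\infty$ of order $p\in[1,\infty)$ if $\lim_{t\to\infty}G(tu)/G(t)=u^p$ for all $u>0$. Two functions are equivalent if each is bounded by a constant multiple of the other. A weight on $[0,1]$ is a measurable function that is positive and finite a.e.; it is non-trivial if $w$ or $1/w$ is unbounded. For the weight $w$ put $M_k=\{t\in[0,1]: w(t)\in[2^k,2^{k+1})\}$, $k\in\mathbb Z$. Since $w$ is non-trivial, infinitely many $M_k$ have positive measure; $(w_r)_{r=1}^\infty$ is the non-increasing rearrangement of $(m(M_k))_{k\in\mathbb Z}$, and $(\overline M_r)_{r=1}^\infty$ is any corresponding enumeration of the sets $M_k$ (of positive measure) with $m(\overline M_r)=w_r$ for all $r$. A space $X$ of functions is $w$-decomposable if there is $C>0$ such that for every $n\in\mathbb N$ and all nonzero $x_1,\dots,x_n,y_1,\dots,y_n\in X$ with $\|x_i\|_X=\|y_i\|_X$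 ($1\le i\le n$) and $\inf w(\operatorname{supp}x_i\cup\operatorname{supp}y_i)\ge 2\sup w(\operatorname{supp}x_{i+1}\cup\operatorname{supp}y_{i+1})$ ($1\le i\le n-1$), one has $C^{-1}\|\sum_{i=1}^n x_i\|_X\le\|\sum_{i=1}^n y_i\|_X\le C\|\sum_{i=1}^n x_i\|_X$. *)

theory Defs
  imports "HOL-Analysis.Analysis" "HOL-Probability.Essential_Supremum"
begin

text \<open>Functions on \<open>[0,1]\<close> are total functions on the reals, of which only the restriction to
  \<open>{0..1}\<close> matters; identification up to null sets is expressed by \<open>AE\<close>.\<close>

abbreviation unit_leb :: "real measure" where
  "unit_leb \<equiv> lebesgue_on {0..1}"

text \<open>Monotonicity is not required to be strict; the last clause only excludes the zero function,
  for which the Luxemburg functional vanishes identically.\<close>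

definition orlicz_function :: "(real \<Rightarrow> real) \<Rightarrow> bool" where
  "orlicz_function F \<longleftrightarrow>
     convex_on {0..} F \<and> mono_on {0..} F \<and> F 0 = 0 \<and> (\<exists>u\<ge>0. F u \<noteq> 0)"

definition orlicz_space :: "(real \<Rightarrow> real) \<Rightarrow> (real \<Rightarrow> real) set" where
  "orlicz_space F =
     {x \<in> borel_measurable unit_leb.
        \<exists>c>0. (\<integral>\<^sup>+ t. ennreal (F (c * \<bar>x t\<bar>)) \<partial>unit_leb) < \<infinity>}"

definition orlicz_norm :: "(real \<Rightarrow> real) \<Rightarrow> (real \<Rightarrow> real) \<Rightarrow> real" where
  "orlicz_norm F x =
     Inf {l. l > 0 \<and> (\<integral>\<^sup>+ t. ennreal (F (\<bar>x t\<bar> / l)) \<partial>unit_leb) \<le> 1}"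

text \<open>Extended real values are needed because the complementary function may take the
  value \<open>\<infinity>\<close>.\<close>

definition delta2_large :: "(real \<Rightarrow> ereal) \<Rightarrow> bool" where
  "delta2_large \<Phi> \<longleftrightarrow> (\<exists>C\<ge>1. \<exists>u0\<ge>0. \<forall>u\<ge>u0. \<Phi> (2 * u) \<le> ereal C * \<Phi> u)"

definition complementary :: "(real \<Rightarrow> real) \<Rightarrow> real \<Rightarrow> ereal" where
  "complementary F v = (SUP u\<in>{0..}. ereal (u * v - F u))"

definition regularly_varying :: "(real \<Rightarrow> real) \<Rightarrow> real \<Rightarrow> bool" where
  "regularly_varying G p \<longleftrightarrow> (\<forall>u>0. ((\<lambda>t. G (t * u) / G t) \<longlongrightarrow> u powr p) at_top)"

definition equivalent_functions :: "(real \<Rightarrow> real) \<Rightarrow> (real \<Rightarrow> real) \<Rightarrow> bool" where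
  "equivalent_functions F G \<longleftrightarrow> (\<exists>C>0. \<forall>u\<ge>0. F u \<le> C * G u \<and> G u \<le> C * F u)"

definition weight :: "(real \<Rightarrow> real) \<Rightarrow> bool" where
  "weight w \<longleftrightarrow> w \<in> borel_measurable unit_leb \<and> (AE t in unit_leb. 0 < w t)"

definition ess_bounded :: "(real \<Rightarrow> real) \<Rightarrow> bool" where
  "ess_bounded f \<longleftrightarrow> (\<exists>B. AE t in unit_leb. \<bar>f t\<bar> \<le> B)"

definition nontrivial_weight :: "(real \<Rightarrow> real) \<Rightarrow> bool" where
  "nontrivial_weight w \<longleftrightarrow>
     weight w \<and> (\<not> ess_bounded w \<or> \<not> ess_bounded (\<lambda>t. 1 / w t))"

definition level_set :: "(real \<Rightarrow> real) \<Rightarrow> int \<Rightarrow> real set" where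
  "level_set w k = {t \<in> {0..1}. 2 powi k \<le> w t \<and> w t < 2 powi (k + 1)}"

text \<open>\<open>Mb\<close> lists the level sets of positive measure, each index \<open>k\<close> exactly once, in an order
  (starting at index \<open>0\<close>) for which the measures are non-increasing.\<close>

definition level_enumeration :: "(real \<Rightarrow> real) \<Rightarrow> (nat \<Rightarrow> real set) \<Rightarrow> bool" where
  "level_enumeration w Mb \<longleftrightarrow>
     (\<exists>\<sigma> :: nat \<Rightarrow> int.
        bij_betw \<sigma> UNIV {k. measure lebesgue (level_set w k) > 0} \<and>
        (\<forall>r. Mb r = level_set w (\<sigma> r)) \<and>
        decseq (\<lambda>r. measure lebesgue (Mb r)))"

definition supp :: "(real \<Rightarrow> real) \<Rightarrow> real set" where
  "supp x = {t \<in> {0..1}. x t \<noteq> 0}"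

definition ess_sup_on :: "(real \<Rightarrow> real) \<Rightarrow> real set \<Rightarrow> ereal" where
  "ess_sup_on w S = esssup (lebesgue_on S) (\<lambda>t. ereal (w t))"

definition ess_inf_on :: "(real \<Rightarrow> real) \<Rightarrow> real set \<Rightarrow> ereal" where
  "ess_inf_on w S = - esssup (lebesgue_on S) (\<lambda>t. - ereal (w t))"

definition w_decomposable ::
  "(real \<Rightarrow> real) \<Rightarrow> (real \<Rightarrow> real) set \<Rightarrow> ((real \<Rightarrow> real) \<Rightarrow> real) \<Rightarrow> bool" where
  "w_decomposable w X nrm \<longleftrightarrow>
     (\<exists>C>0. \<forall>(n::nat) (x :: nat \<Rightarrow> real \<Rightarrow> real) (y :: nat \<Rightarrow> real \<Rightarrow> real).
        (\<forall>i<n. x i \<in> X \<and> y i \<in> X \<and>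
               \<not> (AE t in unit_leb. x i t = 0) \<and> \<not> (AE t in unit_leb. y i t = 0) \<and>
               nrm (x i) = nrm (y i)) \<and>
        (\<forall>i. i + 1 < n \<longrightarrow>
           ess_inf_on w (supp (x i) \<union> supp (y i))
             \<ge> 2 * ess_sup_on w (supp (x (i + 1)) \<union> supp (y (i + 1)))) \<longrightarrow>
        inverse C * nrm (\<lambda>t. \<Sum>i<n. x i t) \<le> nrm (\<lambda>t. \<Sum>i<n. y i t) \<and>
        nrm (\<lambda>t. \<Sum>i<n. y i t) \<le> C * nrm (\<lambda>t. \<Sum>i<n. x i t))"

definition lp_estimates :: "(real \<Rightarrow> real) \<Rightarrow> (nat \<Rightarrow> real set) \<Rightarrow> real \<Rightarrow> bool" where
  "lp_estimates F Mb p \<longleftrightarrow>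
     (\<exists>C>0. \<forall>(n::nat) (A :: nat \<Rightarrow> real set) (c :: nat \<Rightarrow> real).
        (\<forall>k<n. A k \<in> sets lebesgue \<and> A k \<subseteq> Mb k) \<longrightarrow>
        inverse C * orlicz_norm F (\<lambda>t. \<Sum>k<n. c k * indicat_real (A k) t) powr p
          \<le> (\<Sum>k<n. orlicz_norm F (\<lambda>t. c k * indicat_real (A k) t) powr p) \<and>
        (\<Sum>k<n. orlicz_norm F (\<lambda>t. c k * indicat_real (A k) t) powr p)
          \<le> C * orlicz_norm F (\<lambda>t. \<Sum>k<n. c k * indicat_real (A k) t) powr p)"

end

theory Submission
  imports Defs
begin

text \<open>Write \<open>\<phi>\<^sub>u s = F (s u) / F u\<close>. If \<open>F u * m A = 1\<close> then \<open>s u \<chi>\<^sub>A\<close> has norm \<open>s\<close>, and for such functions supported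
  on different cells \<open>M\<^sub>k\<close> the modular of the sum is the sum of the numbers \<open>\<phi>\<^sub>u s\<close>. Both conditions of the theorem
  thus compare Musielak-Orlicz sequence norms, and a pigeonhole choice of a block of indices turns
  such comparisons into pointwise ones with a summable error. The \<open>\<ell>\<^sub>p\<close> estimates become
  \<open>\<phi>\<^sub>u s \<le> C s\<^sup>p + b\<^sub>k\<close> and \<open>s\<^sup>p \<le> C \<phi>\<^sub>u s + b\<^sub>k\<close> whenever \<open>F u * m M\<^sub>k \<ge> 1\<close>, with summable \<open>b\<close>;
  integrated over the cells, this gives the \<open>\<ell>\<^sub>p\<close> estimates for arbitrary functions, hence
  decomposability. Decomposability becomes \<open>\<phi>\<^sub>u s \<le> C \<phi>\<^sub>v s + b\<^sub>k\<close>; letting \<open>u, v\<close> tend to infinity, \<open>\<phi>\<close> is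
  multiplicative in \<open>s\<close> up to a constant, which forces \<open>\<phi>\<^sub>u s \<approx> s\<^sup>p\<close> for some \<open>p\<close>. Finally \<open>F u = u\<^sup>p L u\<close>, where
  \<open>L\<close> varies by at most a bounded factor on long logarithmic intervals; averaging \<open>ln L\<close> over slowly
  growing windows makes it slowly varying. For \<open>p = 1\<close> the hypothesis on \<open>F\<^sup>*\<close> forces \<open>F u / u\<close> to be bounded.\<close>

section \<open>The modular and the norm\<close>

text \<open>A level \<open>u\<close> can be tested in cell \<open>k\<close> only if a set of measure
  \<open>1 / F u\<close> fits there, that is if \<open>F u * W k \<ge> 1\<close>; this is why the
  pointwise estimates carry an error depending on the cell. Summability is its natural size:
  finitely many violations whose ratios add up to at least 1 contradict the norm inequality, while
  conversely a summable error adds only a constant to a modular. Each single cell has room for all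
  large \<open>u\<close>, so for fixed \<open>s\<close> one cell with small error already gives
  clean asymptotic estimates. Neighbouring dyadic levels of \<open>w\<close> need not be separated
  by a factor 2, so decomposability is exploited separately on even and on odd levels. Doubling
  holds only beyond \<open>u1\<close>, yet it is what turns a small modular into a small norm;
  smaller arguments are charged to the summable term \<open>F u1 * W k\<close>. Equivalence is
  demanded on all of \<open>[0, \<infinity>)\<close>, so the smoothed function is used only far out
  and is joined convexly to \<open>F\<close>. Its derivative must increase, and the factor
  \<open>u powr (p - 1)\<close> can absorb the slowly varying one only for \<open>p > 1\<close>;
  this isolates \<open>p = 1\<close>.\<close>

definition modular :: "(real \<Rightarrow> real) \<Rightarrow> (real \<Rightarrow> real) \<Rightarrow> ennreal" where
  "modular F f = (\<integral>\<^sup>+ t. ennreal (F \<bar>f t\<bar>) \<partial>unit_leb)"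

lemma orlicz_norm_modular:
  "orlicz_norm F x = Inf {l. l > 0 \<and> modular F (\<lambda>t. x t / l) \<le> 1}"
proof -
  have "{l. l > 0 \<and> (\<integral>\<^sup>+ t. ennreal (F (\<bar>x t\<bar> / l)) \<partial>unit_leb) \<le> 1}
      = {l. l > 0 \<and> modular F (\<lambda>t. x t / l) \<le> 1}"
    by (auto simp: modular_def)
  then show ?thesis by (simp add: orlicz_norm_def)
qed

lemma orlicz_norm_cong_AE:
  assumes "AE t in unit_leb. x t = y t"
  shows "orlicz_norm F x = orlicz_norm F y"
proof -
  have "modular F (\<lambda>t. x t / l) = modular F (\<lambda>t. y t / l)" for l
    unfolding modular_def by (rule nn_integral_cong_AE) (use assms in auto)
  then show ?thesis by (simp add: orlicz_norm_modular)
qed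

lemma orlicz_norm_le:
  assumes "l > 0" "modular F (\<lambda>t. x t / l) \<le> 1"
  shows "orlicz_norm F x \<le> l"
  unfolding orlicz_norm_modular
  by (rule cInf_lower) (use assms in \<open>auto intro!: bdd_belowI[of _ 0]\<close>)

locale orlicz =
  fixes F :: "real \<Rightarrow> real"
  assumes orlicz_F: "orlicz_function F"
begin

lemma F_convex: "convex_on {0..} F" and F_zero [simp]: "F 0 = 0"
  using orlicz_F by (auto simp: orlicz_function_def)

lemma F_mono: "0 \<le> u \<Longrightarrow> u \<le> v \<Longrightarrow> F u \<le> F v"
  using orlicz_F by (auto simp: orlicz_function_def mono_on_def)

lemma F_nonneg: "0 \<le> u \<Longrightarrow> 0 \<le> F u"
  using F_mono[of 0 u] by simp

lemma F_scale_le: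
  assumes "0 \<le> s" "s \<le> 1" "0 \<le> u" shows "F (s * u) \<le> s * F u"
  using convex_onD[OF F_convex, of s 0 u] assms by simp

lemma F_scale_ge:
  assumes "1 \<le> s" "0 \<le> u" shows "s * F u \<le> F (s * u)"
  using F_scale_le[of "1 / s" "s * u"] assms by (simp add: field_simps)

lemma F_divide_mono:
  assumes "0 < u" "u \<le> v" shows "F u / u \<le> F v / v"
  using F_scale_ge[of "v / u" u] assms by (simp add: field_simps)

text \<open>An Orlicz function may vanish on an initial interval, so strictness needs positivity at
  the right end; from there on it follows from convexity and \<open>F 0 = 0\<close>.\<close>

lemma F_strict_mono:
  assumes "0 \<le> u" "u < v" "0 < F v" shows "F u < F v"
proof -
  have "F u \<le> (u / v) * F v" using F_scale_le[of "u / v" v] assms by simp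
  also have "\<dots> < 1 * F v" using assms by (intro mult_strict_right_mono) auto
  finally show ?thesis by simp
qed

lemma F_le_iff: "0 \<le> u \<Longrightarrow> 0 \<le> v \<Longrightarrow> 0 < F v \<Longrightarrow> F u \<le> F v \<longleftrightarrow> u \<le> v"
  using F_mono[of u v] F_strict_mono[of v u] F_mono[of v u] by linarith

lemma F_at_top: "filterlim F at_top at_top"
proof -
  obtain u where u: "u \<ge> 0" "F u \<noteq> 0" using orlicz_F by (auto simp: orlicz_function_def)
  then have u: "u > 0" "F u > 0" using F_nonneg[of u] by (auto simp: less_le)
  have "filterlim (\<lambda>v. v * (F u / u)) at_top at_top"
    using u by (intro filterlim_at_top_mult_tendsto_pos[OF tendsto_const] filterlim_ident) auto
  moreover have "eventually (\<lambda>v. v * (F u / u) \<le> F v) at_top"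
    using eventually_ge_at_top[of u]
  proof eventually_elim
    case (elim v)
    then show ?case using F_divide_mono[of u v] u by (simp add: field_simps)
  qed
  ultimately show ?thesis by (rule filterlim_at_top_mono)
qed

lemma F_attains:
  assumes "y > 0" obtains t where "t > 0" "F t = y"
proof -
  \<comment> \<open>Convexity gives continuity only on the open half line, so the intermediate value
    theorem needs a positive left end; \<open>F e \<le> e * F 1 \<le> y\<close> dictates this
    one.\<close>
  define e where "e = min 1 (y / (F 1 + 1))"
  have F1: "F 1 \<ge> 0" by (simp add: F_nonneg)
  have e: "0 < e" "e \<le> 1" using assms F1 by (auto simp: e_def)
  have "F e \<le> e * F 1" using F_scale_le[of e 1] e by simp
  also have "\<dots> \<le> y / (F 1 + 1) * F 1" using F1 by (intro mult_right_mono) (auto simp: e_def)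
  also have "\<dots> \<le> y" using F1 assms by (simp add: field_simps)
  finally have Fe: "F e \<le> y" .
  obtain V where V: "V \<ge> 1" "F V \<ge> y"
    using F_at_top eventually_ge_at_top[of "1::real"]
    by (metis (mono_tags, lifting) eventually_at_top_linorder filterlim_at_top linorder_le_cases)
  have "continuous_on {0<..} F"
    by (rule convex_on_continuous) (auto intro: convex_on_subset[OF F_convex])
  then have "continuous_on {e..V} F" by (rule continuous_on_subset) (use e in auto)
  then obtain t where "e \<le> t" "F t = y" using IVT'[of F e y V] Fe V e by auto
  then show thesis using e that[of t] by auto
qed

lemma F_measurable:
  assumes "f \<in> borel_measurable N" shows "(\<lambda>t. F \<bar>f t\<bar>) \<in> borel_measurable N"
proof -
  \<comment> \<open>Nothing is known about \<open>F\<close> on negative reals; precomposing with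
    \<open>max 0\<close> makes it monotone everywhere, hence Borel.\<close>
  have "mono (\<lambda>u. F (max 0 u))" by (auto intro!: monoI F_mono)
  then have "(\<lambda>u. F (max 0 u)) \<in> borel_measurable borel" by (rule borel_measurable_mono)
  from measurable_compose[OF _ this, of "\<lambda>t. \<bar>f t\<bar>" N] assms show ?thesis by simp
qed

lemma modular_mono:
  assumes "AE t in unit_leb. \<bar>f t\<bar> \<le> \<bar>g t\<bar>" shows "modular F f \<le> modular F g"
  unfolding modular_def
  by (rule nn_integral_mono_AE) (use assms in \<open>auto intro!: ennreal_leI F_mono\<close>)

lemma modular_divide_le:
  assumes f: "f \<in> borel_measurable unit_leb" and K: "K \<ge> 1"
  shows "modular F (\<lambda>t. f t / K) \<le> ennreal (1 / K) * modular F f"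
proof -
  have "modular F (\<lambda>t. f t / K) \<le> (\<integral>\<^sup>+ t. ennreal (1 / K) * ennreal (F \<bar>f t\<bar>) \<partial>unit_leb)"
    unfolding modular_def
  proof (rule nn_integral_mono)
    fix t
    have "F \<bar>f t / K\<bar> \<le> (1 / K) * F \<bar>f t\<bar>"
      using F_scale_le[of "1 / K" "\<bar>f t\<bar>"] K by simp
    then show "ennreal (F \<bar>f t / K\<bar>) \<le> ennreal (1 / K) * ennreal (F \<bar>f t\<bar>)"
      using K by (metis ennreal_leI ennreal_mult' zero_le_divide_1_iff order_trans zero_le_one)
  qed
  also have "\<dots> = ennreal (1 / K) * modular F f"
    unfolding modular_def using F_measurable[OF f] by (intro nn_integral_cmult) auto
  finally show ?thesis .
qed

lemma modular_divide_le_one: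
  assumes f: "f \<in> borel_measurable unit_leb" and K: "K \<ge> 1" and le: "modular F f \<le> ennreal K"
  shows "modular F (\<lambda>t. f t / K) \<le> 1"
proof -
  have "modular F (\<lambda>t. f t / K) \<le> ennreal (1 / K) * ennreal K"
    using modular_divide_le[OF f K] le by (meson mult_left_mono order_trans zero_le)
  also have "\<dots> = 1" using K by (simp flip: ennreal_mult')
  finally show ?thesis .
qed

lemma orlicz_space_modular:
  "x \<in> orlicz_space F \<longleftrightarrow>
     x \<in> borel_measurable unit_leb \<and> (\<exists>l>0. modular F (\<lambda>t. x t / l) \<le> 1)"
proof (intro iffI conjI)
  assume "x \<in> orlicz_space F"
  then obtain c where x: "x \<in> borel_measurable unit_leb" and c: "c > 0"
    and fin: "(\<integral>\<^sup>+ t. ennreal (F (c * \<bar>x t\<bar>)) \<partial>unit_leb) < \<infinity>"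
    by (auto simp: orlicz_space_def)
  show "x \<in> borel_measurable unit_leb" by fact
  have eq: "modular F (\<lambda>t. x t * c) = (\<integral>\<^sup>+ t. ennreal (F (c * \<bar>x t\<bar>)) \<partial>unit_leb)"
    using c by (simp add: modular_def abs_mult mult.commute)
  then obtain r where r: "modular F (\<lambda>t. x t * c) = ennreal r" "r \<ge> 0" using fin
    by (metis ennreal_cases infinity_ennreal_def less_irrefl)
  have "modular F (\<lambda>t. x t * c / max 1 r) \<le> 1"
    by (rule modular_divide_le_one) (use x r in \<open>auto intro!: ennreal_leI\<close>)
  then have "modular F (\<lambda>t. x t / (max 1 r / c)) \<le> 1" by simp
  moreover have "max 1 r / c > 0" using c by (simp add: less_max_iff_disj)
  ultimately show "\<exists>l>0. modular F (\<lambda>t. x t / l) \<le> 1" by blast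
next
  assume "x \<in> borel_measurable unit_leb \<and> (\<exists>l>0. modular F (\<lambda>t. x t / l) \<le> 1)"
  then obtain l where x: "x \<in> borel_measurable unit_leb" and l: "l > 0"
    and m: "modular F (\<lambda>t. x t / l) \<le> 1" by auto
  have "modular F (\<lambda>t. x t / l) = (\<integral>\<^sup>+ t. ennreal (F ((1 / l) * \<bar>x t\<bar>)) \<partial>unit_leb)"
    using l by (simp add: modular_def)
  then have "(\<integral>\<^sup>+ t. ennreal (F ((1 / l) * \<bar>x t\<bar>)) \<partial>unit_leb) < \<infinity>"
    using m by (metis ennreal_one_less_top infinity_ennreal_def order_le_less_trans)
  then show "x \<in> orlicz_space F" using x l
    unfolding orlicz_space_def by (auto intro!: exI[of _ "1 / l"])
qed

lemma orlicz_spaceD: "x \<in> orlicz_space F \<Longrightarrow> x \<in> borel_measurable unit_leb"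
  by (simp add: orlicz_space_modular)

lemma orlicz_norm_nonneg:
  assumes "x \<in> orlicz_space F" shows "0 \<le> orlicz_norm F x"
  unfolding orlicz_norm_modular
  by (rule cInf_greatest) (use assms in \<open>auto simp: orlicz_space_modular\<close>)

text \<open>The strict inequality avoids showing that the infimum is attained; later arguments
  approach the norm from above or work with a multiple of it.\<close>

lemma modular_le_oneI:
  assumes x: "x \<in> orlicz_space F" and l: "orlicz_norm F x < l"
  shows "modular F (\<lambda>t. x t / l) \<le> 1"
proof -
  have "{l. l > 0 \<and> modular F (\<lambda>t. x t / l) \<le> 1} \<noteq> {}"
    using x by (auto simp: orlicz_space_modular)
  from cInf_lessD[OF this] l obtain k where k: "k > 0" "modular F (\<lambda>t. x t / k) \<le> 1" "k < l"
    unfolding orlicz_norm_modular by auto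
  have "modular F (\<lambda>t. x t / l) \<le> modular F (\<lambda>t. x t / k)"
    by (rule modular_mono) (use k in \<open>auto intro!: divide_left_mono\<close>)
  then show ?thesis using k by simp
qed

lemma modular_gt_oneI: "0 < l \<Longrightarrow> l < orlicz_norm F x \<Longrightarrow> 1 < modular F (\<lambda>t. x t / l)"
  using orlicz_norm_le[of l F x] linorder_not_le by fastforce

lemma modular_le_one_mono:
  assumes "modular F (\<lambda>t. x t / k) \<le> 1" "0 < k" "k \<le> l"
  shows "modular F (\<lambda>t. x t / l) \<le> 1"
proof -
  have "modular F (\<lambda>t. x t / l) \<le> modular F (\<lambda>t. x t / k)"
    by (rule modular_mono) (use assms in \<open>auto intro!: divide_left_mono\<close>)
  then show ?thesis using assms by simp
qed

lemma orlicz_space_abs_le: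
  assumes "x \<in> orlicz_space F" "y \<in> borel_measurable unit_leb" "AE t in unit_leb. \<bar>y t\<bar> \<le> \<bar>x t\<bar>"
  shows "y \<in> orlicz_space F" "orlicz_norm F y \<le> orlicz_norm F x"
proof -
  have le: "modular F (\<lambda>t. y t / l) \<le> modular F (\<lambda>t. x t / l)" if "l > 0" for l
    by (rule modular_mono) (use assms(3) that in \<open>auto simp: divide_right_mono\<close>)
  show "y \<in> orlicz_space F"
    using assms(1,2) le by (auto simp: orlicz_space_modular intro: order_trans)
  show "orlicz_norm F y \<le> orlicz_norm F x"
  proof (rule dense_ge)
    fix l assume l: "orlicz_norm F x < l"
    then have "l > 0" using orlicz_norm_nonneg[OF assms(1)] by simp
    then show "orlicz_norm F y \<le> l"
      using modular_le_oneI[OF assms(1) l] le[of l] by (intro orlicz_norm_le) auto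
  qed
qed

lemma orlicz_norm_zero: "orlicz_norm F (\<lambda>t. 0) = 0"
proof -
  have "orlicz_norm F (\<lambda>t. 0) = Inf {0<..}"
    by (auto simp: orlicz_norm_modular modular_def greaterThan_def)
  then show ?thesis by simp
qed

lemma orlicz_space_add:
  assumes "x \<in> orlicz_space F" "y \<in> orlicz_space F"
  shows "(\<lambda>t. x t + y t) \<in> orlicz_space F"
proof -
  note [measurable] = assms[THEN orlicz_spaceD]
  obtain a b where ab: "a > 0" "b > 0" "modular F (\<lambda>t. x t / a) \<le> 1" "modular F (\<lambda>t. y t / b) \<le> 1"
    using assms by (auto simp: orlicz_space_modular)
  define l where "l = max a b"
  have l: "l > 0" "modular F (\<lambda>t. x t / l) \<le> 1" "modular F (\<lambda>t. y t / l) \<le> 1"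
    using ab modular_le_one_mono[of x a l] modular_le_one_mono[of y b l] by (auto simp: l_def)
  have "modular F (\<lambda>t. (x t + y t) / (2 * l)) \<le>
     (\<integral>\<^sup>+ t. ennreal (1/2) * (ennreal (F \<bar>x t / l\<bar>) + ennreal (F \<bar>y t / l\<bar>)) \<partial>unit_leb)"
    unfolding modular_def
  proof (rule nn_integral_mono)
    fix t
    have "F \<bar>(x t + y t) / (2 * l)\<bar> \<le> F ((1 - 1/2) *\<^sub>R \<bar>x t / l\<bar> + (1/2) *\<^sub>R \<bar>y t / l\<bar>)"
      using l by (intro F_mono) (auto simp: field_simps)
    also have "\<dots> \<le> (1 - 1/2) * F \<bar>x t / l\<bar> + (1/2) * F \<bar>y t / l\<bar>"
      by (rule convex_onD[OF F_convex]) auto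
    finally have "F \<bar>(x t + y t) / (2 * l)\<bar> \<le> 1/2 * (F \<bar>x t / l\<bar> + F \<bar>y t / l\<bar>)" by simp
    from ennreal_leI[OF this] show
      "ennreal (F \<bar>(x t + y t) / (2 * l)\<bar>) \<le> ennreal (1/2) * (ennreal (F \<bar>x t / l\<bar>) + ennreal (F \<bar>y t / l\<bar>))"
      by (subst (asm) ennreal_mult) (auto simp: F_nonneg ennreal_plus)
  qed
  also have "\<dots> = ennreal (1/2) * (modular F (\<lambda>t. x t / l) + modular F (\<lambda>t. y t / l))"
  proof -
    have [measurable]: "(\<lambda>t. F \<bar>x t / l\<bar>) \<in> borel_measurable unit_leb"
      "(\<lambda>t. F \<bar>y t / l\<bar>) \<in> borel_measurable unit_leb"
      by (intro F_measurable; measurable)+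
    show ?thesis unfolding modular_def
      by (subst nn_integral_cmult, measurable, subst nn_integral_add, measurable)
  qed
  also have "\<dots> \<le> ennreal (1/2) * (ennreal 1 + ennreal 1)"
    using l by (intro mult_left_mono add_mono) auto
  also have "\<dots> = ennreal (1/2 * (1 + 1))"
    by (subst ennreal_mult', simp, subst ennreal_plus, simp_all del: ennreal_1)
  also have "\<dots> = 1" by simp
  finally show ?thesis using l by (auto simp: orlicz_space_modular intro!: exI[of _ "2 * l"])
qed

lemma orlicz_space_zero: "(\<lambda>t. 0) \<in> orlicz_space F"
  by (auto simp: orlicz_space_modular modular_def intro!: exI[of _ 1])

lemma orlicz_space_sum:
  "(\<And>i. i \<in> I \<Longrightarrow> x i \<in> orlicz_space F) \<Longrightarrow> (\<lambda>t. \<Sum>i\<in>I. x i t) \<in> orlicz_space F"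
  by (induction I rule: infinite_finite_induct) (auto intro: orlicz_space_add orlicz_space_zero)

lemma unit_leb_const: "(\<integral>\<^sup>+ t. c \<partial>unit_leb) = c"
  by (simp add: emeasure_restrict_space)

lemma orlicz_space_bounded:
  assumes x: "x \<in> borel_measurable unit_leb" and B: "\<And>t. \<bar>x t\<bar> \<le> B"
  shows "x \<in> orlicz_space F"
proof -
  have "modular F x \<le> (\<integral>\<^sup>+ t. ennreal (F B) \<partial>unit_leb)"
    unfolding modular_def by (intro nn_integral_mono ennreal_leI F_mono B) auto
  also have "\<dots> \<le> ennreal (max 1 (F B))" unfolding unit_leb_const by (intro ennreal_leI) auto
  finally have "modular F (\<lambda>t. x t / max 1 (F B)) \<le> 1"
    by (intro modular_divide_le_one x) auto
  then show ?thesis using x by (auto simp: orlicz_space_modular intro!: exI[of _ "max 1 (F B)"])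
qed

end

section \<open>Consequences of doubling: finite and small modulars\<close>

locale orlicz_delta2 = orlicz +
  fixes D u1 :: real
  assumes D: "D \<ge> 1" and u1: "u1 > 0" "F u1 > 0" and F_double: "\<And>u. u \<ge> u1 \<Longrightarrow> F (2 * u) \<le> D * F u"
begin

lemma F_double_power: "u \<ge> u1 \<Longrightarrow> F (2 ^ j * u) \<le> D ^ j * F u"
proof (induction j)
  case (Suc j)
  have "1 * u1 \<le> 2 ^ j * u" using Suc.prems u1 by (intro mult_mono) auto
  then have "F (2 * (2 ^ j * u)) \<le> D * F (2 ^ j * u)" by (intro F_double) simp
  also have "\<dots> \<le> D * (D ^ j * F u)" using Suc D by (intro mult_left_mono) auto
  finally show ?case by (simp add: mult_ac)
qed simp

text \<open>Values above \<open>u1\<close> pay a power of \<open>D\<close> for a change of scale,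
  and values below it stay bounded on a space of measure one; so finiteness does not depend on the
  scale.\<close>

lemma modular_finite:
  assumes x: "x \<in> orlicz_space F" shows "modular F (\<lambda>t. x t / l) < \<infinity>"
proof -
  obtain k where k: "k > 0" "modular F (\<lambda>t. x t / k) \<le> 1"
    using x by (auto simp: orlicz_space_modular)
  have [measurable]: "x \<in> borel_measurable unit_leb" using x by (rule orlicz_spaceD)
  obtain j :: nat where j: "k / \<bar>l\<bar> < 2 ^ j" using real_arch_pow[of 2 "k / \<bar>l\<bar>"] by auto
  have "modular F (\<lambda>t. x t / l) \<le>
     (\<integral>\<^sup>+ t. ennreal (D ^ j) * ennreal (F \<bar>x t / k\<bar>) + ennreal (F (2 ^ j * u1)) \<partial>unit_leb)"
    unfolding modular_def
  proof (rule nn_integral_mono)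
    fix t
    have "\<bar>x t / l\<bar> = (k / \<bar>l\<bar>) * \<bar>x t / k\<bar>" using k by simp
    also have "\<dots> \<le> 2 ^ j * \<bar>x t / k\<bar>" using j by (intro mult_right_mono) auto
    finally have le: "F \<bar>x t / l\<bar> \<le> F (2 ^ j * \<bar>x t / k\<bar>)" by (intro F_mono) auto
    have "F \<bar>x t / l\<bar> \<le> D ^ j * F \<bar>x t / k\<bar> + F (2 ^ j * u1)"
    proof (cases "\<bar>x t / k\<bar> \<ge> u1")
      case True
      then show ?thesis using le F_double_power[OF True, of j] F_nonneg[of "2 ^ j * u1"] u1 by simp
    next
      case False
      then have "F (2 ^ j * \<bar>x t / k\<bar>) \<le> F (2 ^ j * u1)" by (intro F_mono mult_left_mono) auto
      then show ?thesis using le D F_nonneg[of "\<bar>x t / k\<bar>"]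
        by (smt (verit) abs_ge_zero mult_nonneg_nonneg zero_le_power)
    qed
    from ennreal_leI[OF this]
    show "ennreal (F \<bar>x t / l\<bar>) \<le> ennreal (D ^ j) * ennreal (F \<bar>x t / k\<bar>) + ennreal (F (2 ^ j * u1))"
      using D u1 by (simp add: F_nonneg ennreal_plus ennreal_mult)
  qed
  also have "\<dots> = ennreal (D ^ j) * modular F (\<lambda>t. x t / k) + ennreal (F (2 ^ j * u1))"
  proof -
    have [measurable]: "(\<lambda>t. F \<bar>x t / k\<bar>) \<in> borel_measurable unit_leb"
      by (intro F_measurable; measurable)+
    show ?thesis unfolding modular_def
      by (subst nn_integral_add, measurable, subst nn_integral_cmult, measurable, simp only: unit_leb_const)
  qed
  also have "\<dots> \<le> ennreal (D ^ j) * 1 + ennreal (F (2 ^ j * u1))"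
    using k by (intro add_mono mult_left_mono) auto
  also have "\<dots> < \<infinity>" by simp
  finally show ?thesis .
qed

text \<open>Convexity alone never turns a small modular into a small norm; doubling does, provided
  that the nonzero values avoid the range below \<open>u1\<close>.\<close>

lemma orlicz_norm_le_pow2:
  assumes x: "\<And>t. x t = 0 \<or> u1 \<le> \<bar>x t\<bar>" and [measurable]: "x \<in> borel_measurable unit_leb"
    and m: "modular F x \<le> ennreal (1 / D ^ j)"
  shows "orlicz_norm F x \<le> 1 / 2 ^ j"
proof (rule orlicz_norm_le)
  have "modular F (\<lambda>t. x t / (1 / 2 ^ j)) \<le> (\<integral>\<^sup>+ t. ennreal (D ^ j) * ennreal (F \<bar>x t\<bar>) \<partial>unit_leb)"
    unfolding modular_def
  proof (rule nn_integral_mono)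
    fix t
    have "F (2 ^ j * \<bar>x t\<bar>) \<le> D ^ j * F \<bar>x t\<bar>" using x[of t] F_double_power[of "\<bar>x t\<bar>" j] by auto
    from ennreal_leI[OF this]
    show "ennreal (F \<bar>x t / (1 / 2 ^ j)\<bar>) \<le> ennreal (D ^ j) * ennreal (F \<bar>x t\<bar>)"
      using D by (simp add: abs_mult mult.commute F_nonneg ennreal_mult)
  qed
  also have "\<dots> = ennreal (D ^ j) * modular F x"
    unfolding modular_def using F_measurable[OF assms(2)] by (intro nn_integral_cmult) auto
  also have "\<dots> \<le> ennreal (D ^ j) * ennreal (1 / D ^ j)" using m by (intro mult_left_mono) auto
  also have "\<dots> = 1" using D by (simp flip: ennreal_mult')
  finally show "modular F (\<lambda>t. x t / (1 / 2 ^ j)) \<le> 1" .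
qed simp

end

section \<open>From pointwise to norm estimates on cells\<close>

text \<open>The pointwise condition between both properties of the theorem.
  \<open>1 \<le> F u * W k\<close> says that a set of measure \<open>1 / F u\<close>, on which the
  constant \<open>u\<close> has norm one, fits in cell \<open>k\<close>. The constants must serve
  all cells; only the error may depend on \<open>k\<close>.\<close>

definition lp_like :: "(real \<Rightarrow> real) \<Rightarrow> (nat \<Rightarrow> real) \<Rightarrow> real \<Rightarrow> bool" where
  "lp_like F W p \<longleftrightarrow> (\<exists>C>0. \<exists>b. summable b \<and> (\<forall>k. 0 \<le> b k) \<and>
     (\<forall>k u s. 0 \<le> s \<longrightarrow> s \<le> 1 \<longrightarrow> 0 \<le> u \<longrightarrow> 1 \<le> F u * W k \<longrightarrow>
        F (s * u) \<le> (C * s powr p + b k) * F u \<and>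
        s powr p * F u \<le> C * F (s * u) + b k * F u))"

text \<open>Compensates for the strictness in \<open>modular_le_oneI\<close>: a bound for all
  \<open>l\<close> above the norm passes to the norm itself after taking \<open>p\<close>-th
  roots.\<close>

lemma le_powr_dense:
  fixes a x K p :: real
  assumes le: "\<And>l. a < l \<Longrightarrow> x \<le> K * l powr p" and nn: "0 \<le> x" "0 \<le> a" "0 < K" "0 < p"
  shows "x \<le> K * a powr p"
proof -
  have "(x / K) powr (1 / p) \<le> a"
  proof (rule dense_ge)
    fix l assume l: "a < l"
    have "(x / K) powr (1 / p) \<le> (l powr p) powr (1 / p)"
      using le[OF l] nn by (intro powr_mono2) (auto simp: field_simps)
    also have "\<dots> = l" using l nn by (simp add: powr_powr)
    finally show "(x / K) powr (1 / p) \<le> l" .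
  qed
  then have "((x / K) powr (1 / p)) powr p \<le> a powr p" using nn by (intro powr_mono2) auto
  then show ?thesis using nn by (simp add: powr_powr field_simps)
qed

text \<open>For the norm estimates the cells are just a countable partition up to null sets; the
  order of the values of \<open>w\<close> enters only in \<open>orlicz_weight\<close>.\<close>

locale orlicz_cells = orlicz_delta2 +
  fixes M :: "nat \<Rightarrow> real set"
  assumes M_sets: "M k \<in> sets lebesgue" and M_sub: "M k \<subseteq> {0..1}"
    and M_disjoint: "disjoint_family M" and M_pos: "0 < measure lebesgue (M k)"
    and M_cover: "AE t in unit_leb. \<exists>k. t \<in> M k"
begin

abbreviation W :: "nat \<Rightarrow> real" where "W k \<equiv> measure lebesgue (M k)"

lemma sets_unit_leb: "A \<in> sets lebesgue \<Longrightarrow> A \<subseteq> {0..1} \<Longrightarrow> A \<in> sets unit_leb"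
  by (simp add: sets_restrict_space_iff)

lemma M_unit [measurable]: "M k \<in> sets unit_leb"
  using M_sets M_sub by (rule sets_unit_leb)

lemma emeasure_unit_leb:
  assumes "A \<in> sets lebesgue" "A \<subseteq> {0..1}"
  shows "emeasure unit_leb A = ennreal (measure lebesgue A)"
proof -
  have "A \<in> lmeasurable" using assms by (meson bounded_closed_interval bounded_set_imp_lmeasurable bounded_subset)
  then show ?thesis using assms by (simp add: emeasure_restrict_space emeasure_eq_measure2)
qed

lemma summable_W: "summable W"
proof -
  interpret finite_measure unit_leb
    by (rule finite_measureI) (simp add: emeasure_restrict_space)
  have "(\<lambda>k. measure unit_leb (M k)) sums measure unit_leb (\<Union>k. M k)"
    using M_unit M_disjoint by (intro finite_measure_UNION) auto
  moreover have "measure unit_leb (M k) = W k" for k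
    using emeasure_unit_leb[OF M_sets M_sub] by (simp add: measure_def)
  ultimately show ?thesis by (simp add: sums_iff)
qed

lemma modular_cells:
  assumes [measurable]: "f \<in> borel_measurable unit_leb"
  shows "modular F f = (\<Sum>k. modular F (\<lambda>t. f t * indicat_real (M k) t))"
proof -
  have [measurable]: "(\<lambda>t. F \<bar>f t * indicat_real (M k) t\<bar>) \<in> borel_measurable unit_leb" for k
    by (intro F_measurable) measurable
  have "modular F f = (\<integral>\<^sup>+ t. (\<Sum>k. ennreal (F \<bar>f t * indicat_real (M k) t\<bar>)) \<partial>unit_leb)"
    unfolding modular_def
  proof (rule nn_integral_cong_AE, use M_cover in eventually_elim)
    fix t assume "\<exists>k. t \<in> M k"
    then obtain j where j: "t \<in> M j" by auto
    then have "t \<in> M k \<longleftrightarrow> k = j" for k using M_disjoint by (auto simp: disjoint_family_on_def)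
    then have "(\<lambda>k. ennreal (F \<bar>f t * indicat_real (M k) t\<bar>)) =
               (\<lambda>k. if k = j then ennreal (F \<bar>f t\<bar>) else 0)"
      by (auto simp: fun_eq_iff indicator_def)
    then show "ennreal (F \<bar>f t\<bar>) = (\<Sum>k. ennreal (F \<bar>f t * indicat_real (M k) t\<bar>))"
      using sums_unique[OF sums_single[of j "\<lambda>_. ennreal (F \<bar>f t\<bar>)"]] by simp
  qed
  also have "\<dots> = (\<Sum>k. \<integral>\<^sup>+ t. ennreal (F \<bar>f t * indicat_real (M k) t\<bar>) \<partial>unit_leb)"
    by (intro nn_integral_suminf) measurable
  finally show ?thesis by (simp add: modular_def)
qed

lemma nn_integral_cell_const: "(\<integral>\<^sup>+ t. ennreal (c * indicat_real (M k) t) \<partial>unit_leb) = ennreal (c * W k)"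
  if "c \<ge> 0" for c
proof -
  have "(\<integral>\<^sup>+ t. ennreal (c * indicat_real (M k) t) \<partial>unit_leb) = (\<integral>\<^sup>+ t. ennreal c * indicator (M k) t \<partial>unit_leb)"
    by (intro nn_integral_cong) (auto simp: indicator_def)
  also have "\<dots> = ennreal c * ennreal (W k)"
    by (simp add: nn_integral_cmult_indicator emeasure_unit_leb[OF M_sets M_sub])
  finally show ?thesis using that by (simp add: ennreal_mult)
qed

text \<open>Put \<open>g = \<bar>h\<bar> / l\<close>. Where \<open>F g \<ge> 1 / W k\<close> the
  hypothesis applies to \<open>g\<close> itself; elsewhere \<open>g\<close> is raised to the least
  admissible level, which adds \<open>1 / W k\<close> on a cell of measure \<open>W k\<close>, so
  one in total. The factor 2 is this one plus the modular of \<open>g\<close>.\<close>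

lemma cell_upper:
  assumes [measurable]: "h \<in> borel_measurable unit_leb"
    and up: "\<And>u s. 0 \<le> s \<Longrightarrow> s \<le> 1 \<Longrightarrow> 0 \<le> u \<Longrightarrow> 1 \<le> F u * W k \<Longrightarrow> F (s * u) \<le> (C * s powr p + b) * F u"
    and l: "0 < l" "l \<le> 1" and Cb: "0 \<le> C" "0 \<le> b"
    and m: "modular F (\<lambda>t. h t * indicat_real (M k) t / l) \<le> 1"
  shows "modular F (\<lambda>t. h t * indicat_real (M k) t) \<le> ennreal (2 * (C * l powr p + b))"
proof -
  define Q where "Q = C * l powr p + b"
  have Q: "Q \<ge> 0" using Cb by (simp add: Q_def)
  obtain v where v: "v > 0" "F v = 1 / W k" using F_attains[of "1 / W k"] M_pos[of k] by auto
  have [measurable]: "(\<lambda>t. F \<bar>h t * indicat_real (M k) t / l\<bar>) \<in> borel_measurable unit_leb"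
    by (intro F_measurable) measurable
  have "modular F (\<lambda>t. h t * indicat_real (M k) t) \<le>
      (\<integral>\<^sup>+ t. ennreal Q * (ennreal (F \<bar>h t * indicat_real (M k) t / l\<bar>) + ennreal (1 / W k * indicat_real (M k) t)) \<partial>unit_leb)"
    unfolding modular_def
  proof (rule nn_integral_mono)
    fix t
    define g where "g = \<bar>h t * indicat_real (M k) t / l\<bar>"
    have g: "g \<ge> 0" "\<bar>h t * indicat_real (M k) t\<bar> = l * g" using l by (auto simp: g_def)
    have "F (l * g) \<le> Q * (F g + 1 / W k * indicat_real (M k) t)"
    proof (cases "t \<in> M k")
      case False
      then show ?thesis by (simp add: g_def)
    next
      case True
      have "F (l * g) \<le> Q * (F g + 1 / W k)"
      proof (cases "1 \<le> F g * W k")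
        case True
        then have "F (l * g) \<le> Q * F g" using up[of l g] l g by (simp add: Q_def)
        also have "\<dots> \<le> Q * (F g + 1 / W k)" using Q M_pos[of k] by (intro mult_left_mono) auto
        finally show ?thesis .
      next
        case False
        then have "F g < F v" unfolding v(2) using M_pos[of k] by (simp add: pos_less_divide_eq)
        then have "g \<le> v" using F_mono[of v g] v by linarith
        then have "F (l * g) \<le> F (l * v)" using l g by (intro F_mono mult_left_mono) auto
        also have "\<dots> \<le> Q * F v" using up[of l v] l v M_pos[of k] by (simp add: Q_def)
        also have "\<dots> \<le> Q * (F g + 1 / W k)" using Q F_nonneg[OF g(1)] v by (intro mult_left_mono) auto
        finally show ?thesis .
      qed
      then show ?thesis using True by simp
    qed
    from ennreal_leI[OF this]
    show "ennreal (F \<bar>h t * indicat_real (M k) t\<bar>) \<le>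
       ennreal Q * (ennreal (F \<bar>h t * indicat_real (M k) t / l\<bar>) + ennreal (1 / W k * indicat_real (M k) t))"
      unfolding g(2) g_def[symmetric] using F_nonneg[OF g(1)] M_pos[of k] Q
      by (subst (asm) ennreal_mult) auto
  qed
  also have "\<dots> = ennreal Q * (modular F (\<lambda>t. h t * indicat_real (M k) t / l) + ennreal (1 / W k * W k))"
    unfolding modular_def using M_pos[of k]
    by (subst nn_integral_cmult, measurable, subst nn_integral_add, measurable)
       (subst nn_integral_cell_const, simp_all)
  also have "\<dots> \<le> ennreal Q * (ennreal 1 + ennreal 1)"
    using m M_pos[of k] by (intro mult_left_mono add_mono) auto
  also have "\<dots> = ennreal (Q * (1 + 1))" using Q
    by (subst ennreal_mult, simp, simp, subst ennreal_plus, simp_all del: ennreal_1)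
  finally show ?thesis by (simp add: Q_def mult.commute)
qed

text \<open>The hypothesis is used at \<open>4 g\<close> with \<open>g = \<bar>h\<bar> / l\<close>: by convexity \<open>F (4 g) \<ge> 4 F g\<close>, so the points
  where \<open>4 g\<close> is not admissible contribute at most \<open>1/4\<close> to the modular of \<open>g\<close>.\<close>

lemma cell_lower:
  assumes [measurable]: "h \<in> borel_measurable unit_leb"
    and lo: "\<And>u s. 0 \<le> s \<Longrightarrow> s \<le> 1 \<Longrightarrow> 0 \<le> u \<Longrightarrow> 1 \<le> F u * W k \<Longrightarrow> s powr p * F u \<le> C * F (s * u) + b * F u"
    and l: "0 < l" "l \<le> 1" and Cb: "0 \<le> C" "0 \<le> b"
    and m: "1 \<le> modular F (\<lambda>t. h t * indicat_real (M k) t / l)"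
           "modular F (\<lambda>t. h t * indicat_real (M k) t / l) < \<infinity>"
  shows "3 / 4 * (l / 4) powr p \<le> C * enn2real (modular F (\<lambda>t. h t * indicat_real (M k) t)) + b"
proof -
  define q where "q = (l / 4) powr p"
  have q: "q \<ge> 0" by (simp add: q_def)
  obtain i where i: "i \<ge> 0" "modular F (\<lambda>t. h t * indicat_real (M k) t / l) = ennreal i"
    using m(2) by (metis ennreal_cases infinity_ennreal_def less_irrefl)
  have i1: "i \<ge> 1" using m(1) i by (simp add: ennreal_le_iff flip: ennreal_1)
  have "modular F (\<lambda>t. h t * indicat_real (M k) t) \<le> modular F (\<lambda>t. h t * indicat_real (M k) t / l)"
  proof (rule modular_mono, rule AE_I2)
    fix t
    have "\<bar>h t * indicat_real (M k) t\<bar> * l \<le> \<bar>h t * indicat_real (M k) t\<bar> * 1"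
      using l by (intro mult_left_mono) auto
    then show "\<bar>h t * indicat_real (M k) t\<bar> \<le> \<bar>h t * indicat_real (M k) t / l\<bar>"
      using l by (simp add: field_simps)
  qed
  then obtain j where j: "j \<ge> 0" "modular F (\<lambda>t. h t * indicat_real (M k) t) = ennreal j"
    by (metis ennreal_cases i(2) ennreal_neq_top top.extremum_uniqueI)
  have [measurable]: "(\<lambda>t. F \<bar>h t * indicat_real (M k) t / l\<bar>) \<in> borel_measurable unit_leb"
     "(\<lambda>t. F \<bar>h t * indicat_real (M k) t\<bar>) \<in> borel_measurable unit_leb"
    by (intro F_measurable; measurable)+
  have "(\<integral>\<^sup>+ t. ennreal q * ennreal (F \<bar>h t * indicat_real (M k) t / l\<bar>) \<partial>unit_leb) \<le>
      (\<integral>\<^sup>+ t. ennreal C * ennreal (F \<bar>h t * indicat_real (M k) t\<bar>)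
            + (ennreal b * ennreal (F \<bar>h t * indicat_real (M k) t / l\<bar>) + ennreal (q / (4 * W k) * indicat_real (M k) t)) \<partial>unit_leb)"
  proof (rule nn_integral_mono)
    fix t
    define g where "g = \<bar>h t * indicat_real (M k) t / l\<bar>"
    have g: "g \<ge> 0" "\<bar>h t * indicat_real (M k) t\<bar> = l * g" using l by (auto simp: g_def)
    have Fg: "F g \<ge> 0" "F (l * g) \<ge> 0" using F_nonneg g l by auto
    have "q * F g \<le> C * F (l * g) + (b * F g + q / (4 * W k) * indicat_real (M k) t)"
    proof (cases "t \<in> M k")
      case False
      then show ?thesis by (simp add: g_def)
    next
      case True
      have "q * F g \<le> C * F (l * g) + (b * F g + q / (4 * W k))"
      proof (cases "1 \<le> 4 * F g * W k")
        case True
        have 4: "4 * F g \<le> F (4 * g)" using F_scale_ge[of 4 g] g by simp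
        have pos: "F g > 0" using True Fg by (cases "F g = 0") auto
        have "1 \<le> F (4 * g) * W k"
          using True 4 M_pos[of k] by (meson mult_right_mono less_imp_le order_trans)
        from lo[OF _ _ _ this, of "l / 4"] have "q * F (4 * g) \<le> C * F (l * g) + b * F (4 * g)"
          using l g by (simp add: q_def)
        then have "q \<le> C * F (l * g) / F (4 * g) + b" using 4 pos by (simp add: field_simps)
        also have "\<dots> \<le> C * F (l * g) / F g + b"
          using 4 pos Cb Fg by (intro add_right_mono divide_left_mono mult_nonneg_nonneg mult_pos_pos) auto
        finally have "q * F g \<le> C * F (l * g) + b * F g" using pos by (simp add: field_simps)
        then show ?thesis using q M_pos[of k] by (smt (verit) divide_nonneg_pos)
      next
        case False
        then have "F g \<le> 1 / (4 * W k)" using M_pos[of k] by (simp add: field_simps)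
        then have "q * F g \<le> q * (1 / (4 * W k))" using q by (intro mult_left_mono) auto
        moreover have "0 \<le> C * F (l * g)" "0 \<le> b * F g" using Cb Fg by auto
        ultimately show ?thesis by simp
      qed
      then show ?thesis using True by simp
    qed
    from ennreal_leI[OF this]
    show "ennreal q * ennreal (F \<bar>h t * indicat_real (M k) t / l\<bar>) \<le>
       ennreal C * ennreal (F \<bar>h t * indicat_real (M k) t\<bar>)
            + (ennreal b * ennreal (F \<bar>h t * indicat_real (M k) t / l\<bar>) + ennreal (q / (4 * W k) * indicat_real (M k) t))"
      unfolding g(2) g_def[symmetric] using Fg Cb q
      by (subst (asm) ennreal_plus, simp, simp)
         (subst (asm) ennreal_plus, simp, simp, simp add: ennreal_mult)
  qed
  then have "ennreal q * ennreal i \<le> ennreal C * ennreal j + (ennreal b * ennreal i + ennreal (q / (4 * W k) * W k))"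
    using q unfolding j(2)[symmetric] i(2)[symmetric] modular_def
    by (subst (asm) nn_integral_cmult, measurable, subst (asm) nn_integral_add, measurable,
        subst (asm) nn_integral_cmult, measurable, subst (asm) nn_integral_add, measurable)
      (subst (asm) nn_integral_cmult, measurable, subst (asm) nn_integral_cell_const, simp_all)
  also have "ennreal (q / (4 * W k) * W k) = ennreal (q / 4)" using M_pos[of k] by simp
  also have "ennreal C * ennreal j + (ennreal b * ennreal i + ennreal (q / 4)) = ennreal (C * j + (b * i + q / 4))"
    using Cb i j q by (simp add: ennreal_mult)
  finally have le: "q * i \<le> C * j + (b * i + q / 4)"
    using Cb i j q by (subst (asm) ennreal_mult[symmetric]) (simp_all del: ennreal_plus)
  \<comment> \<open>As \<open>i \<ge> 1\<close>, the amount \<open>q / 4\<close> lost at the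
    inadmissible points is at most a quarter of \<open>q * i\<close>.\<close>
  have "3 / 4 * q * i \<le> C * j + b * i"
  proof -
    have "q * 1 \<le> q * i" using q i1 by (intro mult_left_mono)
    then show ?thesis using le by simp
  qed
  \<comment> \<open>There is no a priori bound on \<open>i\<close>; giving \<open>C * j\<close> the
    factor \<open>i \<ge> 1\<close> as well lets it cancel.\<close>
  also have "\<dots> \<le> C * j * i + b * i" using Cb j i1 mult_left_mono[of 1 i "C * j"] by simp
  also have "\<dots> = (C * j + b) * i" by (simp add: algebra_simps)
  finally have "3 / 4 * q \<le> C * j + b" using i1 by simp
  then show ?thesis using j by (simp add: q_def)
qed

lemma cell_orlicz_space:
  assumes "f \<in> orlicz_space F"
  shows "(\<lambda>t. f t * indicat_real (M k) t) \<in> orlicz_space F"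
    "orlicz_norm F (\<lambda>t. f t * indicat_real (M k) t) \<le> orlicz_norm F f"
proof -
  have [measurable]: "f \<in> borel_measurable unit_leb" using assms by (rule orlicz_spaceD)
  have m: "(\<lambda>t. f t * indicat_real (M k) t) \<in> borel_measurable unit_leb" by measurable
  have le: "AE t in unit_leb. \<bar>f t * indicat_real (M k) t\<bar> \<le> \<bar>f t\<bar>"
    by (auto simp: indicator_def)
  from orlicz_space_abs_le[OF assms m le]
  show "(\<lambda>t. f t * indicat_real (M k) t) \<in> orlicz_space F"
    "orlicz_norm F (\<lambda>t. f t * indicat_real (M k) t) \<le> orlicz_norm F f" .
qed

theorem lp_like_norm_cells:
  assumes "lp_like F W p" "p > 0"
  shows "\<exists>K>0. \<forall>f\<in>orlicz_space F.
    summable (\<lambda>k. orlicz_norm F (\<lambda>t. f t * indicat_real (M k) t) powr p) \<and>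
    orlicz_norm F f powr p \<le> K * (\<Sum>k. orlicz_norm F (\<lambda>t. f t * indicat_real (M k) t) powr p) \<and>
    (\<Sum>k. orlicz_norm F (\<lambda>t. f t * indicat_real (M k) t) powr p) \<le> K * orlicz_norm F f powr p"
proof -
  obtain C b where C: "C > 0" and sb: "summable b" and b: "\<And>k. 0 \<le> b k"
    and up: "\<And>k u s. 0 \<le> s \<Longrightarrow> s \<le> 1 \<Longrightarrow> 0 \<le> u \<Longrightarrow> 1 \<le> F u * W k \<Longrightarrow> F (s * u) \<le> (C * s powr p + b k) * F u"
    and lo: "\<And>k u s. 0 \<le> s \<Longrightarrow> s \<le> 1 \<Longrightarrow> 0 \<le> u \<Longrightarrow> 1 \<le> F u * W k \<Longrightarrow> s powr p * F u \<le> C * F (s * u) + b k * F u"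
    using assms(1) unfolding lp_like_def by blast
  define B where "B = suminf b"
  have B: "B \<ge> 0" using sb b by (simp add: B_def suminf_nonneg)
  define N where "N = (\<lambda>f k. orlicz_norm F (\<lambda>t. f t * indicat_real (M k) t))"
  \<comment> \<open>The 8 is 2 times 4: half the cell norm is used below so that the modular exceeds
    one, and \<open>cell_lower\<close> divides by 4; \<open>4 / 3\<close> inverts its other
    factor.\<close>
  define K1 where "K1 = 8 powr p * (4 / 3) * (C + B)"
  \<comment> \<open>\<open>2 * (C + B)\<close> will bound the total modular; the maximum with 1
    allows division by it through convexity.\<close>
  define K0 where "K0 = max 1 (2 * (C + B))"
  have K1: "K1 > 0" using C B by (simp add: K1_def)
  have K0: "K0 \<ge> 1" by (simp add: K0_def)
  have partial: "(\<Sum>k<n. N f k powr p) \<le> K1 * orlicz_norm F f powr p" if f: "f \<in> orlicz_space F" for f n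
  proof (rule le_powr_dense)
    fix l assume l: "orlicz_norm F f < l"
    have l0: "l > 0" using l orlicz_norm_nonneg[OF f] by simp
    define h where "h = (\<lambda>t. f t / l)"
    have [measurable]: "f \<in> borel_measurable unit_leb" using f by (rule orlicz_spaceD)
    have hm [measurable]: "h \<in> borel_measurable unit_leb" unfolding h_def by measurable
    have h1: "modular F h \<le> 1" using modular_le_oneI[OF f l] by (simp add: h_def)
    define J where "J k = enn2real (modular F (\<lambda>t. h t * indicat_real (M k) t))" for k
    have J: "modular F (\<lambda>t. h t * indicat_real (M k) t) = ennreal (J k)" for k
    proof -
      have "modular F (\<lambda>t. h t * indicat_real (M k) t) \<le> modular F h"
        by (rule modular_mono) (auto simp: indicator_def)
      then show ?thesis using h1 unfolding J_def
        by (metis ennreal_enn2real ennreal_one_less_top order_le_less_trans)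
    qed
    have "ennreal (\<Sum>k<n. J k) = (\<Sum>k<n. modular F (\<lambda>t. h t * indicat_real (M k) t))"
      unfolding J by (rule sum_ennreal[symmetric]) (simp add: J_def)
    also have "\<dots> \<le> modular F h" unfolding modular_cells[OF hm] by (intro sum_le_suminf) auto
    also have "\<dots> \<le> ennreal 1" using h1 by simp
    finally have sumJ: "(\<Sum>k<n. J k) \<le> 1" by (subst (asm) ennreal_le_iff) auto
    have each: "N f k powr p \<le> (8 * l) powr p * (4 / 3) * (C * J k + b k)" for k
    proof (cases "N f k > 0")
      case False
      then have "N f k = 0" using orlicz_norm_nonneg[OF cell_orlicz_space(1)[OF f, of k]] by (simp add: N_def)
      then show ?thesis using C b by (simp add: J_def)
    next
      case True
      \<comment> \<open>With this \<open>s\<close>, dividing \<open>h\<close> by \<open>s\<close>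
        divides \<open>f\<close> by half its norm on the cell, which lies strictly below that norm
        and so forces a modular above one.\<close>
      define s where "s = N f k / (2 * l)"
      have s: "0 < s" "s \<le> 1" using True l0 l cell_orlicz_space(2)[OF f, of k]
        by (auto simp: s_def N_def field_simps)
      have eq: "(\<lambda>t. h t * indicat_real (M k) t / s) = (\<lambda>t. (f t * indicat_real (M k) t) / (N f k / 2))"
        using l0 by (simp add: h_def s_def fun_eq_iff)
      have "3 / 4 * (s / 4) powr p \<le> C * enn2real (modular F (\<lambda>t. h t * indicat_real (M k) t)) + b k"
      proof (rule cell_lower[OF hm lo s])
        show "1 \<le> modular F (\<lambda>t. h t * indicat_real (M k) t / s)"
          unfolding eq using modular_gt_oneI[of "N f k / 2" "\<lambda>t. f t * indicat_real (M k) t"] True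
          by (simp add: N_def less_imp_le)
        show "modular F (\<lambda>t. h t * indicat_real (M k) t / s) < \<infinity>"
          unfolding eq by (rule modular_finite[OF cell_orlicz_space(1)[OF f]])
      qed (use C b in \<open>auto simp: less_imp_le\<close>)
      then have "(s / 4) powr p \<le> 4 / 3 * (C * J k + b k)" by (simp add: J_def)
      then have "(8 * l) powr p * (s / 4) powr p \<le> (8 * l) powr p * (4 / 3 * (C * J k + b k))"
        by (intro mult_left_mono) auto
      moreover have "(8 * l) powr p * (s / 4) powr p = N f k powr p"
        using l0 s True by (subst powr_mult[symmetric]) (auto simp: s_def)
      ultimately show ?thesis by (simp add: algebra_simps)
    qed
    have "(\<Sum>k<n. N f k powr p) \<le> (\<Sum>k<n. (8 * l) powr p * (4 / 3) * (C * J k + b k))"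
      by (intro sum_mono each)
    also have "\<dots> = (8 * l) powr p * (4 / 3) * (C * (\<Sum>k<n. J k) + (\<Sum>k<n. b k))"
      by (simp only: sum_distrib_left[symmetric] sum.distrib)
    also have "\<dots> \<le> (8 * l) powr p * (4 / 3) * (C * 1 + B)"
      using sumJ C sum_le_suminf[OF sb, of "{..<n}"] b
      by (intro mult_left_mono add_mono) (auto simp: B_def)
    also have "\<dots> = K1 * l powr p" using l0 by (simp add: K1_def powr_mult)
    finally show "(\<Sum>k<n. N f k powr p) \<le> K1 * l powr p" .
  qed (use K1 assms(2) orlicz_norm_nonneg[OF f] in \<open>auto intro: sum_nonneg\<close>)
  have summable: "summable (\<lambda>k. N f k powr p)" if f: "f \<in> orlicz_space F" for f
    by (rule summableI_nonneg_bounded[of _ "K1 * orlicz_norm F f powr p"]) (use partial[OF f] in auto)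
  have lower: "(\<Sum>k. N f k powr p) \<le> K1 * orlicz_norm F f powr p" if f: "f \<in> orlicz_space F" for f
    using partial[OF f] summable[OF f] by (intro suminf_le_const) auto
  have upper: "orlicz_norm F f powr p \<le> (2 * K0) powr p * (\<Sum>k. N f k powr p)" if f: "f \<in> orlicz_space F" for f
  proof -
    define S where "S = (\<Sum>k. N f k powr p)"
    have S0: "S \<ge> 0" unfolding S_def by (intro suminf_nonneg summable f) auto
    have "orlicz_norm F f powr p / (2 * K0) powr p \<le> S"
    proof (rule dense_ge)
      fix R assume R: "S < R"
      then have R0: "R > 0" using S0 by simp
      \<comment> \<open>Chosen with \<open>(l / 2) powr p = R\<close>. Every cell norm is then at
        most \<open>l / 2\<close>, and the scales \<open>s = 2 * N f k / l\<close> satisfy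
        \<open>s powr p = N f k powr p / R\<close>, with sum \<open>S / R \<le> 1\<close>.\<close>
      define l where "l = 2 * R powr (1 / p)"
      have l: "l > 0" using R0 by (simp add: l_def)
      have lp: "(l / 2) powr p = R" using R0 assms(2) by (simp add: l_def powr_powr)
      define h where "h = (\<lambda>t. f t / l)"
      have [measurable]: "f \<in> borel_measurable unit_leb" using f by (rule orlicz_spaceD)
      have hm [measurable]: "h \<in> borel_measurable unit_leb" unfolding h_def by measurable
      have each: "modular F (\<lambda>t. h t * indicat_real (M k) t) \<le> ennreal (2 * (C * (N f k powr p / R) + b k))" for k
      proof (cases "N f k > 0")
        case True
        have "N f k powr p \<le> (l / 2) powr p"
          using sum_le_suminf[OF summable[OF f], of "{k}"] R unfolding lp S_def by simp
        then have le: "N f k \<le> l / 2"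
          using powr_less_mono2[of p "l / 2" "N f k"] assms(2) l by linarith
        define s where "s = 2 * N f k / l"
        have s: "0 < s" "s \<le> 1" using True le l by (auto simp: s_def)
        have eq: "(\<lambda>t. h t * indicat_real (M k) t / s) = (\<lambda>t. (f t * indicat_real (M k) t) / (2 * N f k))"
          using l by (simp add: h_def s_def fun_eq_iff)
        have "modular F (\<lambda>t. h t * indicat_real (M k) t) \<le> ennreal (2 * (C * s powr p + b k))"
        proof (rule cell_upper[OF hm up s])
          show "modular F (\<lambda>t. h t * indicat_real (M k) t / s) \<le> 1"
            unfolding eq by (rule modular_le_oneI[OF cell_orlicz_space(1)[OF f]]) (use True in \<open>simp add: N_def\<close>)
        qed (use C b in \<open>auto simp: less_imp_le\<close>)
        also have "s powr p = N f k powr p / R"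
        proof -
          have "s = N f k / (l / 2)" by (simp add: s_def)
          then show ?thesis using True l by (simp add: powr_divide powr_mult flip: lp)
        qed
        finally show ?thesis .
      next
        case False
        then have N0: "N f k = 0" using orlicz_norm_nonneg[OF cell_orlicz_space(1)[OF f, of k]] by (simp add: N_def)
        \<comment> \<open>A cell of norm zero has modular at most one at every scale, and convexity
          improves this to modular at most \<open>e\<close> for arbitrarily small
          \<open>e\<close>.\<close>
        have small: "modular F (\<lambda>t. h t * indicat_real (M k) t) \<le> ennreal e" if e: "0 < e" "e \<le> 1" for e
        proof -
          have "modular F (\<lambda>t. (f t * indicat_real (M k) t / (l * e)) / (1 / e)) \<le>
             ennreal (1 / (1 / e)) * modular F (\<lambda>t. f t * indicat_real (M k) t / (l * e))"
            using e by (intro modular_divide_le) auto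
          also have "\<dots> \<le> ennreal (1 / (1 / e)) * 1"
            using N0 l e by (intro mult_left_mono modular_le_oneI cell_orlicz_space f) (auto simp: N_def)
          finally show ?thesis using e l by (simp add: h_def)
        qed
        have "modular F (\<lambda>t. h t * indicat_real (M k) t) \<le> 0"
        proof (rule ennreal_le_epsilon)
          fix e :: real assume "e > 0"
          then have "modular F (\<lambda>t. h t * indicat_real (M k) t) \<le> ennreal (min 1 e)" by (intro small) auto
          also have "\<dots> \<le> 0 + ennreal e" by (auto intro: ennreal_leI)
          finally show "modular F (\<lambda>t. h t * indicat_real (M k) t) \<le> 0 + ennreal e" .
        qed
        then show ?thesis by simp
      qed
      have nn: "0 \<le> 2 * (C * (N f k powr p / R) + b k)" for k using C b R0 by simp
      have s1: "(\<lambda>k. 2 * (C * (N f k powr p / R) + b k)) sums (2 * (C * (S / R) + B))"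
        using summable_sums[OF summable[OF f]] summable_sums[OF sb] unfolding S_def B_def
        by (intro sums_mult sums_add sums_divide)
      have "modular F h \<le> (\<Sum>k. ennreal (2 * (C * (N f k powr p / R) + b k)))"
        unfolding modular_cells[OF hm] by (intro suminf_le each) auto
      also have "\<dots> = ennreal (2 * (C * (S / R) + B))"
        using s1 nn by (subst suminf_ennreal2) (auto simp: sums_iff)
      also have "\<dots> \<le> ennreal K0"
      proof (rule ennreal_leI)
        have "C * (S / R) \<le> C * 1" using C R R0 by (intro mult_left_mono) auto
        then show "2 * (C * (S / R) + B) \<le> K0" by (simp add: K0_def)
      qed
      finally have "modular F (\<lambda>t. h t / K0) \<le> 1" by (intro modular_divide_le_one hm K0)
      then have "orlicz_norm F f \<le> l * K0" using l K0 by (intro orlicz_norm_le) (auto simp: h_def)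
      then have "orlicz_norm F f powr p \<le> (l * K0) powr p"
        using orlicz_norm_nonneg[OF f] assms(2) by (intro powr_mono2) auto
      also have "l * K0 = (2 * K0) * (l / 2)" by simp
      also have "(\<dots>) powr p = (2 * K0) powr p * R" using K0 l by (simp only: powr_mult lp[symmetric])
      finally show "orlicz_norm F f powr p / (2 * K0) powr p \<le> R"
        using K0 by (simp add: field_simps)
    qed
    then show ?thesis using K0 by (simp add: S_def field_simps)
  qed
  show ?thesis
  proof (intro exI[of _ "max K1 ((2 * K0) powr p)"] conjI ballI)
    fix f assume f: "f \<in> orlicz_space F"
    show "orlicz_norm F f powr p \<le> max K1 ((2 * K0) powr p) * (\<Sum>k. orlicz_norm F (\<lambda>t. f t * indicat_real (M k) t) powr p)"
      using upper[OF f] suminf_nonneg[OF summable[OF f]] unfolding N_def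
      by (elim order_trans) (auto intro!: mult_right_mono)
    show "(\<Sum>k. orlicz_norm F (\<lambda>t. f t * indicat_real (M k) t) powr p) \<le> max K1 ((2 * K0) powr p) * orlicz_norm F f powr p"
      using lower[OF f] unfolding N_def by (elim order_trans) (auto intro!: mult_right_mono)
  qed (use summable K1 in \<open>auto simp: N_def\<close>)
qed

end

section \<open>Level sets of the weight and decomposability\<close>

lemma level_set_sets:
  assumes "w \<in> borel_measurable unit_leb" shows "level_set w k \<in> sets lebesgue"
proof -
  note [measurable] = assms
  have "{t \<in> space unit_leb. 2 powi k \<le> w t \<and> w t < 2 powi (k + 1)} \<in> sets unit_leb" by measurable
  moreover have "{t \<in> space unit_leb. 2 powi k \<le> w t \<and> w t < 2 powi (k + 1)} = level_set w k"
    by (auto simp: level_set_def)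
  ultimately show ?thesis by (auto simp: sets_restrict_space_iff)
qed

lemma level_set_disjoint:
  assumes "t \<in> level_set w j" "t \<in> level_set w k" shows "j = k"
proof -
  have "\<not> j < k" if "t \<in> level_set w j" "t \<in> level_set w k" for j k
  proof
    assume "j < k"
    then have "(2::real) powi (j + 1) \<le> 2 powi k" by (intro power_int_increasing) auto
    then show False using that by (auto simp: level_set_def)
  qed
  then show ?thesis using assms by (meson linorder_neqE)
qed

lemma level_set_exists:
  assumes "0 < w t" "t \<in> {0..1}" shows "\<exists>k. t \<in> level_set w k"
proof -
  define k where "k = \<lfloor>log 2 (w t)\<rfloor>"
  have "2 powr of_int k \<le> w t" using assms by (simp add: k_def flip: le_log_iff)
  moreover have "w t < 2 powr of_int (k + 1)" using assms floor_correct[of "log 2 (w t)"]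
    by (simp add: k_def flip: log_less_iff)
  ultimately have "t \<in> level_set w k" using assms(2) by (simp add: level_set_def flip: powr_real_of_int')
  then show ?thesis ..
qed

lemma AE_lebesgue_on_iff:
  assumes "S \<in> sets lebesgue"
  shows "(AE t in lebesgue_on S. P t) \<longleftrightarrow> (AE t in lebesgue. t \<in> S \<longrightarrow> P t)"
  using assms by (intro AE_restrict_space_iff) auto

lemma ess_sup_on_AE:
  assumes "S \<in> sets lebesgue" shows "AE t in lebesgue. t \<in> S \<longrightarrow> ereal (w t) \<le> ess_sup_on w S"
  using esssup_AE[of "\<lambda>t. ereal (w t)" "lebesgue_on S"] assms
  by (simp add: AE_lebesgue_on_iff ess_sup_on_def)

lemma ess_inf_on_AE:
  assumes "S \<in> sets lebesgue" shows "AE t in lebesgue. t \<in> S \<longrightarrow> ess_inf_on w S \<le> ereal (w t)"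
proof -
  have "AE t in lebesgue. t \<in> S \<longrightarrow> - ereal (w t) \<le> esssup (lebesgue_on S) (\<lambda>t. - ereal (w t))"
    using esssup_AE[of "\<lambda>t. - ereal (w t)" "lebesgue_on S"] assms by (simp add: AE_lebesgue_on_iff)
  then show ?thesis by eventually_elim (auto simp: ess_inf_on_def ereal_uminus_le_reorder)
qed

lemma borel_measurable_lebesgue_on_subset:
  assumes "w \<in> borel_measurable (lebesgue_on T)" "S \<subseteq> T"
  shows "w \<in> borel_measurable (lebesgue_on S)"
  using measurable_restrict_mono[OF assms] .

lemma ess_sup_on_le:
  assumes "w \<in> borel_measurable unit_leb" "S \<subseteq> {0..1}" "\<And>t. t \<in> S \<Longrightarrow> w t \<le> c"
  shows "ess_sup_on w S \<le> ereal c"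
proof -
  note [measurable] = borel_measurable_lebesgue_on_subset[OF assms(1,2)]
  show ?thesis unfolding ess_sup_on_def
    by (rule esssup_I) (use assms(3) in \<open>auto intro!: AE_I2\<close>)
qed

lemma ess_inf_on_ge:
  assumes "w \<in> borel_measurable unit_leb" "S \<subseteq> {0..1}" "\<And>t. t \<in> S \<Longrightarrow> c \<le> w t"
  shows "ereal c \<le> ess_inf_on w S"
proof -
  note [measurable] = borel_measurable_lebesgue_on_subset[OF assms(1,2)]
  have "esssup (lebesgue_on S) (\<lambda>t. - ereal (w t)) \<le> ereal (- c)"
    by (rule esssup_I) (use assms(3) in \<open>auto intro!: AE_I2\<close>)
  then show ?thesis unfolding ess_inf_on_def
    by (metis ereal_minus_le_minus ereal_uminus_uminus uminus_ereal.simps(1))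
qed

lemma supp_sets:
  assumes "x \<in> borel_measurable unit_leb" shows "supp x \<in> sets lebesgue"
proof -
  note [measurable] = assms
  have "{t \<in> space unit_leb. x t \<noteq> 0} \<in> sets unit_leb" by measurable
  moreover have "{t \<in> space unit_leb. x t \<noteq> 0} = supp x" by (auto simp: supp_def)
  ultimately show ?thesis by (auto simp: sets_restrict_space_iff)
qed

context orlicz_cells
begin

lemma lp_like_imp_lp_estimates:
  assumes "lp_like F W p" "p > 0" shows "lp_estimates F M p"
proof -
  obtain K where K: "K > 0"
    and all: "\<forall>f\<in>orlicz_space F.
      summable (\<lambda>k. orlicz_norm F (\<lambda>t. f t * indicat_real (M k) t) powr p) \<and>
      orlicz_norm F f powr p \<le> K * (\<Sum>k. orlicz_norm F (\<lambda>t. f t * indicat_real (M k) t) powr p) \<and>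
      (\<Sum>k. orlicz_norm F (\<lambda>t. f t * indicat_real (M k) t) powr p) \<le> K * orlicz_norm F f powr p"
    using lp_like_norm_cells[OF assms] by blast
  note sm = all[rule_format, THEN conjunct1]
    and up = all[rule_format, THEN conjunct2, THEN conjunct1]
    and lo = all[rule_format, THEN conjunct2, THEN conjunct2]
  show ?thesis unfolding lp_estimates_def
  proof (intro exI[of _ K] conjI K allI impI)
    fix n :: nat and A :: "nat \<Rightarrow> real set" and c :: "nat \<Rightarrow> real"
    assume A: "\<forall>k<n. A k \<in> sets lebesgue \<and> A k \<subseteq> M k"
    define f where "f = (\<lambda>t. \<Sum>k<n. c k * indicat_real (A k) t)"
    have Au: "A k \<in> sets unit_leb" if "k < n" for k
      using A M_sub that by (intro sets_unit_leb) blast+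
    have fm: "f \<in> borel_measurable unit_leb"
      unfolding f_def using Au by (intro borel_measurable_sum borel_measurable_times) auto
    have fb: "\<bar>f t\<bar> \<le> (\<Sum>k<n. \<bar>c k\<bar>)" for t
      unfolding f_def by (rule order_trans[OF sum_abs]) (auto intro!: sum_mono simp: indicator_def)
    have f: "f \<in> orlicz_space F" using fm fb by (rule orlicz_space_bounded)
    have cell: "(\<lambda>t. f t * indicat_real (M j) t) = (\<lambda>t. if j < n then c j * indicat_real (A j) t else 0)" for j
    proof
      fix t
      have "c k * indicat_real (A k) t * indicat_real (M j) t = (if k = j then c k * indicat_real (A k) t else 0)"
        if "k < n" for k
      proof -
        have "A k \<subseteq> M k" using A that by blast
        moreover have "k \<noteq> j \<Longrightarrow> M k \<inter> M j = {}" using M_disjoint by (auto simp: disjoint_family_on_def)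
        ultimately show ?thesis by (auto simp: indicator_def)
      qed
      then show "f t * indicat_real (M j) t = (if j < n then c j * indicat_real (A j) t else 0)"
        unfolding f_def sum_distrib_right by (simp add: sum.delta)
    qed
    have "(\<Sum>j. orlicz_norm F (\<lambda>t. f t * indicat_real (M j) t) powr p)
        = (\<Sum>j<n. orlicz_norm F (\<lambda>t. f t * indicat_real (M j) t) powr p)"
      by (rule suminf_finite) (auto simp: cell orlicz_norm_zero)
    also have "\<dots> = (\<Sum>k<n. orlicz_norm F (\<lambda>t. c k * indicat_real (A k) t) powr p)"
      by (intro sum.cong) (auto simp: cell)
    finally have eq: "(\<Sum>j. orlicz_norm F (\<lambda>t. f t * indicat_real (M j) t) powr p) = \<dots>" .
    show "inverse K * orlicz_norm F (\<lambda>t. \<Sum>k<n. c k * indicat_real (A k) t) powr p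
          \<le> (\<Sum>k<n. orlicz_norm F (\<lambda>t. c k * indicat_real (A k) t) powr p)"
      using up[OF f] K unfolding eq by (simp add: f_def field_simps)
    show "(\<Sum>k<n. orlicz_norm F (\<lambda>t. c k * indicat_real (A k) t) powr p)
          \<le> K * orlicz_norm F (\<lambda>t. \<Sum>k<n. c k * indicat_real (A k) t) powr p"
      using lo[OF f] unfolding eq by (simp add: f_def)
  qed
qed

text \<open>At most one summand survives on the cell, and the others contribute
  \<open>0 powr p = 0\<close>. \<open>i0\<close> may be at least \<open>n\<close>, which covers the
  case that all of them vanish.\<close>

lemma norm_cell_sum:
  fixes x :: "nat \<Rightarrow> real \<Rightarrow> real"
  assumes z: "\<And>i. i < n \<Longrightarrow> i \<noteq> i0 \<Longrightarrow> AE t in unit_leb. x i t * indicat_real (M k) t = 0"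
  shows "orlicz_norm F (\<lambda>t. (\<Sum>i<n. x i t) * indicat_real (M k) t) powr p
       = (\<Sum>i<n. orlicz_norm F (\<lambda>t. x i t * indicat_real (M k) t) powr p)"
proof -
  have "AE t in unit_leb. \<forall>i\<in>{..<n} - {i0}. x i t * indicat_real (M k) t = 0"
    using z by (intro AE_finite_allI) auto
  then have "AE t in unit_leb. (\<Sum>i<n. x i t) * indicat_real (M k) t = (if i0 < n then x i0 t * indicat_real (M k) t else 0)"
  proof eventually_elim
    case (elim t)
    have "(\<Sum>i<n. x i t) * indicat_real (M k) t = (\<Sum>i<n. if i = i0 then x i0 t * indicat_real (M k) t else 0)"
      unfolding sum_distrib_right using elim by (intro sum.cong) auto
    then show ?case by (simp add: sum.delta)
  qed
  then have L: "orlicz_norm F (\<lambda>t. (\<Sum>i<n. x i t) * indicat_real (M k) t)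
     = orlicz_norm F (\<lambda>t. if i0 < n then x i0 t * indicat_real (M k) t else 0)"
    by (rule orlicz_norm_cong_AE)
  have "orlicz_norm F (\<lambda>t. x i t * indicat_real (M k) t) powr p
     = (if i = i0 then orlicz_norm F (\<lambda>t. x i0 t * indicat_real (M k) t) powr p else 0)" if "i < n" for i
    using orlicz_norm_cong_AE[OF z[OF that]] by (auto simp: orlicz_norm_zero)
  then have "(\<Sum>i<n. orlicz_norm F (\<lambda>t. x i t * indicat_real (M k) t) powr p)
     = (if i0 < n then orlicz_norm F (\<lambda>t. x i0 t * indicat_real (M k) t) powr p else 0)"
    by (simp add: sum.delta)
  then show ?thesis using L by (simp add: orlicz_norm_zero)
qed

end

locale orlicz_weight = orlicz_cells +
  fixes w :: "real \<Rightarrow> real" and \<sigma> :: "nat \<Rightarrow> int"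
  assumes w_measurable: "w \<in> borel_measurable unit_leb"
    and w_pos: "AE t in unit_leb. 0 < w t"
    and M_level: "M k = level_set w (\<sigma> k)" and inj_\<sigma>: "inj \<sigma>"
begin

text \<open>On one cell the values of \<open>w\<close> have quotients strictly below 2, while on two
  different sets \<open>S i\<close> they are separated by a factor of at least 2; so a cell meets at
  most one of these sets in positive measure.\<close>

lemma separated_cells:
  fixes S :: "nat \<Rightarrow> real set"
  assumes S: "\<And>i. i < n \<Longrightarrow> S i \<in> sets lebesgue" "\<And>i. i < n \<Longrightarrow> S i \<subseteq> {0..1}"
    and nonnull: "\<And>i. i < n \<Longrightarrow> \<not> (AE t in lebesgue. t \<notin> S i)"
    and sep: "\<And>i. i + 1 < n \<Longrightarrow> 2 * ess_sup_on w (S (i + 1)) \<le> ess_inf_on w (S i)"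
  obtains i0 where "\<And>i. i < n \<Longrightarrow> i \<noteq> i0 \<Longrightarrow> AE t in lebesgue. t \<in> M k \<longrightarrow> t \<notin> S i"
proof -
  define a where "a i = ess_inf_on w (S i)" for i
  define b where "b i = ess_sup_on w (S i)" for i
  have pos: "AE t in lebesgue. t \<in> S i \<longrightarrow> 0 < w t" if "i < n" for i
    using w_pos S(2)[OF that] by (subst (asm) AE_lebesgue_on_iff) (auto elim!: eventually_mono)
  have a: "AE t in lebesgue. t \<in> S i \<longrightarrow> a i \<le> ereal (w t)" if "i < n" for i
    using ess_inf_on_AE[OF S(1)[OF that]] by (simp add: a_def)
  have b: "AE t in lebesgue. t \<in> S i \<longrightarrow> ereal (w t) \<le> b i" if "i < n" for i
    using ess_sup_on_AE[OF S(1)[OF that]] by (simp add: b_def)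
  \<comment> \<open>On a null set the essential infimum could exceed the essential supremum; being
    nonnull rules this out. Nonnegativity of \<open>b i\<close> is what gives
    \<open>b i \<le> 2 * b i\<close> along the chain.\<close>
  have ab: "a i \<le> b i \<and> 0 \<le> b i" if i: "i < n" for i
  proof (rule ccontr)
    assume n: "\<not> (a i \<le> b i \<and> 0 \<le> b i)"
    have "AE t in lebesgue. t \<notin> S i"
      using pos[OF i] a[OF i] b[OF i]
    proof eventually_elim
      case (elim t)
      show ?case
      proof
        assume "t \<in> S i"
        then have *: "a i \<le> ereal (w t)" "ereal (w t) \<le> b i" "0 \<le> ereal (w t)" using elim by auto
        then show False using n order_trans[OF *(1,2)] order_trans[OF *(3,2)] by auto
      qed
    qed
    then show False using nonnull[OF i] by blast
  qed
  have chain: "i < n \<Longrightarrow> j < n \<Longrightarrow> i < j \<Longrightarrow> 2 * b j \<le> a i" for i j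
  proof (induction j)
    case (Suc j)
    show ?case
    proof (cases "i = j")
      case True
      then show ?thesis using sep[of i] Suc.prems by (simp add: a_def b_def)
    next
      case False
      then have IH: "2 * b j \<le> a i" using Suc by auto
      have "2 * b (Suc j) \<le> a j" using sep[of j] Suc.prems by (simp add: a_def b_def)
      also have "\<dots> \<le> b j" using ab Suc.prems by simp
      also have "\<dots> \<le> 2 * b j" using ab[of j] Suc.prems by (cases "b j") auto
      finally show ?thesis using IH by simp
    qed
  qed simp
  have excl: False if i: "i < n" and j: "j < n" and ij: "i < j"
    and ni: "\<not> (AE t in lebesgue. t \<in> M k \<longrightarrow> t \<notin> S i)"
    and nj: "\<not> (AE t in lebesgue. t \<in> M k \<longrightarrow> t \<notin> S j)" for i j
  proof -
    obtain t where t: "t \<in> M k" "a i \<le> ereal (w t)"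
    proof (rule ccontr)
      assume "\<not> thesis"
      then have "\<And>t. t \<in> M k \<Longrightarrow> \<not> a i \<le> ereal (w t)" using that by blast
      then have "AE t in lebesgue. t \<in> M k \<longrightarrow> t \<notin> S i" using a[OF i] by (auto elim!: eventually_mono)
      then show False using ni by blast
    qed
    obtain t' where t': "t' \<in> M k" "ereal (w t') \<le> b j"
    proof (rule ccontr)
      assume "\<not> thesis"
      then have "\<And>t. t \<in> M k \<Longrightarrow> \<not> ereal (w t) \<le> b j" using that by blast
      then have "AE t in lebesgue. t \<in> M k \<longrightarrow> t \<notin> S j" using b[OF j] by (auto elim!: eventually_mono)
      then show False using nj by blast
    qed
    have "2 * ereal (w t') \<le> 2 * b j" using t' by (intro ereal_mult_left_mono) auto
    also have "\<dots> \<le> a i" using chain i j ij by blast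
    also have "\<dots> \<le> ereal (w t)" by fact
    finally have "2 * w t' \<le> w t" by simp
    moreover have "w t < 2 powi (\<sigma> k + 1)" "2 powi \<sigma> k \<le> w t'"
      using t t' by (auto simp: M_level level_set_def)
    ultimately show False by (simp add: power_int_add)
  qed
  show thesis
  proof (cases "\<exists>i<n. \<not> (AE t in lebesgue. t \<in> M k \<longrightarrow> t \<notin> S i)")
    case True
    then obtain i0 where i0: "i0 < n" "\<not> (AE t in lebesgue. t \<in> M k \<longrightarrow> t \<notin> S i0)" by blast
    show thesis
    proof (rule that[of i0], rule ccontr)
      fix i assume i: "i < n" "i \<noteq> i0" "\<not> (AE t in lebesgue. t \<in> M k \<longrightarrow> t \<notin> S i)"
      show False
      proof (cases "i < i0")
        case True
        then show False using excl[OF i(1) i0(1) _ i(3) i0(2)] by blast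
      next
        case False
        then have "i0 < i" using i(2) by simp
        then show False using excl[OF i0(1) i(1) _ i0(2) i(3)] by blast
      qed
    qed
  next
    case False
    then show thesis using that by blast
  qed
qed

theorem lp_like_imp_decomposable:
  assumes "lp_like F W p" "p > 0" shows "w_decomposable w (orlicz_space F) (orlicz_norm F)"
proof -
  obtain K where K: "K > 0"
    and all: "\<forall>f\<in>orlicz_space F.
      summable (\<lambda>k. orlicz_norm F (\<lambda>t. f t * indicat_real (M k) t) powr p) \<and>
      orlicz_norm F f powr p \<le> K * (\<Sum>k. orlicz_norm F (\<lambda>t. f t * indicat_real (M k) t) powr p) \<and>
      (\<Sum>k. orlicz_norm F (\<lambda>t. f t * indicat_real (M k) t) powr p) \<le> K * orlicz_norm F f powr p"
    using lp_like_norm_cells[OF assms] by blast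
  note sm = all[rule_format, THEN conjunct1]
    and up = all[rule_format, THEN conjunct2, THEN conjunct1]
    and lo = all[rule_format, THEN conjunct2, THEN conjunct2]
  \<comment> \<open>Passing from a sum to its cells and from the cells back to the summands costs
    \<open>K\<close> each time; this is done for \<open>x\<close> and for \<open>y\<close>, and then
    the \<open>p\<close>-th root is taken.\<close>
  define L where "L = (K ^ 4) powr (1 / p)"
  have L: "L > 0" using K by (simp add: L_def)
  have sums: "orlicz_norm F (\<lambda>t. \<Sum>i<n. x i t) powr p \<le> K\<^sup>2 * (\<Sum>i<n. orlicz_norm F (x i) powr p)"
      "(\<Sum>i<n. orlicz_norm F (x i) powr p) \<le> K\<^sup>2 * orlicz_norm F (\<lambda>t. \<Sum>i<n. x i t) powr p"
    if x: "\<And>i. i < n \<Longrightarrow> x i \<in> orlicz_space F"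
      and z: "\<And>k. \<exists>i0. \<forall>i<n. i \<noteq> i0 \<longrightarrow> (AE t in unit_leb. x i t * indicat_real (M k) t = 0)"
    for x :: "nat \<Rightarrow> real \<Rightarrow> real" and n
  proof -
    define N where "N = (\<lambda>f k. orlicz_norm F (\<lambda>t. f t * indicat_real (M k) t) powr p)"
    have xs: "(\<lambda>t. \<Sum>i<n. x i t) \<in> orlicz_space F" using x by (intro orlicz_space_sum) auto
    have eq: "N (\<lambda>t. \<Sum>i<n. x i t) k = (\<Sum>i<n. N (x i) k)" for k
    proof -
      obtain i0 where "\<forall>i<n. i \<noteq> i0 \<longrightarrow> (AE t in unit_leb. x i t * indicat_real (M k) t = 0)"
        using z by blast
      then show ?thesis unfolding N_def by (intro norm_cell_sum) auto
    qed
    have tot: "(\<Sum>k. N (\<lambda>t. \<Sum>i<n. x i t) k) = (\<Sum>i<n. \<Sum>k. N (x i) k)"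
      unfolding eq by (rule suminf_sum) (use x sm in \<open>auto simp: N_def\<close>)
    have "orlicz_norm F (\<lambda>t. \<Sum>i<n. x i t) powr p \<le> K * (\<Sum>i<n. \<Sum>k. N (x i) k)"
      using up[OF xs] tot by (simp add: N_def)
    also have "\<dots> \<le> K * (\<Sum>i<n. K * orlicz_norm F (x i) powr p)"
      using K x lo by (intro mult_left_mono sum_mono) (auto simp: N_def)
    also have "\<dots> = K\<^sup>2 * (\<Sum>i<n. orlicz_norm F (x i) powr p)"
      by (simp add: sum_distrib_left power2_eq_square mult.assoc)
    finally show "orlicz_norm F (\<lambda>t. \<Sum>i<n. x i t) powr p \<le> K\<^sup>2 * (\<Sum>i<n. orlicz_norm F (x i) powr p)" .
    have "(\<Sum>i<n. orlicz_norm F (x i) powr p) \<le> (\<Sum>i<n. K * (\<Sum>k. N (x i) k))"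
      using x up by (intro sum_mono) (auto simp: N_def)
    also have "\<dots> = K * (\<Sum>k. N (\<lambda>t. \<Sum>i<n. x i t) k)" by (simp add: tot sum_distrib_left)
    also have "\<dots> \<le> K * (K * orlicz_norm F (\<lambda>t. \<Sum>i<n. x i t) powr p)"
      using K lo[OF xs] by (intro mult_left_mono) (auto simp: N_def)
    finally show "(\<Sum>i<n. orlicz_norm F (x i) powr p) \<le> K\<^sup>2 * orlicz_norm F (\<lambda>t. \<Sum>i<n. x i t) powr p"
      by (simp add: power2_eq_square mult.assoc)
  qed
  have compare: "orlicz_norm F (\<lambda>t. \<Sum>i<n. y i t) \<le> L * orlicz_norm F (\<lambda>t. \<Sum>i<n. x i t)"
    if x: "\<And>i. i < n \<Longrightarrow> x i \<in> orlicz_space F" and y: "\<And>i. i < n \<Longrightarrow> y i \<in> orlicz_space F"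
      and zx: "\<And>k. \<exists>i0. \<forall>i<n. i \<noteq> i0 \<longrightarrow> (AE t in unit_leb. x i t * indicat_real (M k) t = 0)"
      and zy: "\<And>k. \<exists>i0. \<forall>i<n. i \<noteq> i0 \<longrightarrow> (AE t in unit_leb. y i t * indicat_real (M k) t = 0)"
      and eq: "\<And>i. i < n \<Longrightarrow> orlicz_norm F (x i) = orlicz_norm F (y i)"
    for x y :: "nat \<Rightarrow> real \<Rightarrow> real" and n
  proof -
    define X where "X = orlicz_norm F (\<lambda>t. \<Sum>i<n. x i t)"
    define Y where "Y = orlicz_norm F (\<lambda>t. \<Sum>i<n. y i t)"
    have nn: "X \<ge> 0" "Y \<ge> 0" unfolding X_def Y_def
      using x y by (auto intro!: orlicz_norm_nonneg orlicz_space_sum)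
    have "Y powr p \<le> K\<^sup>2 * (\<Sum>i<n. orlicz_norm F (y i) powr p)"
      unfolding Y_def by (rule sums(1)[OF y zy])
    also have "\<dots> = K\<^sup>2 * (\<Sum>i<n. orlicz_norm F (x i) powr p)" using eq by simp
    also have "\<dots> \<le> K\<^sup>2 * (K\<^sup>2 * X powr p)"
      unfolding X_def by (intro mult_left_mono sums(2)[OF x zx]) auto
    finally have "Y powr p \<le> K ^ 4 * X powr p" by (simp add: power2_eq_square power4_eq_xxxx mult.assoc)
    then have "(Y powr p) powr (1 / p) \<le> (K ^ 4 * X powr p) powr (1 / p)"
      using assms(2) by (intro powr_mono2) auto
    then show ?thesis using nn assms(2) K by (simp add: powr_mult powr_powr L_def X_def Y_def)
  qed
  show ?thesis unfolding w_decomposable_def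
  proof (intro exI[of _ L] conjI L allI impI; elim conjE)
    fix n :: nat and x y :: "nat \<Rightarrow> real \<Rightarrow> real"
    assume A: "\<forall>i<n. x i \<in> orlicz_space F \<and> y i \<in> orlicz_space F \<and>
         \<not> (AE t in unit_leb. x i t = 0) \<and> \<not> (AE t in unit_leb. y i t = 0) \<and>
         orlicz_norm F (x i) = orlicz_norm F (y i)"
      and sep: "\<forall>i. i + 1 < n \<longrightarrow>
         2 * ess_sup_on w (supp (x (i + 1)) \<union> supp (y (i + 1))) \<le> ess_inf_on w (supp (x i) \<union> supp (y i))"
    define S where "S i = supp (x i) \<union> supp (y i)" for i
    have z: "\<exists>i0. \<forall>i<n. i \<noteq> i0 \<longrightarrow> (AE t in lebesgue. t \<in> M k \<longrightarrow> t \<notin> S i)" for k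
    proof (rule separated_cells[of n S k])
      fix i assume i: "i < n"
      show "S i \<in> sets lebesgue" unfolding S_def using A i by (intro sets.Un supp_sets orlicz_spaceD) auto
      show "S i \<subseteq> {0..1}" by (auto simp: S_def supp_def)
      show "\<not> (AE t in lebesgue. t \<notin> S i)"
      proof
        assume "AE t in lebesgue. t \<notin> S i"
        then have "AE t in unit_leb. x i t = 0"
          by (subst AE_lebesgue_on_iff) (auto elim!: eventually_mono simp: S_def supp_def)
        then show False using A i by blast
      qed
    qed (use sep in \<open>auto simp: S_def\<close>)
    have zx: "\<exists>i0. \<forall>i<n. i \<noteq> i0 \<longrightarrow> (AE t in unit_leb. x i t * indicat_real (M k) t = 0)"
      and zy: "\<exists>i0. \<forall>i<n. i \<noteq> i0 \<longrightarrow> (AE t in unit_leb. y i t * indicat_real (M k) t = 0)" for k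
    proof -
      obtain i0 where i0: "\<forall>i<n. i \<noteq> i0 \<longrightarrow> (AE t in lebesgue. t \<in> M k \<longrightarrow> t \<notin> S i)" using z by blast
      have "(AE t in unit_leb. x i t * indicat_real (M k) t = 0) \<and> (AE t in unit_leb. y i t * indicat_real (M k) t = 0)"
        if "i < n" "i \<noteq> i0" for i
      proof -
        have "AE t in lebesgue. t \<in> M k \<longrightarrow> t \<notin> S i" using i0 that by blast
        then have "AE t in lebesgue. t \<in> {0..1} \<longrightarrow> x i t * indicat_real (M k) t = 0"
          "AE t in lebesgue. t \<in> {0..1} \<longrightarrow> y i t * indicat_real (M k) t = 0"
          by (eventually_elim, auto simp: S_def supp_def indicator_def)+
        then show ?thesis by (simp add: AE_lebesgue_on_iff)
      qed
      then show "\<exists>i0. \<forall>i<n. i \<noteq> i0 \<longrightarrow> (AE t in unit_leb. x i t * indicat_real (M k) t = 0)"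
        "\<exists>i0. \<forall>i<n. i \<noteq> i0 \<longrightarrow> (AE t in unit_leb. y i t * indicat_real (M k) t = 0)" by blast+
    qed
    show "orlicz_norm F (\<lambda>t. \<Sum>i<n. y i t) \<le> L * orlicz_norm F (\<lambda>t. \<Sum>i<n. x i t)"
      using A by (intro compare zx zy) auto
    have "orlicz_norm F (\<lambda>t. \<Sum>i<n. x i t) \<le> L * orlicz_norm F (\<lambda>t. \<Sum>i<n. y i t)"
      using A by (intro compare zx zy) auto
    then show "inverse L * orlicz_norm F (\<lambda>t. \<Sum>i<n. x i t) \<le> orlicz_norm F (\<lambda>t. \<Sum>i<n. y i t)"
      using L by (simp add: field_simps)
  qed
qed

end

section \<open>From norm estimates to pointwise estimates\<close>

text \<open>\<open>b k\<close> is the supremum of the values \<open>x\<close> that violate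
  \<open>x \<le> C * y\<close> in position \<open>k\<close>. For violators of more than half that
  size, every finite partial sum stays below one, hence the total of \<open>b\<close> is at most
  two.\<close>

lemma summable_selection:
  fixes P :: "nat \<Rightarrow> real \<Rightarrow> real \<Rightarrow> bool"
  assumes C: "0 \<le> C" and le1: "\<And>k x y. P k x y \<Longrightarrow> x \<le> 1" and nn: "\<And>k x y. P k x y \<Longrightarrow> 0 \<le> y"
    and no: "\<And>R X Y. finite R \<Longrightarrow> (\<And>k. k \<in> R \<Longrightarrow> P k (X k) (Y k)) \<Longrightarrow> C * sum Y R \<le> sum X R \<Longrightarrow>
       1 \<le> sum X R \<Longrightarrow> sum X R \<le> 2 \<Longrightarrow> False"
  shows "\<exists>b. summable b \<and> (\<forall>k. 0 \<le> b k) \<and> (\<forall>k x y. P k x y \<longrightarrow> x \<le> C * y + b k)"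
proof -
  define V where "V k = {x. \<exists>y. P k x y \<and> C * y < x}" for k
  define b where "b k = (if V k = {} then 0 else Sup (V k))" for k
  have bdd: "bdd_above (V k)" for k by (rule bdd_aboveI[of _ 1]) (auto simp: V_def le1)
  have V_le: "x \<le> b k" if "x \<in> V k" for x k
    using that bdd by (auto simp: b_def intro: cSup_upper)
  have V_pos: "0 < x" if "x \<in> V k" for x k
    using that C nn by (auto simp: V_def intro: order_le_less_trans[rotated])
  have b_nn: "0 \<le> b k" for k
  proof (cases "V k = {}")
    case False
    then obtain x where "x \<in> V k" by auto
    then show ?thesis using V_pos V_le by (meson less_imp_le order_trans)
  qed (simp add: b_def)
  have "\<exists>x y. P k x y \<and> C * y < x \<and> b k < 2 * x" if ne: "V k \<noteq> {}" for k
  proof -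
    obtain x0 where x0: "x0 \<in> V k" using ne by auto
    have "b k / 2 < Sup (V k)" using ne V_pos[OF x0] V_le[OF x0] by (auto simp: b_def)
    then obtain x where "x \<in> V k" "b k / 2 < x" using less_cSupD[OF ne] by blast
    then have "\<exists>y. P k x y \<and> C * y < x" "b k < 2 * x" by (auto simp: V_def)
    then show ?thesis by blast
  qed
  then obtain X Y where XY: "\<And>k. V k \<noteq> {} \<Longrightarrow> P k (X k) (Y k) \<and> C * Y k < X k \<and> b k < 2 * X k"
    by metis
  \<comment> \<open>Violators are added one at a time. Since each is at most one, the first sum to
    reach 1 would still be at most 2, and this is exactly the block that \<open>no\<close>
    excludes.\<close>
  have lt1: "sum X R < 1" if "finite R" "\<And>k. k \<in> R \<Longrightarrow> V k \<noteq> {}" for R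
    using that
  proof (induction R rule: finite_induct)
    case (insert r R)
    have IH: "sum X R < 1" using insert by auto
    have "C * sum Y (insert r R) \<le> sum X (insert r R)"
      unfolding sum_distrib_left using insert.prems XY by (intro sum_mono) (auto simp: less_imp_le)
    moreover have "sum X (insert r R) \<le> 2" using insert IH le1[of r "X r" "Y r"] XY[of r] by simp
    moreover have "P k (X k) (Y k)" if "k \<in> insert r R" for k using XY insert.prems that by blast
    ultimately show ?case using no[of "insert r R" X Y] insert.hyps by fastforce
  qed simp
  have "summable b"
  proof (rule summableI_nonneg_bounded[of _ 2])
    fix n
    have "sum b {..<n} = sum b {k \<in> {..<n}. V k \<noteq> {}}"
      by (rule sum.mono_neutral_right) (auto simp: b_def)
    also have "\<dots> \<le> (\<Sum>k\<in>{k \<in> {..<n}. V k \<noteq> {}}. 2 * X k)" using XY by (intro sum_mono) (auto simp: less_imp_le)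
    also have "\<dots> = 2 * sum X {k \<in> {..<n}. V k \<noteq> {}}" by (simp add: sum_distrib_left)
    also have "\<dots> \<le> 2 * 1" by (intro mult_left_mono less_imp_le lt1) auto
    finally show "sum b {..<n} \<le> 2" by simp
  qed (rule b_nn)
  moreover have "x \<le> C * y + b k" if "P k x y" for k x y
  proof (cases "C * y < x")
    case True
    then have "x \<le> b k" using that by (intro V_le) (auto simp: V_def)
    then show ?thesis using C nn[OF that] by (meson add_increasing mult_nonneg_nonneg)
  next
    case False
    then show ?thesis using b_nn[of k] by simp
  qed
  ultimately show ?thesis using b_nn by blast
qed

text \<open>The measure of \<open>A \<inter> {0..s}\<close> is 1-Lipschitz in \<open>s\<close>, so
  it takes every intermediate value.\<close>

lemma subset_of_measure:
  fixes A :: "real set"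
  assumes A: "A \<in> sets lebesgue" "A \<subseteq> {0..1}" and a: "0 \<le> a" "a \<le> measure lebesgue A"
  obtains B where "B \<subseteq> A" "B \<in> sets lebesgue" "measure lebesgue B = a"
proof -
  define m where "m s = measure lebesgue (A \<inter> {0..s})" for s :: real
  have meas: "A \<inter> I \<in> lmeasurable" if "I \<in> sets lebesgue" for I
    using A that by (intro bounded_set_imp_lmeasurable) (auto intro: bounded_subset[of "{0..1::real}"])
  have lip: "\<bar>m s - m r\<bar> \<le> s - r" if "r \<le> s" for r s
  proof -
    note meas_sets = fmeasurableD[OF meas]
    have "m s \<le> measure lebesgue ((A \<inter> {0..r}) \<union> (A \<inter> {r..s}))" unfolding m_def
      by (intro measure_mono_fmeasurable fmeasurable.Un meas meas_sets) auto
    also have "\<dots> \<le> m r + measure lebesgue (A \<inter> {r..s})"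
      unfolding m_def by (intro measure_Un_le meas_sets) auto
    also have "measure lebesgue (A \<inter> {r..s}) \<le> measure lebesgue {r..s}"
      by (intro measure_mono_fmeasurable meas_sets) auto
    finally have "m s \<le> m r + (s - r)" using that by simp
    moreover have "m r \<le> m s" unfolding m_def
      using that by (intro measure_mono_fmeasurable meas meas_sets) auto
    ultimately show ?thesis by simp
  qed
  have "1-lipschitz_on UNIV m"
  proof (rule lipschitz_onI)
    fix x y show "dist (m x) (m y) \<le> 1 * dist x y"
      using lip[of x y] lip[of y x] by (cases "x \<le> y") (auto simp: dist_real_def abs_minus_commute)
  qed simp
  then have "continuous_on UNIV m" by (rule lipschitz_on_continuous_on)
  moreover have "m 0 \<le> a"
  proof -
    have "m 0 \<le> measure lebesgue {0..0::real}" unfolding m_def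
      by (intro measure_mono_fmeasurable fmeasurableD[OF meas] bounded_set_imp_lmeasurable) auto
    then show ?thesis using a by simp
  qed
  moreover have "a \<le> m 1" using a A by (simp add: m_def Int_absorb2)
  ultimately obtain s where "m s = a" using IVT'[of m 0 a 1] by (auto intro: continuous_on_subset)
  then show thesis using A by (intro that[of "A \<inter> {0..s}"]) (auto simp: m_def)
qed

section \<open>Normalised indicators and their sums\<close>

context orlicz_cells
begin

definition admissible :: "nat \<Rightarrow> real \<Rightarrow> bool" where
  "admissible k u \<longleftrightarrow> 0 \<le> u \<and> 1 \<le> F u * W k"

text \<open>Its measure \<open>1 / F u\<close> is what makes \<open>s * u\<close> times its
  indicator a function of norm \<open>s\<close>. Which subset of the cell is chosen is immaterial
  for modulars.\<close>

definition piece :: "nat \<Rightarrow> real \<Rightarrow> real set" where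
  "piece k u = (SOME A. A \<subseteq> M k \<and> A \<in> sets lebesgue \<and> F u * measure lebesgue A = 1)"

definition bumps :: "nat set \<Rightarrow> (nat \<Rightarrow> real) \<Rightarrow> (nat \<Rightarrow> real) \<Rightarrow> real \<Rightarrow> real" where
  "bumps R s u = (\<lambda>t. \<Sum>k\<in>R. s k * u k * indicat_real (piece k (u k)) t)"

lemma admissible_pos: "admissible k u \<Longrightarrow> 0 < F u" "admissible k u \<Longrightarrow> 0 < u"
proof -
  show *: "0 < F u" if "admissible k u"
    using that F_nonneg[of u] by (cases "F u = 0") (auto simp: admissible_def)
  show "0 < u" if "admissible k u" using *[OF that] that by (cases "u = 0") (auto simp: admissible_def)
qed

lemma admissible_inverse_le: "admissible k u \<Longrightarrow> 1 / F u \<le> W k"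
  using admissible_pos(1)[of k u] by (simp add: admissible_def field_simps)

lemma piece:
  assumes "admissible k u"
  shows "piece k u \<subseteq> M k" "piece k u \<in> sets lebesgue" "F u * measure lebesgue (piece k u) = 1"
proof -
  have "\<exists>A. A \<subseteq> M k \<and> A \<in> sets lebesgue \<and> F u * measure lebesgue A = 1"
  proof (rule subset_of_measure[OF M_sets M_sub, of "1 / F u" k])
    fix B assume "B \<subseteq> M k" "B \<in> sets lebesgue" "measure lebesgue B = 1 / F u"
    then show ?thesis using admissible_pos[OF assms] by (auto intro!: exI[of _ B])
  qed (use admissible_pos[OF assms] admissible_inverse_le[OF assms] in auto)
  from someI_ex[OF this] show "piece k u \<subseteq> M k" "piece k u \<in> sets lebesgue" "F u * measure lebesgue (piece k u) = 1"
    unfolding piece_def by auto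
qed

lemma piece_unit: "admissible k u \<Longrightarrow> piece k u \<in> sets unit_leb"
  using piece[of k u] M_sub[of k] by (intro sets_unit_leb) auto

lemma norm_piece:
  assumes u: "admissible k u" and s: "0 \<le> s"
  shows "orlicz_norm F (\<lambda>t. s * u * indicat_real (piece k u) t) = s"
proof -
  have m: "modular F (\<lambda>t. s * u * indicat_real (piece k u) t / l) = ennreal (F (s * u / l) / F u)" if "l > 0" for l
  proof -
    have "modular F (\<lambda>t. s * u * indicat_real (piece k u) t / l)
        = (\<integral>\<^sup>+ t. ennreal (F (s * u / l)) * indicator (piece k u) t \<partial>unit_leb)"
      unfolding modular_def using that s admissible_pos(2)[OF u]
      by (intro nn_integral_cong) (auto simp: indicator_def)
    also have "\<dots> = ennreal (F (s * u / l)) * emeasure unit_leb (piece k u)"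
      using piece_unit[OF u] by (simp add: nn_integral_cmult_indicator)
    also have "\<dots> = ennreal (F (s * u / l)) * ennreal (measure lebesgue (piece k u))"
      using piece[OF u] M_sub[of k] by (subst emeasure_unit_leb) auto
    also have "\<dots> = ennreal (F (s * u / l) * measure lebesgue (piece k u))" by (rule ennreal_mult''[symmetric]) simp
    also have "measure lebesgue (piece k u) = 1 / F u"
      using piece(3)[OF u] admissible_pos(1)[OF u] by (simp add: field_simps)
    finally show ?thesis by simp
  qed
  have iff: "modular F (\<lambda>t. s * u * indicat_real (piece k u) t / l) \<le> 1 \<longleftrightarrow> s \<le> l" if l: "l > 0" for l
  proof -
    have "modular F (\<lambda>t. s * u * indicat_real (piece k u) t / l) \<le> ennreal 1 \<longleftrightarrow> F (s * u / l) / F u \<le> 1"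
      unfolding m[OF l] by (rule ennreal_le_iff) simp
    also have "\<dots> \<longleftrightarrow> F (s * u / l) \<le> F u" using admissible_pos(1)[OF u] by simp
    also have "\<dots> \<longleftrightarrow> s * u / l \<le> u" using s l admissible_pos[OF u] by (intro F_le_iff) auto
    also have "\<dots> \<longleftrightarrow> s \<le> l" using l admissible_pos(2)[OF u] by (simp add: field_simps)
    finally show ?thesis by simp
  qed
  have "{l. l > 0 \<and> modular F (\<lambda>t. s * u * indicat_real (piece k u) t / l) \<le> 1} = {l. 0 < l \<and> s \<le> l}"
    using iff by auto
  also have "\<dots> = (if s = 0 then {0<..} else {s..})" using s by auto
  finally show ?thesis unfolding orlicz_norm_modular by simp
qed

lemma bumps_space:
  assumes "finite R" "\<And>k. k \<in> R \<Longrightarrow> admissible k (u k)"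
  shows "bumps R s u \<in> orlicz_space F"
proof (rule orlicz_space_bounded)
  show "bumps R s u \<in> borel_measurable unit_leb"
    unfolding bumps_def using assms piece_unit by (intro borel_measurable_sum borel_measurable_times) auto
  show "\<bar>bumps R s u t\<bar> \<le> (\<Sum>k\<in>R. \<bar>s k * u k\<bar>)" for t
    unfolding bumps_def by (rule order_trans[OF sum_abs]) (auto intro!: sum_mono simp: indicator_def)
qed

lemma bumps_cases:
  assumes R: "finite R" "\<And>k. k \<in> R \<Longrightarrow> admissible k (u k)"
  shows "(bumps R s u t = 0 \<and> (\<forall>k\<in>R. t \<notin> piece k (u k))) \<or>
    (\<exists>j\<in>R. bumps R s u t = s j * u j \<and> (\<forall>k\<in>R. t \<in> piece k (u k) \<longleftrightarrow> k = j))"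
proof (cases "\<exists>j\<in>R. t \<in> piece j (u j)")
  case True
  then obtain j where j: "j \<in> R" "t \<in> piece j (u j)" by auto
  have iff: "t \<in> piece k (u k) \<longleftrightarrow> k = j" if "k \<in> R" for k
  proof -
    have "k \<noteq> j \<Longrightarrow> M k \<inter> M j = {}" using M_disjoint by (auto simp: disjoint_family_on_def)
    then show ?thesis using piece(1)[OF R(2)[OF that]] piece(1)[OF R(2)[OF j(1)]] j by blast
  qed
  then have "bumps R s u t = (\<Sum>k\<in>R. if k = j then s j * u j else 0)"
    unfolding bumps_def by (intro sum.cong) (auto simp: indicator_def)
  then have "bumps R s u t = s j * u j" using R(1) j by simp
  then show ?thesis using iff j by blast
next
  case False
  then show ?thesis by (auto simp: bumps_def)
qed

lemma modular_bumps:
  assumes R: "finite R" "\<And>k. k \<in> R \<Longrightarrow> admissible k (u k)" and s: "\<And>k. k \<in> R \<Longrightarrow> 0 \<le> s k"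
  shows "modular F (bumps R s u) = ennreal (\<Sum>k\<in>R. F (s k * u k) / F (u k))"
proof -
  have su: "0 \<le> s k * u k" if "k \<in> R" for k using s admissible_pos(2)[OF R(2)] that by (simp add: less_imp_le)
  have "modular F (bumps R s u) = (\<integral>\<^sup>+ t. (\<Sum>k\<in>R. ennreal (F (s k * u k)) * indicator (piece k (u k)) t) \<partial>unit_leb)"
    unfolding modular_def
  proof (intro nn_integral_cong)
    fix t
    have "(bumps R s u t = 0 \<and> (\<forall>k\<in>R. t \<notin> piece k (u k))) \<or>
      (\<exists>j\<in>R. bumps R s u t = s j * u j \<and> (\<forall>k\<in>R. t \<in> piece k (u k) \<longleftrightarrow> k = j))"
      by (rule bumps_cases) (use R in auto)
    then show "ennreal (F \<bar>bumps R s u t\<bar>) = (\<Sum>k\<in>R. ennreal (F (s k * u k)) * indicator (piece k (u k)) t)"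
    proof (elim disjE conjE bexE)
      fix j assume j: "j \<in> R" "bumps R s u t = s j * u j" "\<forall>k\<in>R. t \<in> piece k (u k) \<longleftrightarrow> k = j"
      then have "(\<Sum>k\<in>R. ennreal (F (s k * u k)) * indicator (piece k (u k)) t)
          = (\<Sum>k\<in>R. if k = j then ennreal (F (s j * u j)) else 0)"
        by (intro sum.cong) (auto simp: indicator_def)
      then show ?thesis using j su[of j] R(1) by simp
    qed simp
  qed
  also have "\<dots> = (\<Sum>k\<in>R. ennreal (F (s k * u k)) * emeasure unit_leb (piece k (u k)))"
    using piece_unit R by (subst nn_integral_sum) (auto simp: nn_integral_cmult_indicator intro!: sum.cong)
  also have "\<dots> = (\<Sum>k\<in>R. ennreal (F (s k * u k) / F (u k)))"
  proof (intro sum.cong refl)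
    fix k assume k: "k \<in> R"
    note a = R(2)[OF k]
    have "emeasure unit_leb (piece k (u k)) = ennreal (measure lebesgue (piece k (u k)))"
      using piece[OF a] M_sub[of k] by (intro emeasure_unit_leb) auto
    also have "measure lebesgue (piece k (u k)) = 1 / F (u k)"
      using piece(3)[OF a] admissible_pos(1)[OF a] by (simp add: field_simps)
    finally show "ennreal (F (s k * u k)) * emeasure unit_leb (piece k (u k)) = ennreal (F (s k * u k) / F (u k))"
      using F_nonneg[OF su[OF k]] by (simp flip: ennreal_mult')
  qed
  also have "\<dots> = ennreal (\<Sum>k\<in>R. F (s k * u k) / F (u k))"
    using F_nonneg[OF su] admissible_pos(1)[OF R(2)] by (intro sum_ennreal) (auto intro!: divide_nonneg_pos)
  finally show ?thesis .
qed

text \<open>By convexity, a norm below some \<open>l < 1\<close> would force the modular itself to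
  be at most \<open>l\<close>. No doubling is involved, so small arguments are allowed here.\<close>

lemma norm_bumps_ge_1:
  assumes R: "finite R" "\<And>k. k \<in> R \<Longrightarrow> admissible k (u k)" and s: "\<And>k. k \<in> R \<Longrightarrow> 0 \<le> s k"
    and ge: "1 \<le> (\<Sum>k\<in>R. F (s k * u k) / F (u k))"
  shows "1 \<le> orlicz_norm F (bumps R s u)"
proof (rule ccontr)
  assume "\<not> ?thesis"
  then obtain l where l: "orlicz_norm F (bumps R s u) < l" "l < 1" using dense not_le by blast
  note sp = bumps_space[of R u s, OF R]
  have l0: "l > 0" using l orlicz_norm_nonneg[OF sp] by (meson order_le_less_trans)
  have "ennreal 1 \<le> modular F (bumps R s u)" using ge by (simp only: modular_bumps[of R u s, OF R s] ennreal_leI)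
  also have "\<dots> = modular F (\<lambda>t. bumps R s u t / l / (1 / l))" using l0 by simp
  also have "\<dots> \<le> ennreal (1 / (1 / l)) * modular F (\<lambda>t. bumps R s u t / l)"
    using l0 l orlicz_spaceD[OF sp] by (intro modular_divide_le) auto
  also have "\<dots> \<le> ennreal (1 / (1 / l)) * 1"
    by (intro mult_left_mono modular_le_oneI sp l) auto
  finally show False using l l0 by (simp del: ennreal_1)
qed

lemma norm_bumps_le_pow2:
  assumes R: "finite R" "\<And>k. k \<in> R \<Longrightarrow> admissible k (u k)" and s: "\<And>k. k \<in> R \<Longrightarrow> u1 \<le> s k * u k"
    and le: "(\<Sum>k\<in>R. F (s k * u k) / F (u k)) \<le> 1 / D ^ j"
  shows "orlicz_norm F (bumps R s u) \<le> 1 / 2 ^ j"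
proof (rule orlicz_norm_le_pow2)
  have s0: "0 \<le> s k" if "k \<in> R" for k
    using s[OF that] u1 admissible_pos(2)[OF R(2)[OF that]] by (smt (verit) mult_nonneg_nonneg mult_neg_pos)
  show "bumps R s u t = 0 \<or> u1 \<le> \<bar>bumps R s u t\<bar>" for t
    using bumps_cases[of R u s t, OF R] s by fastforce
  show "bumps R s u \<in> borel_measurable unit_leb" using bumps_space[OF R] by (rule orlicz_spaceD)
  show "modular F (bumps R s u) \<le> ennreal (1 / D ^ j)"
    using le by (simp only: modular_bumps[of R u s, OF R s0] ennreal_leI)
qed

lemma ratio_le_1:
  assumes "admissible k u" "0 \<le> s" "s \<le> 1" shows "0 \<le> F (s * u) / F u" "F (s * u) / F u \<le> 1"
proof -
  note p = admissible_pos[OF assms(1)]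
  show "0 \<le> F (s * u) / F u" using F_nonneg[of "s * u"] assms p by simp
  have "s * u \<le> 1 * u" using assms p by (intro mult_right_mono) auto
  then have "F (s * u) \<le> F u" using assms p by (intro F_mono) auto
  then show "F (s * u) / F u \<le> 1" using p by simp
qed

text \<open>Values of the argument below the \<open>\<Delta>\<^sub>2\<close> threshold \<open>u1\<close> cost only the summable error \<open>F u1 * W k\<close>.\<close>

lemma below_threshold:
  fixes \<Phi> :: "real \<Rightarrow> real"
  assumes u: "admissible k u" and s: "0 \<le> s" "s \<le> 1"
    and \<Phi>_mono: "\<And>r. s \<le> r \<Longrightarrow> r \<le> 1 \<Longrightarrow> \<Phi> s \<le> \<Phi> r" and \<Phi>_le: "\<Phi> s \<le> 1"
    and C: "0 \<le> C" and b: "0 \<le> b"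
    and le: "\<And>r. 0 \<le> r \<Longrightarrow> r \<le> 1 \<Longrightarrow> u1 \<le> r * u \<Longrightarrow> \<Phi> r \<le> C * (F (r * u) / F u) + b"
  shows "\<Phi> s \<le> C * (F (s * u) / F u) + (b + (C + 1) * F u1 * W k)"
proof -
  note p = admissible_pos[OF u]
  have nn: "0 \<le> C * (F (s * u) / F u)" "0 \<le> F u1 * W k" "0 \<le> C * (F u1 * W k)"
    using C F_nonneg[of "s * u"] s p u1 by auto
  have exp: "(C + 1) * F u1 * W k = C * (F u1 * W k) + F u1 * W k" by (simp add: algebra_simps)
  consider "u1 \<le> s * u" | "s * u < u1" "u1 \<le> u" | "u < u1" by linarith
  then show ?thesis
  proof cases
    case 1
    then show ?thesis using le[OF s] nn unfolding exp by simp
  next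
    case 2
    \<comment> \<open>\<open>s\<close> is raised to the point where the argument reaches the
      threshold; the ratio there is \<open>F u1 / F u\<close>, at most \<open>F u1 * W k\<close> by
      admissibility of \<open>u\<close>.\<close>
    define r where "r = u1 / u"
    have r: "s \<le> r" "r \<le> 1" "0 \<le> r" "r * u = u1" using 2 p u1 by (auto simp: r_def field_simps)
    have "\<Phi> s \<le> \<Phi> r" using \<Phi>_mono r by blast
    also have "\<dots> \<le> C * (F u1 / F u) + b" using le[of r] r by simp
    also have "C * (F u1 / F u) \<le> C * (F u1 * W k)"
      using mult_left_mono[OF admissible_inverse_le[OF u], of "F u1"] C u1 by (intro mult_left_mono) auto
    finally show ?thesis using nn unfolding exp by simp
  next
    case 3
    \<comment> \<open>If even \<open>u\<close> lies below the threshold, admissibility makes the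
      error term alone at least one.\<close>
    have "1 \<le> F u * W k" using u by (simp add: admissible_def)
    also have "\<dots> \<le> F u1 * W k" using 3 p M_pos[of k] by (intro mult_right_mono F_mono) auto
    finally show ?thesis using \<Phi>_le nn b unfolding exp by simp
  qed
qed

lemma lp_likeI:
  assumes "C > 0" "summable b" "\<And>k. 0 \<le> b k" "C' > 0" "summable b'" "\<And>k. 0 \<le> b' k"
    and up: "\<And>k u s. admissible k u \<Longrightarrow> 0 \<le> s \<Longrightarrow> s \<le> 1 \<Longrightarrow> F (s * u) / F u \<le> C * s powr p + b k"
    and lo: "\<And>k u s. admissible k u \<Longrightarrow> 0 \<le> s \<Longrightarrow> s \<le> 1 \<Longrightarrow> s powr p \<le> C' * (F (s * u) / F u) + b' k"
  shows "lp_like F W p"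
  unfolding lp_like_def
proof (intro exI[of _ "C + C'"] exI[of _ "\<lambda>k. b k + b' k"] conjI allI impI)
  fix u s :: real and k :: nat
  assume s: "0 \<le> s" "s \<le> 1" and "0 \<le> u" "1 \<le> F u * W k"
  then have u: "admissible k u" by (simp add: admissible_def)
  note p = admissible_pos(1)[OF u]
  have "F (s * u) / F u \<le> C * s powr p + b k" using up[OF u s] .
  also have "\<dots> \<le> (C + C') * s powr p + (b k + b' k)"
    using assms(4,6) by (intro add_mono mult_right_mono) auto
  finally show "F (s * u) \<le> ((C + C') * s powr p + (b k + b' k)) * F u" using p by (simp add: field_simps)
  have "s powr p \<le> C' * (F (s * u) / F u) + b' k" using lo[OF u s] .
  also have "\<dots> \<le> (C + C') * (F (s * u) / F u) + (b k + b' k)"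
    using assms(1,3) ratio_le_1[OF u s] by (intro add_mono mult_right_mono) auto
  finally have "s powr p * F u \<le> ((C + C') * (F (s * u) / F u) + (b k + b' k)) * F u"
    using p by (intro mult_right_mono) auto
  also have "\<dots> = (C + C') * F (s * u) + (b k + b' k) * F u" using p by (simp add: field_simps)
  finally show "s powr p * F u \<le> (C + C') * F (s * u) + (b k + b' k) * F u" .
qed (use assms in \<open>auto intro: summable_add\<close>)

lemma lp_estimates_bumps:
  assumes "lp_estimates F M p"
  obtains C where "C > 0"
    "\<And>R s u. finite R \<Longrightarrow> (\<forall>k\<in>R. admissible k (u k) \<and> 0 \<le> s k) \<Longrightarrow>
       orlicz_norm F (bumps R s u) powr p \<le> C * (\<Sum>k\<in>R. s k powr p) \<and>
       (\<Sum>k\<in>R. s k powr p) \<le> C * orlicz_norm F (bumps R s u) powr p"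
proof -
  obtain C where C: "C > 0" and est: "\<And>n A c. (\<forall>k<n. A k \<in> sets lebesgue \<and> A k \<subseteq> M k) \<Longrightarrow>
        inverse C * orlicz_norm F (\<lambda>t. \<Sum>k<n. c k * indicat_real (A k) t) powr p
          \<le> (\<Sum>k<n. orlicz_norm F (\<lambda>t. c k * indicat_real (A k) t) powr p) \<and>
        (\<Sum>k<n. orlicz_norm F (\<lambda>t. c k * indicat_real (A k) t) powr p)
          \<le> C * orlicz_norm F (\<lambda>t. \<Sum>k<n. c k * indicat_real (A k) t) powr p"
    using assms unfolding lp_estimates_def by blast
  show thesis
  proof (rule that[OF C])
    fix R and s u :: "nat \<Rightarrow> real"
    assume R: "finite R" "\<forall>k\<in>R. admissible k (u k) \<and> 0 \<le> s k"
    obtain n where n: "R \<subseteq> {..<n}" using finite_nat_bounded[OF R(1)] by auto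
    \<comment> \<open>Indices outside \<open>R\<close> receive the empty set, so their terms have
      norm zero and any finite index set fits the initial segment that the estimates speak
      of.\<close>
    define A where "A k = (if k \<in> R then piece k (u k) else {})" for k
    define c where "c k = s k * u k" for k
    have A: "\<forall>k<n. A k \<in> sets lebesgue \<and> A k \<subseteq> M k"
      using R piece by (auto simp: A_def)
    have 1: "(\<lambda>t. \<Sum>k<n. c k * indicat_real (A k) t) = bumps R s u"
    proof
      fix t
      have "(\<Sum>k<n. c k * indicat_real (A k) t) = (\<Sum>k\<in>R. c k * indicat_real (A k) t)"
        using n by (intro sum.mono_neutral_right) (auto simp: A_def)
      then show "(\<Sum>k<n. c k * indicat_real (A k) t) = bumps R s u t" by (simp add: bumps_def A_def c_def)
    qed
    have "(\<Sum>k<n. orlicz_norm F (\<lambda>t. c k * indicat_real (A k) t) powr p)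
       = (\<Sum>k\<in>R. orlicz_norm F (\<lambda>t. c k * indicat_real (A k) t) powr p)"
      using n by (intro sum.mono_neutral_right) (auto simp: A_def orlicz_norm_zero)
    also have "\<dots> = (\<Sum>k\<in>R. s k powr p)"
      using R norm_piece by (intro sum.cong) (auto simp: A_def c_def)
    finally have 2: "(\<Sum>k<n. orlicz_norm F (\<lambda>t. c k * indicat_real (A k) t) powr p) = (\<Sum>k\<in>R. s k powr p)" .
    show "orlicz_norm F (bumps R s u) powr p \<le> C * (\<Sum>k\<in>R. s k powr p) \<and>
       (\<Sum>k\<in>R. s k powr p) \<le> C * orlicz_norm F (bumps R s u) powr p"
      using est[OF A, of c] C unfolding 1 2 by (simp add: field_simps)
  qed
qed

theorem lp_estimates_imp_lp_like:
  assumes est: "lp_estimates F M p" and p: "p > 0" shows "lp_like F W p"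
proof -
  obtain C0 where C0: "C0 > 0"
    and bump: "\<And>R s u. finite R \<Longrightarrow> (\<forall>k\<in>R. admissible k (u k) \<and> 0 \<le> s k) \<Longrightarrow>
       orlicz_norm F (bumps R s u) powr p \<le> C0 * (\<Sum>k\<in>R. s k powr p) \<and>
       (\<Sum>k\<in>R. s k powr p) \<le> C0 * orlicz_norm F (bumps R s u) powr p"
    using lp_estimates_bumps[OF est] by blast
  have powr_le1: "s powr p \<le> 1" if "0 \<le> s" "s \<le> 1" for s :: real
    using powr_mono2[of p s 1] that p by simp
  define P where "P k x y \<longleftrightarrow>
    (\<exists>u s. admissible k u \<and> 0 \<le> s \<and> s \<le> 1 \<and> x = F (s * u) / F u \<and> y = s powr p)" for k x y
  \<comment> \<open>With the factor 3 a forbidden block would give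
    \<open>1 \<le> C0 * sum Y R \<le> sum X R / 3 \<le> 2 / 3\<close>.\<close>
  have "\<exists>b. summable b \<and> (\<forall>k. 0 \<le> b k) \<and> (\<forall>k x y. P k x y \<longrightarrow> x \<le> (3 * C0) * y + b k)"
  proof (rule summable_selection)
    fix R X Y
    assume 4: "finite R" "\<And>k. k \<in> R \<Longrightarrow> P k (X k) (Y k)" "3 * C0 * sum Y R \<le> sum X R"
      "1 \<le> sum X R" "sum X R \<le> 2"
    from 4(2) obtain u s where us: "\<And>k. k \<in> R \<Longrightarrow> admissible k (u k) \<and> 0 \<le> s k \<and> s k \<le> 1 \<and>
       X k = F (s k * u k) / F (u k) \<and> Y k = s k powr p" unfolding P_def by metis
    have "1 \<le> orlicz_norm F (bumps R s u)"
      by (rule norm_bumps_ge_1) (use 4 us in auto)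
    then have "1 \<le> orlicz_norm F (bumps R s u) powr p" using p by (simp add: ge_one_powr_ge_zero)
    also have "\<dots> \<le> C0 * sum Y R" using bump[of R u s] 4 us by simp
    finally show False using 4 by simp
  qed (use C0 ratio_le_1 in \<open>auto simp: P_def\<close>)
  then obtain b1 where b1: "summable b1" "\<And>k. 0 \<le> b1 k"
    and up: "\<And>k u s. admissible k u \<Longrightarrow> 0 \<le> s \<Longrightarrow> s \<le> 1 \<Longrightarrow> F (s * u) / F u \<le> (3 * C0) * s powr p + b1 k"
    unfolding P_def by blast
  \<comment> \<open>A sum of bumps of norm at most \<open>1 / 2 ^ j\<close> contradicts the lower
    estimate. Doubling yields that norm from a modular of at most \<open>1 / D ^ j\<close>, and
    \<open>C = 2 * D ^ j\<close> extracts this modular from \<open>sum X R \<le> 2\<close>.\<close>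
  obtain j :: nat where j: "C0 * (1 / 2 ^ j) powr p < 1"
  proof -
    obtain j :: nat where j: "C0 powr (1 / p) < 2 ^ j" using real_arch_pow[of 2 "C0 powr (1 / p)"] by auto
    then have "(C0 powr (1 / p)) powr p < (2 ^ j) powr p" using p by (intro powr_less_mono2) auto
    then have "C0 < (2 ^ j) powr p" using p C0 by (simp add: powr_powr)
    then have "C0 * (1 / 2 ^ j) powr p < 1" by (simp add: powr_divide field_simps)
    then show thesis by (rule that)
  qed
  define C where "C = 2 * D ^ j"
  have C: "C > 0" using D by (simp add: C_def)
  \<comment> \<open>The condition \<open>u1 \<le> s * u\<close> is what
    \<open>norm_bumps_le_pow2\<close> asks for; \<open>below_threshold\<close> removes it at the
    end.\<close>
  define Q where "Q k x y \<longleftrightarrow>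
    (\<exists>u s. admissible k u \<and> 0 \<le> s \<and> s \<le> 1 \<and> u1 \<le> s * u \<and> x = s powr p \<and> y = F (s * u) / F u)" for k x y
  have "\<exists>b. summable b \<and> (\<forall>k. 0 \<le> b k) \<and> (\<forall>k x y. Q k x y \<longrightarrow> x \<le> C * y + b k)"
  proof (rule summable_selection)
    fix R X Y
    assume 4: "finite R" "\<And>k. k \<in> R \<Longrightarrow> Q k (X k) (Y k)" "C * sum Y R \<le> sum X R"
      "1 \<le> sum X R" "sum X R \<le> 2"
    from 4(2) obtain u s where us: "\<And>k. k \<in> R \<Longrightarrow> admissible k (u k) \<and> 0 \<le> s k \<and> s k \<le> 1 \<and> u1 \<le> s k * u k \<and>
       X k = s k powr p \<and> Y k = F (s k * u k) / F (u k)" unfolding Q_def by metis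
    have "C * sum Y R \<le> 2" using 4 by linarith
    then have "sum Y R \<le> 1 / D ^ j" using D by (simp add: C_def field_simps)
    then have "orlicz_norm F (bumps R s u) \<le> 1 / 2 ^ j"
      by (intro norm_bumps_le_pow2) (use 4 us in auto)
    then have "orlicz_norm F (bumps R s u) powr p \<le> (1 / 2 ^ j) powr p"
      using p us 4 by (intro powr_mono2 orlicz_norm_nonneg bumps_space) auto
    moreover have "sum X R \<le> C0 * orlicz_norm F (bumps R s u) powr p" using bump[of R u s] 4 us by simp
    ultimately have "sum X R \<le> C0 * (1 / 2 ^ j) powr p" using C0 by (meson less_imp_le mult_left_mono order_trans)
    then show False using j 4 by simp
  qed (use C ratio_le_1 powr_le1 in \<open>auto simp: Q_def\<close>)
  then obtain b2 where b2: "summable b2" "\<And>k. 0 \<le> b2 k"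
    and lo: "\<And>k u s. admissible k u \<Longrightarrow> 0 \<le> s \<Longrightarrow> s \<le> 1 \<Longrightarrow> u1 \<le> s * u \<Longrightarrow> s powr p \<le> C * (F (s * u) / F u) + b2 k"
    unfolding Q_def by blast
  show ?thesis
  proof (rule lp_likeI[where C = "3 * C0" and b = b1 and C' = C and b' = "\<lambda>k. b2 k + (C + 1) * F u1 * W k"])
    show "summable (\<lambda>k. b2 k + (C + 1) * F u1 * W k)" by (intro summable_add b2 summable_mult summable_W)
    show "0 \<le> b2 k + (C + 1) * F u1 * W k" for k using b2 C u1 by simp
    show "s powr p \<le> C * (F (s * u) / F u) + (b2 k + (C + 1) * F u1 * W k)"
      if "admissible k u" "0 \<le> s" "s \<le> 1" for k u s
      using that lo b2 C p powr_le1 by (intro below_threshold) (auto intro: powr_mono2)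
    show "F (s * u) / F u \<le> (3 * C0) * s powr p + b1 k" if "admissible k u" "0 \<le> s" "s \<le> 1" for k u s
      using up that .
  qed (use b1 C C0 in auto)
qed

end

section \<open>From decomposability to an exponent\<close>

text \<open>Evaluating \<open>a (n * m)\<close> from both factors shows that every
  \<open>(a m - c) / m\<close> lies below every \<open>(a n + c) / n\<close>; any number in between
  serves as \<open>p\<close>, with the same constant \<open>c\<close>.\<close>

lemma quasi_additive_nat:
  fixes a :: "nat \<Rightarrow> real"
  assumes q: "\<And>m n. \<bar>a (m + n) - a m - a n\<bar> \<le> c"
  obtains p where "\<And>n. \<bar>a n - real n * p\<bar> \<le> c"
proof -
  have c0: "c \<ge> 0" using q[of 0 0] by (meson abs_ge_zero order_trans)
  have mult: "real n * a m - real n * c \<le> a (n * m)" "a (n * m) \<le> real n * a m + real n * c" if "n > 0" for n m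
    using that
  proof (induction n)
    case (Suc n)
    {
      case 1
      then show ?case using Suc c0 q[of m "n * m"] by (cases "n = 0") (auto simp: algebra_simps)
    next
      case 2
      then show ?case using Suc c0 q[of m "n * m"] by (cases "n = 0") (auto simp: algebra_simps)
    }
  qed auto
  define p where "p = Inf ((\<lambda>n. (a n + c) / n) ` {0<..})"
  have le: "(a m - c) / m \<le> (a n + c) / n" if "m > 0" "n > 0" for m n
  proof -
    have "real n * a m - real n * c \<le> real m * a n + real m * c"
      using mult(1)[of n m] mult(2)[of m n] that by (simp add: mult.commute)
    then show ?thesis using that by (simp add: field_simps)
  qed
  have "\<bar>a n - real n * p\<bar> \<le> c" for n
  proof (cases "n = 0")
    case True
    then show ?thesis using q[of 0 0] by simp
  next
    case False
    have "p \<le> (a n + c) / n" unfolding p_def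
      using False le[of 1] by (intro cInf_lower bdd_belowI2[of _ "(a 1 - c) / 1"]) auto
    moreover have "(a n - c) / n \<le> p" unfolding p_def
      using False le[of n] by (intro cInf_greatest) auto
    ultimately show ?thesis using False by (simp add: field_simps abs_le_iff)
  qed
  then show thesis by (rule that)
qed

section \<open>Comparable ratios force a power\<close>

context orlicz_cells
begin

lemma eventually_admissible: "eventually (admissible k) at_top"
proof -
  have "eventually (\<lambda>u. 1 / W k \<le> F u) at_top" using F_at_top by (simp add: filterlim_at_top)
  then show ?thesis using eventually_ge_at_top[of 0]
    by eventually_elim (use M_pos[of k] in \<open>auto simp: admissible_def field_simps\<close>)
qed

theorem comparison_imp_lp_like:
  assumes C: "C > 0" and b: "summable b" "\<And>k. 0 \<le> b k"
    and cmp: "\<And>k u v s. admissible k u \<Longrightarrow> admissible k v \<Longrightarrow> 0 \<le> s \<Longrightarrow> s \<le> 1 \<Longrightarrow>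
      F (s * u) / F u \<le> C * (F (s * v) / F v) + b k"
  shows "\<exists>p\<ge>1. lp_like F W p"
proof -
  define \<phi> where "\<phi> n u = F (u / 2 ^ n) / F u" for n :: nat and u
  \<comment> \<open>The extra 1 absorbs the error of a cell, once that error is below the ratio
    itself.\<close>
  define B where "B = C + 1"
  have B: "B > 1" using C by (simp add: B_def)
  have small: "\<exists>k. b k \<le> e" if "e > 0" for e
  proof -
    have "eventually (\<lambda>k. b k < e) sequentially"
      using summable_LIMSEQ_zero[OF b(1)] that by (rule order_tendstoD)
    then obtain k where "b k < e" by (auto simp: eventually_sequentially)
    then show ?thesis by (auto intro: less_imp_le)
  qed
  have F_pos: "eventually (\<lambda>u. 0 < F (u / 2 ^ n)) at_top" for n :: nat
    using eventually_ge_at_top[of "2 ^ n * u1"]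
  proof eventually_elim
    case (elim u)
    then have "u1 \<le> u / 2 ^ n" by (simp add: field_simps)
    then show ?case using F_mono[of u1 "u / 2 ^ n"] u1 by linarith
  qed
  \<comment> \<open>Doubling \<open>n\<close> times bounds the ratio below independently of
    \<open>u\<close>, so for each \<open>n\<close> there is a cell whose error is negligible against
    it. Only that cell is used to compare large \<open>u\<close> and \<open>v\<close>.\<close>
  have \<phi>_ge: "eventually (\<lambda>u. 1 / D ^ n \<le> \<phi> n u) at_top" for n
    using eventually_ge_at_top[of "2 ^ n * u1"] F_pos[of n] F_pos[of 0]
  proof eventually_elim
    case (elim u)
    have "u1 \<le> u / 2 ^ n" using elim by (simp add: field_simps)
    from F_double_power[OF this, of n] have "F u \<le> D ^ n * F (u / 2 ^ n)" by simp
    then show ?case using D elim by (simp add: \<phi>_def field_simps)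
  qed
  have "\<exists>T. \<forall>u\<ge>T. \<forall>v\<ge>T. \<phi> n u \<le> B * \<phi> n v \<and> 0 < \<phi> n u" for n
  proof -
    obtain k where k: "b k \<le> 1 / D ^ n" using small[of "1 / D ^ n"] D by auto
    have "eventually (\<lambda>u. admissible k u \<and> 1 / D ^ n \<le> \<phi> n u) at_top"
      by (intro eventually_conj eventually_admissible \<phi>_ge)
    then obtain T where T: "\<And>u. u \<ge> T \<Longrightarrow> admissible k u \<and> 1 / D ^ n \<le> \<phi> n u"
      by (auto simp: eventually_at_top_linorder)
    have "\<phi> n u \<le> B * \<phi> n v \<and> 0 < \<phi> n u" if "u \<ge> T" "v \<ge> T" for u v
    proof
      have "\<phi> n u \<le> C * \<phi> n v + b k"
        using cmp[of k u v "1 / 2 ^ n"] T that by (simp add: \<phi>_def)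
      also have "\<dots> \<le> C * \<phi> n v + \<phi> n v" using k T[OF that(2)] by simp
      finally show "\<phi> n u \<le> B * \<phi> n v" by (simp add: B_def algebra_simps)
      have "0 < 1 / D ^ n" using D by simp
      then show "0 < \<phi> n u" using T[OF that(1)] by (meson order_less_le_trans)
    qed
    then show ?thesis by blast
  qed
  then obtain T where T: "\<And>n u v. u \<ge> T n \<Longrightarrow> v \<ge> T n \<Longrightarrow> \<phi> n u \<le> B * \<phi> n v"
    "\<And>n u. u \<ge> T n \<Longrightarrow> 0 < \<phi> n u" by (metis order_refl)
  define \<alpha> where "\<alpha> n = \<phi> n (T n)" for n
  have \<alpha>_pos: "0 < \<alpha> n" for n using T(2)[of n "T n"] by (simp add: \<alpha>_def)
  have \<alpha>: "eventually (\<lambda>u. \<phi> n u \<le> B * \<alpha> n \<and> \<alpha> n \<le> B * \<phi> n u) at_top" for n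
    using eventually_ge_at_top[of "T n"] by eventually_elim (use T(1)[of n] in \<open>auto simp: \<alpha>_def\<close>)
  define a where "a n = - log 2 (\<alpha> n)" for n
  \<comment> \<open>The identity \<open>\<phi> (m + n) u = \<phi> m u * \<phi> n (u / 2 ^ m)\<close>
    is exact; replacing its three ratios by the reference values \<open>\<alpha>\<close> costs
    \<open>B\<close> each.\<close>
  define c where "c = 3 * log 2 B"
  have quasi: "\<bar>a (m + n) - a m - a n\<bar> \<le> c" for m n
  proof -
    have shift: "eventually (\<lambda>u. \<phi> n (u / 2 ^ m) \<le> B * \<alpha> n \<and> \<alpha> n \<le> B * \<phi> n (u / 2 ^ m)) at_top"
    proof -
      have "filterlim (\<lambda>u::real. u / 2 ^ m) at_top at_top"
        using filterlim_at_top_mult_tendsto_pos[OF tendsto_const _ filterlim_ident, of "1 / 2 ^ m"] by simp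
      from filterlim_iff[THEN iffD1, OF this] \<alpha>[of n] show ?thesis by blast
    qed
    have "eventually (\<lambda>u::real. \<alpha> (m + n) \<le> B ^ 3 * (\<alpha> m * \<alpha> n) \<and> \<alpha> m * \<alpha> n \<le> B ^ 3 * \<alpha> (m + n)) at_top"
      using \<alpha>[of m] \<alpha>[of "m + n"] shift F_pos[of m] F_pos[of "m + n"] F_pos[of 0]
    proof eventually_elim
      case (elim u)
      have split: "\<phi> (m + n) u = \<phi> m u * \<phi> n (u / 2 ^ m)"
        using elim by (simp add: \<phi>_def power_add)
      have pos: "0 < \<phi> m u" "0 < \<phi> n (u / 2 ^ m)" using elim by (auto simp: \<phi>_def power_add)
      have "\<phi> (m + n) u \<le> (B * \<alpha> m) * (B * \<alpha> n)"
        unfolding split using elim pos \<alpha>_pos[of m] B by (intro mult_mono) auto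
      then have "B * \<phi> (m + n) u \<le> B * ((B * \<alpha> m) * (B * \<alpha> n))" using B by (intro mult_left_mono) auto
      then have 1: "\<alpha> (m + n) \<le> B * ((B * \<alpha> m) * (B * \<alpha> n))" using elim by linarith
      have "\<alpha> m * \<alpha> n \<le> (B * \<phi> m u) * (B * \<phi> n (u / 2 ^ m))"
        using elim pos \<alpha>_pos[of m] \<alpha>_pos[of n] B by (intro mult_mono) auto
      also have "\<dots> = B\<^sup>2 * \<phi> (m + n) u" unfolding split by (simp add: power2_eq_square)
      also have "\<dots> \<le> B\<^sup>2 * (B * \<alpha> (m + n))" using elim by (intro mult_left_mono) auto
      finally show ?case using 1 by (simp add: power3_eq_cube power2_eq_square mult_ac)
    qed
    then have le: "\<alpha> (m + n) \<le> B ^ 3 * (\<alpha> m * \<alpha> n)" "\<alpha> m * \<alpha> n \<le> B ^ 3 * \<alpha> (m + n)"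
      by (auto simp: eventually_at_top_linorder)
    have "log 2 (\<alpha> (m + n)) \<le> log 2 (B ^ 3 * (\<alpha> m * \<alpha> n))"
      using le(1) \<alpha>_pos[of m] \<alpha>_pos[of n] \<alpha>_pos[of "m + n"] B by (intro log_mono) auto
    moreover have "log 2 (\<alpha> m * \<alpha> n) \<le> log 2 (B ^ 3 * \<alpha> (m + n))"
      using le(2) \<alpha>_pos[of m] \<alpha>_pos[of n] \<alpha>_pos[of "m + n"] B by (intro log_mono) auto
    ultimately show ?thesis using \<alpha>_pos[of m] \<alpha>_pos[of n] \<alpha>_pos[of "m + n"] B
      by (simp add: a_def c_def log_mult log_nat_power abs_le_iff)
  qed
  obtain p where p: "\<And>n. \<bar>a n - real n * p\<bar> \<le> c" using quasi_additive_nat[OF quasi] by blast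
  \<comment> \<open>\<open>B\<close> pays for the passage from the ratio to
    \<open>\<alpha> n\<close>, and \<open>2 powr c\<close> for that from \<open>\<alpha> n\<close>
    to the power.\<close>
  define E where "E = B * 2 powr c"
  have E: "E > 0" using B by (simp add: E_def)
  have \<alpha>_le: "\<alpha> n \<le> 2 powr c * 2 powr (- real n * p)" "2 powr (- real n * p) \<le> 2 powr c * \<alpha> n" for n
  proof -
    have eq: "\<alpha> n = 2 powr (- a n)" using \<alpha>_pos[of n] by (simp add: a_def)
    have "- a n \<le> c + (- real n * p)" "- real n * p \<le> c + (- a n)" using p[of n] by (auto simp: abs_le_iff)
    then show "\<alpha> n \<le> 2 powr c * 2 powr (- real n * p)" "2 powr (- real n * p) \<le> 2 powr c * \<alpha> n"
      unfolding eq powr_add[symmetric] by simp_all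
  qed
  have \<phi>_p: "eventually (\<lambda>u. \<phi> n u \<le> E * 2 powr (- real n * p) \<and> 2 powr (- real n * p) \<le> E * \<phi> n u) at_top" for n
    using \<alpha>[of n]
  proof eventually_elim
    case (elim u)
    have "\<phi> n u \<le> B * \<alpha> n" using elim by simp
    also have "\<dots> \<le> B * (2 powr c * 2 powr (- real n * p))" using \<alpha>_le(1)[of n] B by (intro mult_left_mono) auto
    finally have 1: "\<phi> n u \<le> E * 2 powr (- real n * p)" by (simp add: E_def)
    have "2 powr (- real n * p) \<le> 2 powr c * \<alpha> n" by (rule \<alpha>_le)
    also have "\<dots> \<le> 2 powr c * (B * \<phi> n u)" using elim by (intro mult_left_mono) auto
    finally show ?case using 1 by (simp add: E_def mult_ac)
  qed
  \<comment> \<open>Convexity gives \<open>\<phi> n u \<le> 1 / 2 ^ n\<close>; with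
    \<open>p < 1\<close> this contradicts the lower bound \<open>2 powr (- real n * p) / E\<close>
    for large \<open>n\<close>.\<close>
  have p1: "p \<ge> 1"
  proof (rule ccontr)
    assume "\<not> p \<ge> 1"
    then obtain n :: nat where n: "real n * (1 - p) > log 2 E"
      using reals_Archimedean3[of "1 - p"] by auto
    have "eventually (\<lambda>u::real. 2 powr (- real n * p) \<le> E * 2 powr (- real n)) at_top"
      using \<phi>_p[of n] F_pos[of 0] eventually_ge_at_top[of 0]
    proof eventually_elim
      case (elim u)
      have "F (u / 2 ^ n) \<le> (1 / 2 ^ n) * F u" using F_scale_le[of "1 / 2 ^ n" u] elim by simp
      then have "\<phi> n u \<le> 1 / 2 ^ n" using elim by (simp add: \<phi>_def field_simps)
      also have "\<dots> = 2 powr (- real n)" by (simp add: powr_minus powr_realpow divide_inverse)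
      finally have "E * \<phi> n u \<le> E * 2 powr (- real n)" using E by (intro mult_left_mono) auto
      then show ?case using elim by linarith
    qed
    then have "2 powr (- real n * p) \<le> E * 2 powr (- real n)" by (auto simp: eventually_at_top_linorder)
    also have "\<dots> = 2 powr (log 2 E - real n)" using E by (simp add: powr_diff powr_minus divide_inverse)
    finally have "- real n * p \<le> log 2 E - real n" by (subst (asm) powr_le_cancel_iff) auto
    then show False using n by (simp add: algebra_simps)
  qed
  have dyadic: "\<exists>n::nat. 1 / 2 ^ Suc n < s \<and> s \<le> 1 / 2 ^ n" if s: "0 < s" "s \<le> 1" for s :: real
  proof -
    define P where "P n \<longleftrightarrow> 1 / 2 ^ n < s" for n :: nat
    obtain n0 :: nat where "1 / s < 2 ^ n0" using real_arch_pow[of 2 "1 / s"] by auto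
    then have "P n0" using s by (simp add: P_def field_simps)
    then have L: "P (LEAST n. P n)" by (rule LeastI)
    moreover have "\<not> P 0" using s by (simp add: P_def)
    ultimately obtain n where n: "(LEAST n. P n) = Suc n" by (metis not0_implies_Suc)
    then have "\<not> P n" using not_less_Least[of n P] by simp
    then show ?thesis using L n by (auto simp: P_def not_less)
  qed
  \<comment> \<open>For each cell one sufficiently large \<open>v\<close> is admissible and already
    obeys the power law; \<open>cmp\<close> carries the law from it to every admissible
    \<open>u\<close>, at the price of \<open>b k\<close>.\<close>
  have cmp\<phi>: "\<exists>v. admissible k v \<and> \<phi> n v \<le> E * 2 powr (- real n * p) \<and> 2 powr (- real n * p) \<le> E * \<phi> n v" for k n
    using eventually_conj[OF eventually_admissible[of k] \<phi>_p[of n]]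
    by (auto simp: eventually_at_top_linorder)
  have "lp_like F W p"
  proof (rule lp_likeI[where C = "C * E * 2 powr p" and b = b and C' = "2 powr p * E * C" and b' = "\<lambda>k. 2 powr p * E * b k"])
    fix k u s assume u: "admissible k u" and s: "0 \<le> s" "s \<le> (1::real)"
    note up = admissible_pos[OF u]
    have "F (s * u) / F u \<le> C * E * 2 powr p * s powr p + b k \<and>
          s powr p \<le> 2 powr p * E * C * (F (s * u) / F u) + 2 powr p * E * b k"
    proof (cases "s = 0")
      case True
      then show ?thesis using b E by simp
    next
      case False
      then obtain n where n: "1 / 2 ^ Suc n < s" "s \<le> 1 / 2 ^ n" using dyadic[of s] s by auto
      have pow: "2 powr (- real m * p) = (1 / 2 ^ m) powr p" for m :: nat
        by (simp add: powr_divide powr_minus_divide powr_powr powr_realpow[symmetric] mult.commute)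
      have e1: "2 powr (- real n * p) \<le> 2 powr p * s powr p"
      proof -
        have "(1 / 2 ^ n) powr p \<le> (2 * s) powr p" using n p1 by (intro powr_mono2) auto
        then show ?thesis unfolding pow using s by (simp add: powr_mult)
      qed
      have e2: "s powr p \<le> 2 powr p * 2 powr (- real (Suc n) * p)"
      proof -
        have "s powr p \<le> (2 * (1 / 2 ^ Suc n)) powr p" using n p1 s by (intro powr_mono2) auto
        then show ?thesis unfolding pow powr_mult[symmetric] by simp
      qed
      have mono: "F (r * u) / F u \<le> F (q * u) / F u" if "0 \<le> r" "r \<le> q" for r q
        using that up by (intro divide_right_mono F_mono mult_right_mono) auto
      obtain v where v: "admissible k v" "\<phi> n v \<le> E * 2 powr (- real n * p)" using cmp\<phi> by blast
      have "F (s * u) / F u \<le> F (1 / 2 ^ n * u) / F u" using mono s n by blast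
      also have "\<dots> \<le> C * (F (1 / 2 ^ n * v) / F v) + b k" by (rule cmp[OF u v(1)]) auto
      also have "\<dots> = C * \<phi> n v + b k" by (simp add: \<phi>_def)
      also have "\<dots> \<le> C * (E * (2 powr p * s powr p)) + b k"
        using v(2) e1 E C by (intro add_right_mono mult_left_mono) (auto intro: order_trans mult_left_mono)
      finally have 1: "F (s * u) / F u \<le> C * E * 2 powr p * s powr p + b k" by (simp add: mult.assoc)
      obtain v where v: "admissible k v" "2 powr (- real (Suc n) * p) \<le> E * \<phi> (Suc n) v" using cmp\<phi> by blast
      have "\<phi> (Suc n) v \<le> C * (F (1 / 2 ^ Suc n * u) / F u) + b k"
        using cmp[OF v(1) u, of "1 / 2 ^ Suc n"] one_le_power[of "2::real" "Suc n"] by (simp add: \<phi>_def)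
      also have "\<dots> \<le> C * (F (s * u) / F u) + b k"
        using C n by (intro add_right_mono mult_left_mono mono) auto
      finally have "E * \<phi> (Suc n) v \<le> E * (C * (F (s * u) / F u) + b k)" using E by (intro mult_left_mono) auto
      then have "2 powr (- real (Suc n) * p) \<le> E * (C * (F (s * u) / F u) + b k)" using v(2) by linarith
      then have "2 powr p * 2 powr (- real (Suc n) * p) \<le> 2 powr p * (E * (C * (F (s * u) / F u) + b k))"
        by (intro mult_left_mono) auto
      with e2 have "s powr p \<le> 2 powr p * (E * (C * (F (s * u) / F u) + b k))" by linarith
      then show ?thesis using 1 by (simp add: algebra_simps)
    qed
    then show "F (s * u) / F u \<le> C * E * 2 powr p * s powr p + b k"
      "s powr p \<le> 2 powr p * E * C * (F (s * u) / F u) + 2 powr p * E * b k" by auto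
  qed (use C E b in \<open>auto intro: summable_mult\<close>)
  then show ?thesis using p1 by blast
qed

end

context orlicz_weight
begin

text \<open>Distinct exponents of equal parity differ by at least two, so twice the upper end of the
  lower level does not exceed the lower end of the higher one; adjacent levels may fail this.
  \<open>s k\<close> must be positive because decomposability speaks of nonzero functions.\<close>

lemma decomposable_bumps:
  assumes "w_decomposable w (orlicz_space F) (orlicz_norm F)"
  obtains C where "C > 0"
    "\<And>R s u v e. finite R \<Longrightarrow>
       (\<forall>k\<in>R. admissible k (u k) \<and> admissible k (v k) \<and> 0 < s k \<and> even (\<sigma> k) = e) \<Longrightarrow>
       orlicz_norm F (bumps R s u) \<le> C * orlicz_norm F (bumps R s v)"
proof -
  from assms[unfolded w_decomposable_def] obtain C where C: "C > 0"
    and all: "\<forall>(n::nat) (x :: nat \<Rightarrow> real \<Rightarrow> real) (y :: nat \<Rightarrow> real \<Rightarrow> real).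
        (\<forall>i<n. x i \<in> orlicz_space F \<and> y i \<in> orlicz_space F \<and>
               \<not> (AE t in unit_leb. x i t = 0) \<and> \<not> (AE t in unit_leb. y i t = 0) \<and>
               orlicz_norm F (x i) = orlicz_norm F (y i)) \<and>
        (\<forall>i. i + 1 < n \<longrightarrow>
           ess_inf_on w (supp (x i) \<union> supp (y i))
             \<ge> 2 * ess_sup_on w (supp (x (i + 1)) \<union> supp (y (i + 1)))) \<longrightarrow>
        inverse C * orlicz_norm F (\<lambda>t. \<Sum>i<n. x i t) \<le> orlicz_norm F (\<lambda>t. \<Sum>i<n. y i t) \<and>
        orlicz_norm F (\<lambda>t. \<Sum>i<n. y i t) \<le> C * orlicz_norm F (\<lambda>t. \<Sum>i<n. x i t)"
    by (elim exE conjE) (rule that; assumption)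
  note dec = all[THEN spec, THEN spec, THEN spec, THEN mp, OF conjI, THEN conjunct2]
  show thesis
  proof (rule that[OF C])
    fix R and s u v :: "nat \<Rightarrow> real" and e
    assume R: "finite R"
      and A: "\<forall>k\<in>R. admissible k (u k) \<and> admissible k (v k) \<and> 0 < s k \<and> even (\<sigma> k) = e"
    \<comment> \<open>Decomposability lists its functions by decreasing values of \<open>w\<close>,
      hence the cells are sorted by decreasing exponent.\<close>
    define ys where "ys = rev (sorted_list_of_set (\<sigma> ` R))"
    define n where "n = length ys"
    define \<pi> where "\<pi> i = inv \<sigma> (ys ! i)" for i
    have set_ys: "set ys = \<sigma> ` R" and dist: "distinct ys" using R by (auto simp: ys_def)
    have dec_ys: "sorted_wrt (\<lambda>x y. y < x) ys" by (simp add: ys_def sorted_wrt_rev)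
    have "bij_betw ((!) ys) {..<n} (\<sigma> ` R)" by (rule bij_betw_nth) (use dist set_ys in \<open>auto simp: n_def\<close>)
    moreover have "bij_betw (inv \<sigma>) (\<sigma> ` R) R"
      using inj_\<sigma> by (auto intro!: bij_betw_imageI inj_onI simp: image_image)
    ultimately have bij: "bij_betw \<pi> {..<n} R"
      using bij_betw_trans[of "(!) ys" "{..<n}" "\<sigma> ` R" "inv \<sigma>" R] by (simp add: o_def \<pi>_def[abs_def])
    have \<pi>R: "\<pi> i \<in> R" if "i < n" for i using bij that by (auto simp: bij_betw_def)
    have \<sigma>\<pi>: "\<sigma> (\<pi> i) = ys ! i" if "i < n" for i
    proof -
      have "ys ! i \<in> \<sigma> ` R" using that set_ys by (auto simp: n_def)
      then show ?thesis unfolding \<pi>_def by (auto intro: f_inv_into_f)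
    qed
    define bump where "bump z k = (\<lambda>t. s k * z k * indicat_real (piece k (z k)) t)" for z :: "nat \<Rightarrow> real" and k
    have bumps_eq: "(\<lambda>t. \<Sum>i<n. bump z (\<pi> i) t) = bumps R s z" for z
    proof
      fix t show "(\<Sum>i<n. bump z (\<pi> i) t) = bumps R s z t"
        using sum.reindex_bij_betw[OF bij, of "\<lambda>k. bump z k t"] by (simp add: bumps_def bump_def)
    qed
    have bump: "bump z k \<in> orlicz_space F" "\<not> (AE t in unit_leb. bump z k t = 0)"
      "orlicz_norm F (bump z k) = s k" "supp (bump z k) \<subseteq> M k"
      if k: "k \<in> R" and z: "admissible k (z k)" for z k
    proof -
      have sz: "s k * z k \<noteq> 0" using A k admissible_pos(2)[OF z] by force
      show "bump z k \<in> orlicz_space F"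
      proof (rule orlicz_space_bounded)
        show "bump z k \<in> borel_measurable unit_leb" unfolding bump_def
          using piece_unit[OF z] by (intro borel_measurable_times) auto
        show "\<bar>bump z k t\<bar> \<le> \<bar>s k * z k\<bar>" for t by (auto simp: bump_def indicator_def)
      qed
      show "orlicz_norm F (bump z k) = s k" unfolding bump_def
        using A k by (intro norm_piece z) (auto simp: less_imp_le)
      show "supp (bump z k) \<subseteq> M k" using piece(1)[OF z] by (auto simp: supp_def bump_def indicator_def)
      show "\<not> (AE t in unit_leb. bump z k t = 0)"
      proof
        assume "AE t in unit_leb. bump z k t = 0"
        then have "AE t in unit_leb. t \<notin> piece k (z k)"
          by eventually_elim (use sz in \<open>auto simp: bump_def indicator_def\<close>)
        then have "emeasure unit_leb (piece k (z k)) = 0"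
          using AE_iff_null_sets[OF piece_unit[OF z]] by auto
        then have "measure lebesgue (piece k (z k)) = 0"
          using piece[OF z] M_sub[of k] by (subst (asm) emeasure_unit_leb) auto
        then show False using piece(3)[OF z] by simp
      qed
    qed
    have "orlicz_norm F (\<lambda>t. \<Sum>i<n. bump u (\<pi> i) t) \<le> C * orlicz_norm F (\<lambda>t. \<Sum>i<n. bump v (\<pi> i) t)"
    proof (rule dec; intro allI impI)
      fix i assume "i < n"
      then show "bump v (\<pi> i) \<in> orlicz_space F \<and> bump u (\<pi> i) \<in> orlicz_space F \<and>
          \<not> (AE t in unit_leb. bump v (\<pi> i) t = 0) \<and> \<not> (AE t in unit_leb. bump u (\<pi> i) t = 0) \<and>
          orlicz_norm F (bump v (\<pi> i)) = orlicz_norm F (bump u (\<pi> i))"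
        using bump \<pi>R A by auto
    next
      fix i assume i: "i + 1 < n"
      define S where "S i = supp (bump v (\<pi> i)) \<union> supp (bump u (\<pi> i))" for i
      have S: "S i \<subseteq> level_set w (ys ! i)" if "i < n" for i
        using bump(4)[OF \<pi>R[OF that], of u] bump(4)[OF \<pi>R[OF that], of v] A \<pi>R[OF that] \<sigma>\<pi>[OF that]
        by (auto simp: S_def M_level)
      have S01: "S i \<subseteq> {0..1}" for i by (auto simp: S_def supp_def)
      have lt: "ys ! (i + 1) < ys ! i" using sorted_wrt_nth_less[OF dec_ys, of i "i + 1"] i by (simp add: n_def)
      have "even (\<sigma> (\<pi> i)) = e" "even (\<sigma> (\<pi> (i + 1))) = e" using A \<pi>R i by auto
      then have "even (ys ! (i + 1)) = even (ys ! i)" using \<sigma>\<pi>[of i] \<sigma>\<pi>[of "i + 1"] i by simp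
      then have ge: "ys ! (i + 1) + 2 \<le> ys ! i" using lt by presburger
      have "ess_sup_on w (S (i + 1)) \<le> ereal (2 powi (ys ! (i + 1) + 1))"
        using S[of "i + 1"] i by (intro ess_sup_on_le w_measurable S01) (auto simp: level_set_def)
      then have "2 * ess_sup_on w (S (i + 1)) \<le> 2 * ereal (2 powi (ys ! (i + 1) + 1))"
        by (intro ereal_mult_left_mono) auto
      also have "\<dots> = ereal (2 powi (ys ! (i + 1) + 2))" by (simp add: power_int_add)
      also have "\<dots> \<le> ereal (2 powi (ys ! i))" using ge by (simp add: power_int_increasing)
      also have "\<dots> \<le> ess_inf_on w (S i)"
        using S[of i] i by (intro ess_inf_on_ge w_measurable S01) (auto simp: level_set_def)
      finally show "2 * ess_sup_on w (supp (bump v (\<pi> (i + 1))) \<union> supp (bump u (\<pi> (i + 1))))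
          \<le> ess_inf_on w (supp (bump v (\<pi> i)) \<union> supp (bump u (\<pi> i)))" by (simp add: S_def)
    qed
    then show "orlicz_norm F (bumps R s u) \<le> C * orlicz_norm F (bumps R s v)" by (simp add: bumps_eq)
  qed
qed

theorem decomposable_imp_lp_like:
  assumes "w_decomposable w (orlicz_space F) (orlicz_norm F)"
  shows "\<exists>p\<ge>1. lp_like F W p"
proof -
  obtain C0 where C0: "C0 > 0"
    and bump: "\<And>R s u v e. finite R \<Longrightarrow>
       (\<forall>k\<in>R. admissible k (u k) \<and> admissible k (v k) \<and> 0 < s k \<and> even (\<sigma> k) = e) \<Longrightarrow>
       orlicz_norm F (bumps R s u) \<le> C0 * orlicz_norm F (bumps R s v)"
    using decomposable_bumps[OF assms] by blast
  \<comment> \<open>If the bumps at heights \<open>v\<close> have norm at most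
    \<open>1 / 2 ^ j\<close>, those at heights \<open>u\<close> have norm below one, against their
    modular being at least one.\<close>
  obtain j :: nat where j: "C0 < 2 ^ j" using real_arch_pow[of 2 C0] by auto
  define C where "C = 2 * D ^ j"
  have C: "C > 0" using D by (simp add: C_def)
  \<comment> \<open>Only the sum built from \<open>v\<close> has to be shown small in norm, so only
    \<open>s * v\<close> must stay above the doubling threshold.\<close>
  define P where "P e k x y \<longleftrightarrow> (\<exists>u v s. admissible k u \<and> admissible k v \<and> 0 \<le> s \<and> s \<le> 1 \<and>
     u1 \<le> s * v \<and> even (\<sigma> k) = e \<and> x = F (s * u) / F u \<and> y = F (s * v) / F v)" for e k x y
  have sel: "\<exists>b. summable b \<and> (\<forall>k. 0 \<le> b k) \<and> (\<forall>k x y. P e k x y \<longrightarrow> x \<le> C * y + b k)" for e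
  proof (rule summable_selection)
    fix R X Y
    assume 4: "finite R" "\<And>k. k \<in> R \<Longrightarrow> P e k (X k) (Y k)" "C * sum Y R \<le> sum X R"
      "1 \<le> sum X R" "sum X R \<le> 2"
    from 4(2) obtain u v s where us: "\<And>k. k \<in> R \<Longrightarrow> admissible k (u k) \<and> admissible k (v k) \<and> 0 \<le> s k \<and> s k \<le> 1 \<and>
       u1 \<le> s k * v k \<and> even (\<sigma> k) = e \<and> X k = F (s k * u k) / F (u k) \<and> Y k = F (s k * v k) / F (v k)"
      unfolding P_def by metis
    have s0: "0 < s k" if "k \<in> R" for k
      using us[OF that] u1 by (cases "s k = 0") auto
    have "C * sum Y R \<le> 2" using 4 by linarith
    then have "sum Y R \<le> 1 / D ^ j" using D by (simp add: C_def field_simps)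
    then have 1: "orlicz_norm F (bumps R s v) \<le> 1 / 2 ^ j"
      by (intro norm_bumps_le_pow2) (use 4 us in auto)
    have "1 \<le> orlicz_norm F (bumps R s u)" by (rule norm_bumps_ge_1) (use 4 us in auto)
    also have "\<dots> \<le> C0 * orlicz_norm F (bumps R s v)" using 4 us s0 by (intro bump[where e = e]) auto
    also have "\<dots> \<le> C0 * (1 / 2 ^ j)" using 1 C0 by (intro mult_left_mono) auto
    also have "\<dots> < 1" using j by simp
    finally show False by simp
  qed (use C ratio_le_1 in \<open>auto simp: P_def\<close>)
  obtain b where b: "\<And>e. summable (b e)" "\<And>e k. 0 \<le> b e k" "\<And>e k x y. P e k x y \<Longrightarrow> x \<le> C * y + b e k"
    using sel by metis
  \<comment> \<open>Each cell belongs to one parity class, and the sum of both errors serves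
    either.\<close>
  define b' where "b' k = b True k + b False k" for k
  have b'0: "0 \<le> b' k" for k using b by (simp add: b'_def)
  have cmp: "F (s * u) / F u \<le> C * (F (s * v) / F v) + b' k"
    if "admissible k u" "admissible k v" "0 \<le> s" "s \<le> 1" "u1 \<le> s * v" for k u v s
  proof -
    have "P (even (\<sigma> k)) k (F (s * u) / F u) (F (s * v) / F v)" unfolding P_def using that by blast
    from b(3)[OF this] show ?thesis using b(2)[of True k] b(2)[of False k]
      by (cases "even (\<sigma> k)") (auto simp: b'_def)
  qed
  show ?thesis
  proof (rule comparison_imp_lp_like[OF C, of "\<lambda>k. b' k + (C + 1) * F u1 * W k"])
    show "summable (\<lambda>k. b' k + (C + 1) * F u1 * W k)" unfolding b'_def
      by (intro summable_add b summable_mult summable_W)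
    show "0 \<le> b' k + (C + 1) * F u1 * W k" for k using b'0 C u1 by simp
    fix k u v s assume u: "admissible k u" and v: "admissible k v" and s: "0 \<le> s" "s \<le> (1::real)"
    show "F (s * u) / F u \<le> C * (F (s * v) / F v) + (b' k + (C + 1) * F u1 * W k)"
    proof (rule below_threshold[OF v s, where \<Phi> = "\<lambda>s. F (s * u) / F u"])
      show "F (s * u) / F u \<le> F (r * u) / F u" if "s \<le> r" for r
        using that s admissible_pos[OF u] by (intro divide_right_mono F_mono mult_right_mono) auto
    qed (use ratio_le_1[OF u s] C b'0 cmp u v in auto)
  qed
qed

end

section \<open>Smoothing and gluing\<close>

text \<open>Shifting a window of length \<open>L\<close> by one changes the average by
  \<open>(a (n + L) - a n) / L\<close>, of order \<open>c / L\<close>. The window must grow for this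
  to vanish, yet at \<open>n\<close> it may only contain shifts \<open>h\<close> whose threshold has
  been passed, so that the average stays within \<open>c\<close> of \<open>a n\<close>.\<close>

lemma moving_average:
  fixes a :: "nat \<Rightarrow> real"
  assumes slow: "\<And>h. \<exists>N. \<forall>n\<ge>N. \<bar>a (n + h) - a n\<bar> \<le> c"
  obtains a' N where "\<And>n. n \<ge> N \<Longrightarrow> \<bar>a' n - a n\<bar> \<le> c" "(\<lambda>n. a' (Suc n) - a' n) \<longlonglongrightarrow> 0"
proof -
  obtain t where t: "\<And>h n. n \<ge> t h \<Longrightarrow> \<bar>a (n + h) - a n\<bar> \<le> c" using slow by metis
  have c0: "c \<ge> 0" using t[of 0 "t 0"] by simp
  \<comment> \<open>The sum dominates all thresholds \<open>t i\<close> with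
    \<open>i \<le> j\<close>, and the summand \<open>j\<close> makes \<open>N\<close> strictly
    increasing.\<close>
  define N where "N j = j + (\<Sum>i\<le>j. t i)" for j
  have N_mono: "strict_mono N" by (rule strict_mono_Suc_iff[THEN iffD2]) (simp add: N_def)
  have tN: "t i \<le> N j" if "i \<le> j" for i j
  proof -
    have "t i \<le> (\<Sum>i\<le>j. t i)" using that by (intro member_le_sum) auto
    then show ?thesis by (simp add: N_def)
  qed
  \<comment> \<open>the window length \<open>H n\<close> tends to infinity, but so slowly that it grows by at most one per step\<close>
  define H where "H n = card {j. N j \<le> n}" for n
  have sub: "{j. N j \<le> n} \<subseteq> {..n}" for n using strict_mono_imp_increasing[OF N_mono] order_trans by auto
  have fin: "finite {j. N j \<le> n}" for n using sub by (rule finite_subset) simp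
  have H_ge: "k < H n" if "N k \<le> n" for k n
  proof -
    have "N j \<le> n" if "j \<le> k" for j
      using \<open>N k \<le> n\<close> strict_mono_less_eq[OF N_mono, of j k] that by linarith
    then have "{..k} \<subseteq> {j. N j \<le> n}" by auto
    then have "card {..k} \<le> H n" unfolding H_def using fin by (rule card_mono[rotated])
    then show ?thesis by simp
  qed
  have N_H: "N k \<le> n" if "k < H n" for k n
  proof (rule ccontr)
    assume "\<not> N k \<le> n"
    then have "j < k" if "N j \<le> n" for j
      using strict_mono_less_eq[OF N_mono, of k j] that by linarith
    then have "{j. N j \<le> n} \<subseteq> {..<k}" by auto
    then have "H n \<le> card {..<k}" unfolding H_def by (intro card_mono) auto
    then show False using that by simp
  qed
  have H_Suc: "H n \<le> H (Suc n)" "H (Suc n) \<le> Suc (H n)" for n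
  proof -
    show "H n \<le> H (Suc n)" unfolding H_def using fin by (intro card_mono) auto
    have "j = inv N (Suc n)" if "N j = Suc n" for j
      using inv_f_eq[OF strict_mono_imp_inj_on[OF N_mono] that] by simp
    then have "H (Suc n) \<le> card (insert (inv N (Suc n)) {j. N j \<le> n})" unfolding H_def
      using fin by (intro card_mono) (auto simp: le_Suc_eq)
    also have "\<dots> \<le> Suc (H n)" unfolding H_def using fin by (simp add: card_insert_if)
    finally show "H (Suc n) \<le> Suc (H n)" .
  qed
  have close: "\<bar>a (n + i) - a n\<bar> \<le> c" if "i < H n" for n i
    using t[of i n] tN[of i "H n - 1"] N_H[of "H n - 1" n] that by linarith
  define avg where "avg n L = (\<Sum>i<L. a (n + i)) / real L" for n L
  have avg_close: "\<bar>avg n L - x\<bar> \<le> C" if "L > 0" "\<And>i. i < L \<Longrightarrow> \<bar>a (n + i) - x\<bar> \<le> C" for n L x C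
  proof -
    have "avg n L - x = (\<Sum>i<L. a (n + i) - x) / real L"
      using that(1) by (simp add: avg_def sum_subtractf field_simps)
    also have "\<bar>\<dots>\<bar> \<le> (\<Sum>i<L. \<bar>a (n + i) - x\<bar>) / real L"
      by (simp add: sum_abs divide_right_mono)
    also have "\<dots> \<le> (\<Sum>i<L. C) / real L" using that(2) by (intro divide_right_mono sum_mono) auto
    finally show ?thesis using that(1) by simp
  qed
  define a' where "a' n = avg n (H n)" for n
  have "\<bar>a' n - a n\<bar> \<le> c" if "n \<ge> N 0" for n
    unfolding a'_def using H_ge[OF that] close by (intro avg_close) auto
  moreover have "(\<lambda>n. a' (Suc n) - a' n) \<longlonglongrightarrow> 0"
  proof (rule Lim_null_comparison)
    show "eventually (\<lambda>n. norm (a' (Suc n) - a' n) \<le> 4 * c / real (H n)) sequentially"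
      using eventually_ge_at_top[of "N 1"]
    proof eventually_elim
      case (elim n)
      define L where "L = H n"
      have L: "L \<ge> 2" using H_ge[OF elim] by (simp add: L_def)
      have "avg (Suc n) L - avg n L = ((\<Sum>i<L. a (Suc n + i)) - (\<Sum>i<L. a (n + i))) / real L"
        by (simp add: avg_def diff_divide_distrib)
      also have "(\<Sum>i<L. a (Suc n + i)) - (\<Sum>i<L. a (n + i)) = a (n + L) - a n"
        using sum_lessThan_telescope[of "\<lambda>i. a (n + i)" L] by (simp add: sum_subtractf)
      finally have 1: "\<bar>avg (Suc n) L - avg n L\<bar> = \<bar>a (n + L) - a n\<bar> / real L" by simp
      \<comment> \<open>The shift \<open>L\<close> lies just outside the window at \<open>n\<close>;
        going through \<open>Suc n\<close> brings it inside and doubles the constant.\<close>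
      have "\<bar>a (n + L) - a n\<bar> \<le> 2 * c"
      proof -
        have "\<bar>a (Suc n + (L - 1)) - a (Suc n)\<bar> \<le> c" using L H_Suc(1)[of n] by (intro close) (auto simp: L_def)
        moreover have "\<bar>a (n + 1) - a n\<bar> \<le> c" using L by (intro close) (auto simp: L_def)
        ultimately show ?thesis using L by simp
      qed
      then have 2: "\<bar>avg (Suc n) L - avg n L\<bar> \<le> 2 * c / real L" unfolding 1 by (intro divide_right_mono) auto
      \<comment> \<open>The window may also gain one term, which again moves the average by at most
        the order of \<open>c / L\<close>.\<close>
      have 3: "\<bar>a' (Suc n) - avg (Suc n) L\<bar> \<le> 2 * c / real L"
      proof (cases "H (Suc n) = L")
        case True
        then show ?thesis using c0 by (simp add: a'_def)
      next
        case False
        then have HL: "H (Suc n) = Suc L" using H_Suc[of n] by (simp add: L_def)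
        have "a' (Suc n) - avg (Suc n) L = (a (Suc n + L) - avg (Suc n) L) / real (Suc L)"
          unfolding a'_def HL using L by (simp add: avg_def field_simps)
        then have "\<bar>a' (Suc n) - avg (Suc n) L\<bar> = \<bar>a (Suc n + L) - avg (Suc n) L\<bar> / real (Suc L)" by simp
        also have "\<bar>a (Suc n + L) - avg (Suc n) L\<bar> \<le> 2 * c"
        proof -
          have "\<bar>avg (Suc n) L - a (Suc n)\<bar> \<le> c" using L HL by (intro avg_close close) auto
          moreover have "\<bar>a (Suc n + L) - a (Suc n)\<bar> \<le> c" using HL by (intro close) auto
          ultimately show ?thesis by linarith
        qed
        also have "2 * c / real (Suc L) \<le> 2 * c / real L" using c0 L by (intro divide_left_mono) auto
        finally show ?thesis by (simp add: divide_right_mono)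
      qed
      have "\<bar>a' (Suc n) - a' n\<bar> \<le> 2 * c / real L + 2 * c / real L"
        using 2 3 unfolding a'_def[of n] L_def[symmetric] by linarith
      then show ?case by (simp add: L_def)
    qed
    have "filterlim H at_top sequentially"
      unfolding filterlim_at_top eventually_sequentially using H_ge less_imp_le by (metis order_less_imp_le)
    then have "filterlim (\<lambda>n. real (H n)) at_top sequentially"
      by (rule filterlim_compose[OF filterlim_real_sequentially])
    then show "(\<lambda>n. 4 * c / real (H n)) \<longlonglongrightarrow> 0" by (rule tendsto_divide_0[OF tendsto_const filterlim_at_top_imp_at_infinity])
  qed
  ultimately show thesis by (rule that)
qed

text \<open>\<open>e\<close> is the piecewise linear interpolation, written as a sum of clamped
  ramps with slopes \<open>d j\<close>. An increment of \<open>e\<close> beyond \<open>N\<close>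
  involves only slopes with \<open>j \<ge> N\<close>, and the ramps' increments add up to
  \<open>y - x\<close>.\<close>

lemma slow_interpolation:
  fixes \<alpha> :: "nat \<Rightarrow> real"
  assumes lim: "(\<lambda>n. \<alpha> (Suc n) - \<alpha> n) \<longlonglongrightarrow> 0"
  obtains e :: "real \<Rightarrow> real" where
    "\<And>n x. real n \<le> x \<Longrightarrow> x \<le> real n + 1 \<Longrightarrow> \<bar>e x - \<alpha> n\<bar> \<le> \<bar>\<alpha> (Suc n) - \<alpha> n\<bar>"
    "\<And>\<delta>. \<delta> > 0 \<Longrightarrow> \<exists>N::nat. \<forall>x\<ge>real N. \<forall>y\<ge>real N. \<bar>e y - e x\<bar> \<le> \<delta> * \<bar>y - x\<bar>"
proof -
  define d where "d n = \<alpha> (Suc n) - \<alpha> n" for n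
  define clamp where "clamp x = max 0 (min 1 x)" for x :: real
  define e where "e x = \<alpha> 0 + (\<Sum>j<nat \<lceil>x\<rceil>. d j * clamp (x - real j))" for x
  have e_eq: "e x = \<alpha> 0 + (\<Sum>j<m. d j * clamp (x - real j))" if "x \<le> real m" for x m
  proof -
    have le: "nat \<lceil>x\<rceil> \<le> m" using that by linarith
    have "(\<Sum>j<m. d j * clamp (x - real j)) = (\<Sum>j<nat \<lceil>x\<rceil>. d j * clamp (x - real j))"
    proof (rule sum.mono_neutral_right)
      show "\<forall>j\<in>{..<m} - {..<nat \<lceil>x\<rceil>}. d j * clamp (x - real j) = 0"
      proof
        fix j assume "j \<in> {..<m} - {..<nat \<lceil>x\<rceil>}"
        then have "x \<le> real j" by (simp add: nat_le_iff ceiling_le_iff)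
        then show "d j * clamp (x - real j) = 0" by (simp add: clamp_def)
      qed
    qed (use le in auto)
    then show ?thesis by (simp add: e_def)
  qed
  have clamp_sum: "(\<Sum>j<m. clamp (x - real j)) = min x (real m)" if "x \<ge> 0" for x m
    by (induction m) (use that in \<open>auto simp: clamp_def min_def max_def\<close>)
  have 1: "\<bar>e x - \<alpha> n\<bar> \<le> \<bar>\<alpha> (Suc n) - \<alpha> n\<bar>" if x: "real n \<le> x" "x \<le> real n + 1" for n x
  proof -
    have "e x = \<alpha> 0 + ((\<Sum>j<n. d j * clamp (x - real j)) + d n * clamp (x - real n))"
      using e_eq[of x "Suc n"] x by simp
    also have "(\<Sum>j<n. d j * clamp (x - real j)) = (\<Sum>j<n. d j)"
      using x by (intro sum.cong) (auto simp: clamp_def)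
    also have "(\<Sum>j<n. d j) = \<alpha> n - \<alpha> 0" unfolding d_def by (rule sum_lessThan_telescope)
    also have "clamp (x - real n) = x - real n" using x by (simp add: clamp_def)
    finally have "\<bar>e x - \<alpha> n\<bar> = \<bar>d n\<bar> * (x - real n)" using x by (simp add: abs_mult)
    also have "\<dots> \<le> \<bar>d n\<bar> * 1" using x by (intro mult_left_mono) auto
    finally show ?thesis by (simp add: d_def)
  qed
  have 2: "\<exists>N::nat. \<forall>x\<ge>real N. \<forall>y\<ge>real N. \<bar>e y - e x\<bar> \<le> \<delta> * \<bar>y - x\<bar>" if \<delta>: "\<delta> > 0" for \<delta>
  proof -
    obtain N where N: "\<And>j. j \<ge> N \<Longrightarrow> \<bar>d j\<bar> < \<delta>"
      using LIMSEQ_D[OF lim \<delta>] by (auto simp: d_def)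
    have main: "\<bar>e y - e x\<bar> \<le> \<delta> * (y - x)" if x: "real N \<le> x" and y: "x \<le> y" for x y
    proof -
      obtain m :: nat where m: "y \<le> real m" using real_arch_simple by blast
      have diff: "e y - e x = (\<Sum>j<m. d j * (clamp (y - real j) - clamp (x - real j)))"
        using e_eq[OF m] e_eq[of x m] m y by (simp add: sum_subtractf right_diff_distrib)
      have "\<bar>e y - e x\<bar> \<le> (\<Sum>j<m. \<bar>d j * (clamp (y - real j) - clamp (x - real j))\<bar>)"
        unfolding diff by (rule sum_abs)
      also have "\<dots> \<le> (\<Sum>j<m. \<delta> * (clamp (y - real j) - clamp (x - real j)))"
      proof (rule sum_mono)
        fix j
        have nn: "0 \<le> clamp (y - real j) - clamp (x - real j)" using y by (auto simp: clamp_def)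
        show "\<bar>d j * (clamp (y - real j) - clamp (x - real j))\<bar> \<le> \<delta> * (clamp (y - real j) - clamp (x - real j))"
        proof (cases "j \<ge> N")
          case True
          then show ?thesis using N[of j] nn by (auto simp: abs_mult intro!: mult_right_mono)
        next
          case False
          then have "real j + 1 \<le> x" using x by linarith
          then show ?thesis using y by (simp add: clamp_def)
        qed
      qed
      also have "\<dots> = \<delta> * (y - x)"
        unfolding sum_distrib_left[symmetric] sum_subtractf using clamp_sum x y m by simp
      finally show ?thesis .
    qed
    have "\<bar>e y - e x\<bar> \<le> \<delta> * \<bar>y - x\<bar>" if "x \<ge> real N" "y \<ge> real N" for x y
      using main[of x y] main[of y x] that by (cases "x \<le> y") (auto simp: abs_minus_commute)
    then show ?thesis by blast
  qed
  show thesis using that[OF 1 2] .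
qed

text \<open>A line of slope \<open>d\<close> through the common value at \<open>T\<close> supports
  both pieces from below, which excludes a concave kink. For a chord across \<open>T\<close>, the
  value at \<open>T\<close> therefore lies below the chord, and convexity of one piece finishes on
  either side.\<close>

lemma convex_on_glue:
  fixes f h :: "real \<Rightarrow> real"
  assumes f: "convex_on {a..T} f" and h: "convex_on {T..} h" and eq: "f T = h T"
    and fs: "\<And>u. a \<le> u \<Longrightarrow> u \<le> T \<Longrightarrow> f T + d * (u - T) \<le> f u"
    and hs: "\<And>u. T \<le> u \<Longrightarrow> f T + d * (u - T) \<le> h u"
  shows "convex_on {a..} (\<lambda>u. if u \<le> T then f u else h u)"
proof (rule convex_on_linorderI)
  fix t x y :: real
  assume t: "0 < t" "t < 1" and x: "x \<in> {a..}" and y: "y \<in> {a..}" and xy: "x < y"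
  define z where "z = (1 - t) * x + t * y"
  have z: "x < z" "z < y"
  proof -
    have "0 < t * (y - x)" "0 < (1 - t) * (y - x)" using t xy by auto
    then show "x < z" "z < y" by (auto simp: z_def algebra_simps)
  qed
  let ?G = "\<lambda>u. if u \<le> T then f u else h u"
  have "?G z \<le> (1 - t) * ?G x + t * ?G y"
  proof -
    consider "y \<le> T" | "T \<le> x" | "x < T" "T < y" by linarith
    then show ?thesis
    proof cases
      case 1
      then show ?thesis using convex_onD[OF f, of t x y] t x xy z by (simp add: z_def)
    next
      case 2
      have G_h: "?G x = h x" "?G y = h y" "?G z = h z" using 2 xy z eq by auto
      have "h z \<le> (1 - t) * h x + t * h y" using convex_onD[OF h, of t x y] 2 t xy by (simp add: z_def)
      then show ?thesis unfolding G_h .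
    next
      case 3
      \<comment> \<open>\<open>q\<close> is the weight of \<open>y\<close> in \<open>T\<close>;
        below, \<open>r\<close> places \<open>z\<close> between \<open>T\<close> and the endpoint on
        its own side.\<close>
      define q where "q = (T - x) / (y - x)"
      have q: "0 < q" "q < 1" using 3 by (auto simp: q_def)
      have Tq: "T = (1 - q) * x + q * y"
      proof -
        have "q * (y - x) = T - x" using xy by (simp add: q_def)
        then show ?thesis by (simp add: algebra_simps)
      qed
      have fT: "f T \<le> (1 - q) * f x + q * h y"
      proof -
        have "(1 - q) * (f T + d * (x - T)) + q * (f T + d * (y - T)) = f T + d * ((1 - q) * x + q * y - T)"
          by (simp add: algebra_simps)
        also have "\<dots> = f T" by (simp flip: Tq)
        finally have "f T = (1 - q) * (f T + d * (x - T)) + q * (f T + d * (y - T))" by simp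
        also have "\<dots> \<le> (1 - q) * f x + q * h y"
          using q fs[of x] hs[of y] x 3 by (intro add_mono mult_left_mono) auto
        finally show ?thesis .
      qed
      show ?thesis
      proof (cases "z \<le> T")
        case True
        define r where "r = t / q"
        have zT: "T - z = (q - t) * (y - x)" by (simp add: Tq z_def algebra_simps)
        then have "0 \<le> (q - t) * (y - x)" using True by simp
        then have tq: "t \<le> q" using xy by (simp add: zero_le_mult_iff)
        have r: "0 \<le> r" "r \<le> 1" "r * q = t" using q t tq by (auto simp: r_def)
        have "(1 - r) * x + r * T = (1 - r * q) * x + (r * q) * y" by (simp add: Tq algebra_simps)
        then have zr: "z = (1 - r) * x + r * T" by (simp add: z_def r)
        have "f z \<le> (1 - r) * f x + r * f T" using convex_onD[OF f, of r x T] r x 3 by (simp add: zr)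
        also have "\<dots> \<le> (1 - r) * f x + r * ((1 - q) * f x + q * h y)"
          using fT r by (intro add_left_mono mult_left_mono) auto
        also have "\<dots> = (1 - r * q) * f x + (r * q) * h y" by (simp add: algebra_simps)
        finally show ?thesis using True 3 by (simp add: r)
      next
        case False
        define r where "r = (1 - t) / (1 - q)"
        have zT: "T - z = (q - t) * (y - x)" by (simp add: Tq z_def algebra_simps)
        then have "(q - t) * (y - x) < 0" using False by simp
        then have tq: "q \<le> t" using xy by (simp add: mult_less_0_iff)
        have r: "0 \<le> r" "r \<le> 1" "r * (1 - q) = 1 - t" using q t tq by (auto simp: r_def)
        have "(1 - r) * y + r * T = (r * (1 - q)) * x + (1 - r * (1 - q)) * y" by (simp add: Tq algebra_simps)
        then have zr: "z = (1 - r) * y + r * T" by (simp add: z_def r)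
        have "h z \<le> (1 - r) * h y + r * h T" using convex_onD[OF h, of r y T] r 3 by (simp add: zr)
        also have "\<dots> \<le> (1 - r) * h y + r * ((1 - q) * f x + q * h y)"
          using fT r eq by (intro add_left_mono mult_left_mono) auto
        also have "\<dots> = (r * (1 - q)) * f x + (1 - r * (1 - q)) * h y" by (simp add: algebra_simps)
        finally show ?thesis using False 3 by (simp add: r)
      qed
    qed
  qed
  moreover have "(1 - t) *\<^sub>R x + t *\<^sub>R y = z" by (simp add: z_def)
  ultimately show "?G ((1 - t) *\<^sub>R x + t *\<^sub>R y) \<le> (1 - t) * ?G x + t * ?G y" by (simp only:)
qed simp

section \<open>Regular variation\<close>

context orlicz
begin

lemma F_subgradient:
  assumes "u > 0" shows "\<exists>v. \<forall>y\<ge>0. F u + v * (y - u) \<le> F y"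
  using convex_le_Inf_differential[OF F_convex, of u] assms by (auto simp: interior_real_atLeast)

lemma equivalent_functions_refl: "equivalent_functions F F"
  unfolding equivalent_functions_def by (intro exI[of _ 1]) simp

text \<open>By convexity \<open>F u / u\<close> increases, so if bounded it has a limit, which is
  positive; \<open>F\<close> is then asymptotically linear.\<close>

lemma regularly_varying_linear:
  assumes bdd: "\<And>u. u > 0 \<Longrightarrow> F u / u \<le> B"
  shows "regularly_varying F 1"
proof -
  define L where "L = (SUP u\<in>{0<..}. F u / u)"
  have bd: "bdd_above ((\<lambda>u. F u / u) ` {0<..})" using bdd by (intro bdd_aboveI2[of _ _ B]) auto
  have le_L: "F u / u \<le> L" if "u > 0" for u unfolding L_def using that bd by (intro cSUP_upper) auto
  have lim: "((\<lambda>u. F u / u) \<longlongrightarrow> L) at_top"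
  proof (rule increasing_tendsto)
    show "eventually (\<lambda>u. F u / u \<le> L) at_top"
      using eventually_gt_at_top[of 0] by eventually_elim (rule le_L)
    fix x assume "x < L"
    then obtain u where u: "u > 0" "x < F u / u" unfolding L_def using bd by (auto simp: less_cSUP_iff)
    show "eventually (\<lambda>u. x < F u / u) at_top"
      using eventually_ge_at_top[of u]
    proof eventually_elim
      case (elim v)
      then show ?case using F_divide_mono[of u v] u by linarith
    qed
  qed
  have Lpos: "L > 0"
  proof -
    obtain u where u: "u > 0" "F u = 1" by (rule F_attains[of 1]) auto
    then have "0 < F u / u" by simp
    then show ?thesis using le_L[OF u(1)] by linarith
  qed
  show ?thesis unfolding regularly_varying_def
  proof (intro allI impI)
    fix u :: real assume u: "u > 0"
    have shift: "filterlim (\<lambda>t. t * u) at_top at_top"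
      using u by (intro filterlim_at_top_mult_tendsto_pos[OF tendsto_const _ filterlim_ident])
    have "((\<lambda>t. u * ((F (t * u) / (t * u)) / (F t / t))) \<longlongrightarrow> u * (L / L)) at_top"
      using Lpos by (intro tendsto_intros lim filterlim_compose[OF lim shift]) auto
    moreover have "eventually (\<lambda>t. u * ((F (t * u) / (t * u)) / (F t / t)) = F (t * u) / F t) at_top"
      using eventually_gt_at_top[of 0] by eventually_elim (use u in \<open>simp add: field_simps\<close>)
    ultimately have "((\<lambda>t. F (t * u) / F t) \<longlongrightarrow> u * (L / L)) at_top" by (rule Lim_transform_eventually)
    then show "((\<lambda>t. F (t * u) / F t) \<longlongrightarrow> u powr 1) at_top" using Lpos u by simp
  qed
qed

text \<open>At a subgradient \<open>v\<close> of \<open>F\<close> at \<open>u\<close>, Young's inequality is an equality: \<open>F\<^sup>* v = u v - F u\<close>.\<close>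

lemma complementary_delta2_growth:
  assumes d: "delta2_large (complementary F)" and unb: "\<And>B. \<exists>u>0. B < F u / u"
  obtains l U where "l \<ge> 1" "U > 0" "\<And>u. u \<ge> U \<Longrightarrow> 2 * l * F u \<le> F (l * u)"
proof -
  obtain C v0 where C: "C \<ge> 1" and d2: "\<And>v. v \<ge> v0 \<Longrightarrow> complementary F (2 * v) \<le> ereal C * complementary F v"
    using d unfolding delta2_large_def by blast
  \<comment> \<open>Ensures \<open>C \<le> 2 * l\<close>, so that in testing the supremum for
    \<open>2 * v\<close> at \<open>l * u\<close> the terms \<open>2 * l * u * v\<close>
    cancel.\<close>
  define l where "l = max 1 (C / 2)"
  obtain U where U: "U > 0" "v0 < F U / U" using unb by blast
  show thesis
  proof (rule that[of l U])
    fix u assume u: "u \<ge> U"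
    then have u0: "u > 0" using U by simp
    obtain v where v: "\<And>y. y \<ge> 0 \<Longrightarrow> F u + v * (y - u) \<le> F y" using F_subgradient[OF u0] by blast
    have Fu: "F u \<le> v * u" using v[of 0] by simp
    have "v0 < F u / u" using U F_divide_mono[of U u] u by linarith
    also have "\<dots> \<le> v" using Fu u0 by (simp add: field_simps)
    finally have v_ge: "v \<ge> v0" by simp
    have star: "complementary F v \<le> ereal (u * v - F u)"
      unfolding complementary_def
    proof (rule SUP_least)
      fix y :: real assume "y \<in> {0..}"
      then show "ereal (y * v - F y) \<le> ereal (u * v - F u)" using v[of y] by (simp add: algebra_simps)
    qed
    have "ereal ((l * u) * (2 * v) - F (l * u)) \<le> complementary F (2 * v)"
      unfolding complementary_def using u0 by (intro SUP_upper) (auto simp: l_def)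
    also have "\<dots> \<le> ereal C * complementary F v" by (rule d2[OF v_ge])
    also have "\<dots> \<le> ereal C * ereal (u * v - F u)" using star C by (intro ereal_mult_left_mono) auto
    finally have "(l * u) * (2 * v) - F (l * u) \<le> C * (u * v - F u)" by simp
    also have "\<dots> \<le> (2 * l) * (u * v - F u)"
      using Fu by (intro mult_right_mono) (auto simp: l_def mult.commute)
    finally show "2 * l * F u \<le> F (l * u)" by (simp add: algebra_simps)
  qed (use U in \<open>auto simp: l_def\<close>)
qed

end

context orlicz_delta2
begin

text \<open>Integrating an increasing, regularly varying \<open>g\<close> gives a convex function,
  and l'Hospital's rule passes regular variation from the derivative to the integral. Near zero
  \<open>F\<close> itself is kept, since the equivalence has to hold there too.\<close>

lemma regularly_varying_glue:
  assumes T: "T \<ge> u1" and cont: "continuous_on {T..} g" and pos: "\<And>u. u \<ge> T \<Longrightarrow> 0 < g u"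
    and mono: "\<And>u v. T \<le> u \<Longrightarrow> u \<le> v \<Longrightarrow> g u \<le> g v"
    and K: "K > 0" and gF: "\<And>u. u \<ge> T \<Longrightarrow> u * g u \<le> K * F u" and Fg: "\<And>u. u \<ge> T \<Longrightarrow> F u \<le> K * (u * g u)"
    and rv: "\<And>u. u > 0 \<Longrightarrow> ((\<lambda>t. g (t * u) / g t) \<longlongrightarrow> u powr (p - 1)) at_top"
  shows "\<exists>G. orlicz_function G \<and> regularly_varying G p \<and> equivalent_functions F G"
proof -
  \<comment> \<open>The integral has a two-sided derivative only beyond \<open>T\<close>, so the
    joint is placed strictly to the right of it.\<close>
  define S where "S = 2 * T"
  have T0: "T > 0" using T u1 by simp
  have S: "T < S" "S > 0" "u1 \<le> S" using T0 T by (auto simp: S_def)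
  obtain d where d: "\<And>y. y \<ge> 0 \<Longrightarrow> F S + d * (y - S) \<le> F y" using F_subgradient[OF S(2)] by blast
  \<comment> \<open>Chosen so that \<open>c * g S = g S + \<bar>d\<bar>\<close>: the right-hand
    piece leaves \<open>S\<close> at least as steeply as the supporting line of
    \<open>F\<close>.\<close>
  define c where "c = 1 + \<bar>d\<bar> / g S"
  have gS: "g S > 0" using pos S by simp
  have c: "c \<ge> 1" "d \<le> c * g S"
  proof -
    have "c * g S = g S + \<bar>d\<bar>" using gS by (simp add: c_def field_simps)
    then show "d \<le> c * g S" using gS by linarith
  qed (use gS in \<open>simp add: c_def\<close>)
  define h where "h u = F S + c * (integral {T..u} g - integral {T..S} g)" for u
  have hS: "h S = F S" by (simp add: h_def)
  have dh: "(h has_real_derivative c * g u) (at u)" if u: "u > T" for u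
  proof -
    have "((\<lambda>x. integral {T..x} g) has_real_derivative g u) (at u within {T..u + 1})"
      using u cont by (intro integral_has_real_derivative) (auto intro: continuous_on_subset)
    then have "((\<lambda>x. integral {T..x} g) has_real_derivative g u) (at u)"
      using at_within_interior[of u "{T..u + 1}"] u by (simp add: interior_atLeastAtMost_real)
    then show ?thesis unfolding h_def by (auto intro!: derivative_eq_intros)
  qed
  have mvt: "\<exists>z. x < z \<and> z < y \<and> h y - h x = (y - x) * (c * g z)" if "T < x" "x < y" for x y
    using MVT2[of x y h "\<lambda>u. c * g u"] dh that by fastforce
  have slope: "(y - x) * (c * g x) \<le> h y - h x \<and> h y - h x \<le> (y - x) * (c * g y)" if xy: "T < x" "x \<le> y" for x y
  proof (cases "x = y")
    case False
    then obtain z where z: "x < z" "z < y" "h y - h x = (y - x) * (c * g z)" using mvt[of x y] xy by auto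
    then show ?thesis using c xy mono[of x z] mono[of z y] by (auto intro!: mult_left_mono)
  qed simp
  define G where "G u = (if u \<le> S then F u else h u)" for u
  have G_h: "G u = h u" if "u \<ge> S" for u using that hS by (cases "u = S") (auto simp: G_def)
  have h_ge: "F S \<le> h u" if "u \<ge> S" for u
  proof -
    have "0 \<le> (u - S) * (c * g S)" using that c gS by simp
    then show ?thesis using slope[of S u] S that hS by linarith
  qed
  have h_conv: "convex_on {S..} h"
    using S c mono by (intro convex_on_realI[where f' = "\<lambda>u. c * g u"] dh) (auto intro!: mult_left_mono)
  have G_conv: "convex_on {0..} G" unfolding G_def
  proof (rule convex_on_glue[where d = d])
    show "convex_on {0..S} F" by (rule convex_on_subset[OF F_convex]) auto
    fix u assume u: "S \<le> u"
    have "d * (u - S) \<le> (c * g S) * (u - S)" using c u by (intro mult_right_mono) auto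
    then show "F S + d * (u - S) \<le> h u" using slope[of S u] S u hS by (simp add: mult.commute)
  qed (use h_conv hS d in auto)
  have G_mono: "mono_on {0..} G"
  proof (rule mono_onI)
    fix x y :: real assume xy: "x \<in> {0..}" "y \<in> {0..}" "x \<le> y"
    consider "y \<le> S" | "x \<le> S" "S < y" | "S < x" by linarith
    then show "G x \<le> G y"
    proof cases
      case 1
      then show ?thesis using xy F_mono[of x y] by (simp add: G_def)
    next
      case 2
      then show ?thesis using xy F_mono[of x S] h_ge[of y] by (simp add: G_def)
    next
      case 3
      have "0 \<le> (y - x) * (c * g x)" using xy 3 c pos[of x] S by simp
      then show ?thesis using slope[of x y] 3 xy S by (simp add: G_def)
    qed
  qed
  have FS: "F S > 0" using F_mono[of u1 S] u1 S by linarith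
  have "orlicz_function G" unfolding orlicz_function_def
    using G_conv G_mono S FS by (auto intro!: exI[of _ S] simp: G_def)
  moreover have equiv: "equivalent_functions F G"
  proof -
    define E where "E = 1 + c * K + D + D * K"
    have E: "E \<ge> 1 + c * K" "E \<ge> D" "E \<ge> D * K" "E > 1" "E > 0"
      using D K c by (auto simp: E_def add_pos_nonneg add_pos_pos)
    have "F u \<le> E * G u \<and> G u \<le> E * F u" if u: "u \<ge> 0" for u
    proof (cases "u \<le> S")
      case True
      then show ?thesis using F_nonneg[OF u] E mult_right_mono[of 1 E "F u"] by (simp add: G_def)
    next
      case False
      then have uS: "u > S" by simp
      have Fu: "F u \<ge> 0" using F_nonneg[OF u] .
      have "h u - h S \<le> (u - S) * (c * g u)" using slope[of S u] S uS by simp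
      also have "\<dots> \<le> u * (c * g u)" using S uS c pos[of u] by (intro mult_right_mono) auto
      also have "\<dots> \<le> c * (K * F u)" using gF[of u] uS S c by (simp add: mult.left_commute)
      finally have "G u \<le> F S + c * K * F u" using hS uS by (simp add: G_def)
      also have "\<dots> \<le> (1 + c * K) * F u" using F_mono[of S u] S uS by (simp add: algebra_simps)
      also have "\<dots> \<le> E * F u" using E Fu by (intro mult_right_mono) auto
      finally have up: "G u \<le> E * F u" .
      have Gu: "G u = h u" "0 \<le> h u" using uS h_ge[of u] FS by (auto simp: G_def)
      have "F u \<le> E * G u"
      proof (cases "u \<le> 2 * S")
        case True
        \<comment> \<open>Close to \<open>S\<close> the integral is too short to be compared with
          \<open>u * g u\<close>; doubling and \<open>F S \<le> h u\<close> do instead.\<close>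
        have "F u \<le> F (2 * S)" using u True by (rule F_mono)
        also have "\<dots> \<le> D * F S" using S by (intro F_double)
        also have "\<dots> \<le> D * h u" using h_ge[of u] uS D by (intro mult_left_mono) auto
        also have "\<dots> \<le> E * h u" using E Gu by (intro mult_right_mono) auto
        finally show ?thesis using Gu by simp
      next
        case False
        \<comment> \<open>Beyond \<open>2 * S\<close> the integral over the upper half
          \<open>[u / 2, u]\<close> alone is at least \<open>u / 2 * g (u / 2)\<close>, comparable
          with \<open>F (u / 2)\<close>.\<close>
        have u2: "u / 2 > S" using False by simp
        have "F u = F (2 * (u / 2))" by simp
        also have "\<dots> \<le> D * F (u / 2)" using u2 S by (intro F_double) auto
        also have "\<dots> \<le> D * (K * (u / 2 * g (u / 2)))" using Fg[of "u / 2"] u2 S D by (intro mult_left_mono) auto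
        also have "u / 2 * g (u / 2) \<le> h u"
        proof -
          have "1 * (u / 2 * g (u / 2)) \<le> c * (u / 2 * g (u / 2))"
            using c u2 S pos[of "u / 2"] by (intro mult_right_mono) auto
          also have "\<dots> \<le> h u - h (u / 2)" using slope[of "u / 2" u] u2 S by (simp add: mult_ac)
          finally show ?thesis using h_ge[of "u / 2"] u2 FS by linarith
        qed
        also have "D * (K * h u) \<le> E * h u"
          using E(3) Gu mult_right_mono[of "D * K" E "h u"] by (simp add: mult.assoc)
        finally show ?thesis using Gu D K by (simp add: mult_left_mono)
      qed
      then show ?thesis using up by simp
    qed
    then show ?thesis unfolding equivalent_functions_def using E by blast
  qed
  moreover have "regularly_varying G p" unfolding regularly_varying_def
  proof (intro allI impI)
    fix u :: real assume u: "u > 0"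
    have G_top: "filterlim G at_top at_top"
    proof -
      obtain E where E: "E > 0" "\<And>v. v \<ge> 0 \<Longrightarrow> F v \<le> E * G v"
        using equiv unfolding equivalent_functions_def by blast
      have "filterlim (\<lambda>v. F v * (1 / E)) at_top at_top"
        using E by (intro filterlim_at_top_mult_tendsto_pos[OF tendsto_const _ F_at_top]) auto
      then show ?thesis
        by (rule filterlim_at_top_mono)
           (use eventually_ge_at_top[of 0] in eventually_elim, use E in \<open>auto simp: field_simps\<close>)
    qed
    have dG: "(G has_real_derivative c * g t) (at t)" if "t > S" for t
      using dh[of t] that S
      by (intro has_field_derivative_transform_within_open[of h _ t "{S<..}" G]) (auto simp: G_def)
    show "((\<lambda>t. G (t * u) / G t) \<longlongrightarrow> u powr p) at_top"
    proof (rule lhospital_at_top_at_top[OF G_top])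
      show "eventually (\<lambda>t. c * g t \<noteq> 0) at_top"
        using eventually_ge_at_top[of T] by eventually_elim (use c pos in fastforce)
      show "eventually (\<lambda>t. (G has_real_derivative c * g t) (at t)) at_top"
        using eventually_gt_at_top[of S] by eventually_elim (rule dG)
      show "eventually (\<lambda>t. ((\<lambda>t. G (t * u)) has_real_derivative c * g (t * u) * u) (at t)) at_top"
        using eventually_gt_at_top[of "S / u"]
      proof eventually_elim
        case (elim t)
        then have "S < t * u" using u by (simp add: field_simps)
        then show ?case
          by (intro DERIV_chain2[of G _ "\<lambda>t. t * u"] dG) (auto intro!: derivative_eq_intros)
      qed
      have "((\<lambda>t. u * (g (t * u) / g t)) \<longlongrightarrow> u * u powr (p - 1)) at_top"
        by (intro tendsto_mult tendsto_const rv u)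
      also have "u * u powr (p - 1) = u powr p" using u by (simp add: powr_diff)
      finally show "((\<lambda>t. c * g (t * u) * u / (c * g t)) \<longlongrightarrow> u powr p) at_top"
        using c by (simp add: mult.commute)
    qed
  qed
  ultimately show ?thesis by blast
qed

end

section \<open>Regular variation from the pointwise condition\<close>

context orlicz_cells
begin

text \<open>For fixed \<open>s\<close> one cell with \<open>b k < s powr p / 2\<close> suffices,
  because it admits all large \<open>u\<close>; the error is absorbed, and \<open>E\<close> does not
  depend on \<open>s\<close>.\<close>

lemma lp_like_eventually:
  assumes "lp_like F W p"
  obtains E where "E \<ge> 1" "\<And>s. 0 < s \<Longrightarrow> s \<le> 1 \<Longrightarrow>
    eventually (\<lambda>u. F (s * u) \<le> E * s powr p * F u \<and> s powr p * F u \<le> E * F (s * u)) at_top"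
proof -
  obtain C b where C: "C > 0" and sb: "summable b" and b: "\<And>k. 0 \<le> b k"
    and up: "\<And>k u s. 0 \<le> s \<Longrightarrow> s \<le> 1 \<Longrightarrow> 0 \<le> u \<Longrightarrow> 1 \<le> F u * W k \<Longrightarrow> F (s * u) \<le> (C * s powr p + b k) * F u"
    and lo: "\<And>k u s. 0 \<le> s \<Longrightarrow> s \<le> 1 \<Longrightarrow> 0 \<le> u \<Longrightarrow> 1 \<le> F u * W k \<Longrightarrow> s powr p * F u \<le> C * F (s * u) + b k * F u"
    using assms unfolding lp_like_def by blast
  show thesis
  proof (rule that[of "2 * C + 1"])
    fix s :: real assume s: "0 < s" "s \<le> 1"
    define q where "q = s powr p"
    have q: "q > 0" using s by (simp add: q_def)
    have "eventually (\<lambda>k. b k < q / 2) sequentially"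
      using summable_LIMSEQ_zero[OF sb] by (rule order_tendstoD) (use q in simp)
    then obtain k where k: "b k < q / 2" by (auto simp: eventually_sequentially)
    show "eventually (\<lambda>u. F (s * u) \<le> (2 * C + 1) * s powr p * F u \<and> s powr p * F u \<le> (2 * C + 1) * F (s * u)) at_top"
      using eventually_admissible[of k]
    proof eventually_elim
      case (elim u)
      note p = admissible_pos[OF elim]
      have a: "0 \<le> u" "1 \<le> F u * W k" using elim by (auto simp: admissible_def)
      have "F (s * u) \<le> (C * q + b k) * F u" using up[of s u k] s a by (simp add: q_def)
      also have "\<dots> \<le> ((2 * C + 1) * q) * F u"
      proof -
        have "C * q > 0" using C q by simp
        then show ?thesis using k p q by (intro mult_right_mono) (auto simp: distrib_right)
      qed
      finally have 1: "F (s * u) \<le> (2 * C + 1) * q * F u" .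
      have "q * F u \<le> C * F (s * u) + b k * F u" using lo[of s u k] s a by (simp add: q_def)
      also have "b k * F u \<le> q / 2 * F u" using k p by (intro mult_right_mono) auto
      finally have "q * F u \<le> 2 * C * F (s * u)" by simp
      also have "\<dots> \<le> (2 * C + 1) * F (s * u)" using F_nonneg[of "s * u"] s p by (intro mult_right_mono) auto
      finally show ?case using 1 by (simp add: q_def)
    qed
  qed (use C in simp)
qed

text \<open>Otherwise \<open>F\<close> would grow by \<open>(2 * l) ^ j\<close> when its argument
  grows by \<open>l ^ j\<close>, exceeding linear growth by \<open>2 ^ j\<close>, whereas exponent
  one tolerates only the fixed factor \<open>E\<close>.\<close>

lemma lp_like_one_imp_linear:
  assumes "lp_like F W 1" and d: "delta2_large (complementary F)"
  shows "\<exists>B. \<forall>u>0. F u / u \<le> B"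
proof (rule ccontr)
  assume "\<not> ?thesis"
  then have "\<And>B. \<exists>u>0. B < F u / u" by (meson not_le)
  then obtain l U where l: "l \<ge> 1" and U: "U > 0" and grow: "\<And>u. u \<ge> U \<Longrightarrow> 2 * l * F u \<le> F (l * u)"
    using complementary_delta2_growth[OF d] by blast
  obtain E where E: "E \<ge> 1" and ev: "\<And>s. 0 < s \<Longrightarrow> s \<le> 1 \<Longrightarrow>
    eventually (\<lambda>u. F (s * u) \<le> E * s powr 1 * F u \<and> s powr 1 * F u \<le> E * F (s * u)) at_top"
    using lp_like_eventually[OF assms(1)] by blast
  obtain j :: nat where j: "E < 2 ^ j" using real_arch_pow[of 2 E] by auto
  have iter: "(2 * l) ^ i * F u \<le> F (l ^ i * u)" if "u \<ge> U" for u i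
  proof (induction i)
    case (Suc i)
    have "1 * u \<le> l ^ i * u" using l that U by (intro mult_right_mono) auto
    then have "2 * l * F (l ^ i * u) \<le> F (l * (l ^ i * u))" using that by (intro grow) simp
    moreover have "2 * l * ((2 * l) ^ i * F u) \<le> 2 * l * F (l ^ i * u)"
      using Suc l by (intro mult_left_mono) auto
    ultimately show ?case by (simp add: mult_ac)
  qed simp
  define s where "s = 1 / l ^ j"
  have s: "0 < s" "s \<le> 1" using l by (auto simp: s_def)
  have "eventually (\<lambda>u::real. False) at_top"
    using ev[OF s] eventually_ge_at_top[of "l ^ j * max U u1"]
  proof eventually_elim
    case (elim u)
    have su: "l ^ j * (s * u) = u" using l by (simp add: s_def)
    have su_ge: "s * u \<ge> max U u1" using elim(2) l unfolding s_def by (simp add: pos_le_divide_eq mult.commute del: max.bounded_iff)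
    have pos: "F (s * u) > 0" using F_mono[of u1 "s * u"] u1 su_ge by simp
    have "(2 * l) ^ j * F (s * u) \<le> F u" using iter[of "s * u" j] su su_ge by simp
    then have "s * ((2 * l) ^ j * F (s * u)) \<le> s * F u" using s by (intro mult_left_mono) auto
    also have "\<dots> \<le> E * F (s * u)" using elim s by simp
    finally have "s * (2 * l) ^ j \<le> E" using pos by simp
    moreover have "s * (2 * l) ^ j = 2 ^ j" using l by (simp add: s_def power_mult_distrib)
    ultimately show False using j by linarith
  qed
  then show False by (auto simp: eventually_at_top_linorder)
qed

theorem lp_like_imp_regularly_varying:
  assumes lp: "lp_like F W p" and p: "p > 1"
  shows "\<exists>G. orlicz_function G \<and> regularly_varying G p \<and> equivalent_functions F G"
proof -
  obtain E where E: "E \<ge> 1" and ev: "\<And>s. 0 < s \<Longrightarrow> s \<le> 1 \<Longrightarrow>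
    eventually (\<lambda>u. F (s * u) \<le> E * s powr p * F u \<and> s powr p * F u \<le> E * F (s * u)) at_top"
    using lp_like_eventually[OF lp] by blast
  define c where "c = ln E"
  have c: "c \<ge> 0" using E by (simp add: c_def)
  \<comment> \<open>The logarithm of \<open>F u / u powr p\<close> at \<open>u = 2 ^ n\<close>.
    Since \<open>E\<close> does not depend on \<open>s\<close>, its increments over any fixed
    distance \<open>h\<close> are eventually bounded by the same \<open>c\<close>.\<close>
  define a where "a n = ln (F (2 ^ n)) - real n * p * ln 2" for n :: nat
  have pow_top: "filterlim (\<lambda>n. (2::real) ^ n) at_top sequentially"
    by (rule filterlim_at_top_mono[OF filterlim_real_sequentially]) (simp add: less_imp_le of_nat_less_two_power)
  have F_pos: "F u > 0" if "u \<ge> u1" for u using F_mono[of u1 u] u1 that by linarith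
  have slow: "\<exists>N. \<forall>n\<ge>N. \<bar>a (n + h) - a n\<bar> \<le> c" for h
  proof -
    define s where "s = 1 / (2::real) ^ h"
    have s: "0 < s" "s \<le> 1" by (auto simp: s_def)
    have lns: "ln s = - (real h * ln 2)" by (simp add: s_def ln_div ln_realpow)
    have top: "filterlim (\<lambda>n. (2::real) ^ (n + h)) at_top sequentially"
      using pow_top by (rule filterlim_compose) (rule filterlim_add_const_nat_at_top)
    have "eventually (\<lambda>n. \<bar>a (n + h) - a n\<bar> \<le> c) sequentially"
      using eventually_compose_filterlim[OF ev[OF s] top]
        eventually_compose_filterlim[OF eventually_ge_at_top[of u1] pow_top]
    proof eventually_elim
      case (elim n)
      have su: "s * 2 ^ (n + h) = 2 ^ n" by (simp add: s_def power_add)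
      have le: "(2::real) ^ n \<le> 2 ^ (n + h)" by (intro power_increasing) auto
      have pos: "F (2 ^ n) > 0" "F (2 ^ (n + h)) > 0" using elim(2) order_trans[OF elim(2) le] by (auto intro!: F_pos)
      have "ln (F (2 ^ n)) \<le> ln (E * s powr p * F (2 ^ (n + h)))"
        using elim pos E s unfolding su by (intro ln_mono) auto
      also have "\<dots> = c - real h * p * ln 2 + ln (F (2 ^ (n + h)))"
        using pos E s by (simp add: ln_mult ln_powr lns c_def)
      finally have 1: "a n \<le> c + a (n + h)" by (simp add: a_def algebra_simps)
      have "ln (s powr p * F (2 ^ (n + h))) \<le> ln (E * F (2 ^ n))"
        using elim pos E s unfolding su by (intro ln_mono) auto
      then have "- (real h * p * ln 2) + ln (F (2 ^ (n + h))) \<le> c + ln (F (2 ^ n))"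
        using pos E s by (simp add: ln_mult ln_powr lns c_def mult_ac)
      then have "a (n + h) \<le> c + a n" by (simp add: a_def algebra_simps)
      then show ?case using 1 by (simp add: abs_le_iff)
    qed
    then show ?thesis by (simp add: eventually_sequentially)
  qed
  obtain \<alpha> N1 where close: "\<And>n. n \<ge> N1 \<Longrightarrow> \<bar>\<alpha> n - a n\<bar> \<le> c"
    and \<alpha>0: "(\<lambda>n. \<alpha> (Suc n) - \<alpha> n) \<longlonglongrightarrow> 0" using moving_average[OF slow] by blast
  obtain e where e1: "\<And>n x. real n \<le> x \<Longrightarrow> x \<le> real n + 1 \<Longrightarrow> \<bar>e x - \<alpha> n\<bar> \<le> \<bar>\<alpha> (Suc n) - \<alpha> n\<bar>"
    and e2: "\<And>\<delta>. \<delta> > 0 \<Longrightarrow> \<exists>N::nat. \<forall>x\<ge>real N. \<forall>y\<ge>real N. \<bar>e y - e x\<bar> \<le> \<delta> * \<bar>y - x\<bar>"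
    using slow_interpolation[OF \<alpha>0] by blast
  obtain N2 where N2: "\<And>n. n \<ge> N2 \<Longrightarrow> \<bar>\<alpha> (Suc n) - \<alpha> n\<bar> \<le> 1"
    using LIMSEQ_D[OF \<alpha>0, of 1] by (auto intro: less_imp_le)
  \<comment> \<open>With this Lipschitz constant in \<open>log 2 u\<close>, the factor
    \<open>exp (e (log 2 u))\<close> decreases no faster than \<open>u powr (p - 1)\<close>
    increases. Its positivity is where \<open>p > 1\<close> enters.\<close>
  define \<epsilon> where "\<epsilon> = (p - 1) * ln 2"
  have \<epsilon>: "\<epsilon> > 0" using p by (simp add: \<epsilon>_def)
  obtain N3 :: nat where N3: "\<And>x y. x \<ge> real N3 \<Longrightarrow> y \<ge> real N3 \<Longrightarrow> \<bar>e y - e x\<bar> \<le> \<epsilon> * \<bar>y - x\<bar>"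
    using e2[OF \<epsilon>] by blast
  obtain N4 :: nat where N4: "u1 < 2 ^ N4" using real_arch_pow[of 2 u1] by auto
  define N where "N = Max {N1, N2, N3, N4}"
  have N: "N \<ge> N1" "N \<ge> N2" "N \<ge> N3" "N \<ge> N4" by (auto simp: N_def)
  define T where "T = (2::real) ^ N"
  \<comment> \<open>Designed so that \<open>u * g u\<close> is \<open>u powr p\<close> times the
    smoothed slowly varying factor, hence comparable with \<open>F u\<close>.\<close>
  define g where "g u = u powr (p - 1) * exp (e (log 2 u))" for u
  have T: "T \<ge> u1" "T > 0"
  proof -
    have "(2::real) ^ N4 \<le> T" unfolding T_def using N by (intro power_increasing) auto
    then show "T \<ge> u1" using N4 by simp
  qed (simp add: T_def)
  have logT: "log 2 u \<ge> real N" if "u \<ge> T" for u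
  proof -
    have "u > 0" using that T by linarith
    then show ?thesis using that by (simp add: le_log_iff T_def powr_realpow)
  qed
  \<comment> \<open>\<open>2 powr p\<close> and \<open>D\<close> pay for replacing \<open>u\<close>
    by the power of two below it; in the exponent, \<open>c\<close> comes from averaging and 1 from
    interpolating.\<close>
  define K where "K = 2 powr p * exp (c + 1) * D"
  have K: "K > 0" using D by (simp add: K_def)
  have cmp: "u * g u \<le> K * F u \<and> F u \<le> K * (u * g u)" if u: "u \<ge> T" for u
  proof -
    define x where "x = log 2 u"
    have u0: "u > 0" using u T by simp
    have ux: "u = 2 powr x" using u0 by (simp add: x_def)
    define n where "n = nat \<lfloor>x\<rfloor>"
    have xN: "x \<ge> real N" using logT[OF u] by (simp add: x_def)
    have n: "real n \<le> x" "x \<le> real n + 1" using xN by (simp_all add: n_def)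
    have nN: "n \<ge> N" using xN by (simp add: n_def le_nat_iff le_floor_iff)
    have "\<bar>e x - a n\<bar> \<le> c + 1"
      using e1[OF n] close[of n] N2[of n] nN N by linarith
    then have ea: "exp (a n) \<le> exp (c + 1) * exp (e x)" "exp (e x) \<le> exp (c + 1) * exp (a n)"
      by (auto simp flip: exp_add)
    have u2: "2 ^ n \<le> u" "u \<le> 2 * 2 ^ n"
    proof -
      show "2 ^ n \<le> u" using powr_mono[of "real n" x 2] n by (simp add: ux powr_realpow)
      show "u \<le> 2 * 2 ^ n" using powr_mono[of x "real n + 1" 2] n by (simp add: ux powr_realpow powr_add)
    qed
    have nu1: "u1 \<le> 2 ^ n"
    proof -
      have "T \<le> 2 ^ n" unfolding T_def using nN by (intro power_increasing) auto
      then show ?thesis using T by simp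
    qed
    have np: "F (2 ^ n) > 0" using nu1 by (rule F_pos)
    have "exp (a n) = F (2 ^ n) / exp (real n * p * ln 2)" using np by (simp add: a_def exp_diff)
    also have "exp (real n * p * ln 2) = 2 powr (real n * p)" by (simp add: powr_def)
    finally have ean: "exp (a n) * 2 powr (real n * p) = F (2 ^ n)" by simp
    have ug: "u * g u = 2 powr (x * p) * exp (e x)"
    proof -
      have "u * u powr (p - 1) = u powr p" using u0 by (simp add: powr_diff)
      also have "\<dots> = 2 powr (x * p)" by (simp add: ux powr_powr)
      finally show ?thesis by (simp add: g_def x_def mult.assoc[symmetric])
    qed
    have F2: "F (2 ^ n) \<le> F u" "F u \<le> D * F (2 ^ n)"
      using F_mono[of "2 ^ n" u] F_mono[of u "2 * 2 ^ n"] F_double[OF nu1] u2 u0 by auto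
    have "u * g u \<le> 2 powr ((real n + 1) * p) * (exp (c + 1) * exp (a n))"
      unfolding ug using ea n p by (intro mult_mono powr_mono mult_right_mono) auto
    also have "\<dots> = 2 powr p * exp (c + 1) * F (2 ^ n)"
      by (simp flip: ean add: distrib_right powr_add)
    also have "\<dots> \<le> 2 powr p * exp (c + 1) * (D * F u)"
      using F2(1) D np mult_mono[of 1 D "F (2 ^ n)" "F u"] by (intro mult_left_mono) auto
    finally have 1: "u * g u \<le> K * F u" by (simp add: K_def mult.assoc)
    have "F u \<le> D * F (2 ^ n)" by (rule F2)
    also have "F (2 ^ n) \<le> (exp (c + 1) * exp (e x)) * 2 powr (x * p)"
      unfolding ean[symmetric] using ea n p by (intro mult_mono powr_mono mult_right_mono) auto
    also have "\<dots> = exp (c + 1) * (u * g u)" by (simp add: ug)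
    finally have "F u \<le> D * (exp (c + 1) * (u * g u))" using D by (simp add: mult_left_mono)
    also have "\<dots> \<le> 2 powr p * (D * (exp (c + 1) * (u * g u)))"
      using mult_right_mono[of 1 "2 powr p" "D * (exp (c + 1) * (u * g u))"] D p u0
      by (simp add: ge_one_powr_ge_zero g_def)
    finally show ?thesis using 1 by (simp add: K_def mult_ac)
  qed
  have e_cont: "continuous_on {real N..} e"
  proof (rule lipschitz_on_continuous_on[of \<epsilon>], rule lipschitz_onI)
    fix x y assume "x \<in> {real N..}" "y \<in> {real N..}"
    then show "dist (e x) (e y) \<le> \<epsilon> * dist x y" using N3[of y x] N by (simp add: dist_real_def)
  qed (use \<epsilon> in simp)
  show ?thesis
  proof (rule regularly_varying_glue[OF T(1)])
    have log_cont: "continuous_on {T..} (log 2)" using T by (intro continuous_intros) auto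
    have "continuous_on {T..} (\<lambda>u. e (log 2 u))"
      by (rule continuous_on_compose2[OF e_cont log_cont]) (use logT in auto)
    then show "continuous_on {T..} g" unfolding g_def using T by (intro continuous_intros) auto
    show "0 < g u" if "u \<ge> T" for u using that T by (simp add: g_def)
    show "g u \<le> g v" if uv: "T \<le> u" "u \<le> v" for u v
    proof -
      have pos: "u > 0" "v > 0" using uv T by auto
      have "\<bar>e (log 2 v) - e (log 2 u)\<bar> \<le> \<epsilon> * \<bar>log 2 v - log 2 u\<bar>"
        using logT[of u] logT[of v] uv N by (intro N3) auto
      also have "\<bar>log 2 v - log 2 u\<bar> = log 2 v - log 2 u" using uv pos by simp
      also have "\<epsilon> * (log 2 v - log 2 u) = (p - 1) * (ln v - ln u)" by (simp add: \<epsilon>_def log_def field_simps)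
      finally have "(p - 1) * ln u + e (log 2 u) \<le> (p - 1) * ln v + e (log 2 v)" by (simp add: algebra_simps)
      then have "exp ((p - 1) * ln u + e (log 2 u)) \<le> exp ((p - 1) * ln v + e (log 2 v))" by simp
      then show ?thesis using pos by (simp add: g_def powr_def exp_add)
    qed
    show "u * g u \<le> K * F u" "F u \<le> K * (u * g u)" if "u \<ge> T" for u using cmp[OF that] by auto
    show "K > 0" by (rule K)
    fix u :: real assume u: "u > 0"
    \<comment> \<open>\<open>log 2 (t * u)\<close> and \<open>log 2 t\<close> keep the fixed
      distance \<open>log 2 u\<close>, while the Lipschitz constant of \<open>e\<close> tends to
      zero far out.\<close>
    have lim: "((\<lambda>t. e (log 2 (t * u)) - e (log 2 t)) \<longlongrightarrow> 0) at_top"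
    proof (rule tendstoI)
      fix \<eta> :: real assume \<eta>: "\<eta> > 0"
      define \<delta> where "\<delta> = \<eta> / (1 + \<bar>log 2 u\<bar>)"
      have \<delta>: "\<delta> > 0" using \<eta> by (simp add: \<delta>_def add_pos_nonneg)
      obtain m :: nat where m: "\<And>x y. x \<ge> real m \<Longrightarrow> y \<ge> real m \<Longrightarrow> \<bar>e y - e x\<bar> \<le> \<delta> * \<bar>y - x\<bar>" using e2[OF \<delta>] by blast
      show "eventually (\<lambda>t. dist (e (log 2 (t * u)) - e (log 2 t)) 0 < \<eta>) at_top"
        using eventually_ge_at_top[of "2 ^ m"] eventually_ge_at_top[of "2 ^ m / u"]
      proof eventually_elim
        case (elim t)
        have t0: "t > 0" using elim(1) by (meson less_le_trans zero_less_power zero_less_numeral)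
        have tu: "2 ^ m \<le> t * u" using elim(2) u by (simp add: field_simps)
        have "log 2 t \<ge> real m" "log 2 (t * u) \<ge> real m"
          using elim t0 u tu by (auto simp: le_log_iff powr_realpow)
        then have "\<bar>e (log 2 (t * u)) - e (log 2 t)\<bar> \<le> \<delta> * \<bar>log 2 (t * u) - log 2 t\<bar>" by (intro m)
        also have "log 2 (t * u) - log 2 t = log 2 u" using t0 u by (simp add: log_mult)
        also have "\<delta> * \<bar>log 2 u\<bar> < \<delta> * (1 + \<bar>log 2 u\<bar>)" using \<delta> by (intro mult_strict_left_mono) auto
        also have "\<dots> = \<eta>" by (simp add: \<delta>_def add_pos_nonneg less_imp_neq[symmetric])
        finally show ?case by (simp add: dist_real_def)
      qed
    qed
    have "((\<lambda>t. u powr (p - 1) * exp (e (log 2 (t * u)) - e (log 2 t))) \<longlongrightarrow> u powr (p - 1) * exp 0) at_top"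
      by (intro tendsto_intros lim)
    moreover have "eventually (\<lambda>t. u powr (p - 1) * exp (e (log 2 (t * u)) - e (log 2 t)) = g (t * u) / g t) at_top"
      using eventually_gt_at_top[of 0]
      by eventually_elim (use u in \<open>simp add: g_def powr_mult exp_diff\<close>)
    ultimately have "((\<lambda>t. g (t * u) / g t) \<longlongrightarrow> u powr (p - 1) * exp 0) at_top"
      by (rule Lim_transform_eventually)
    then show "((\<lambda>t. g (t * u) / g t) \<longlongrightarrow> u powr (p - 1)) at_top" by simp
  qed
qed

end

section \<open>The cells of a weight\<close>

lemma orlicz_delta2_exists:
  assumes "orlicz_function F" "delta2_large (\<lambda>u. ereal (F u))"
  obtains D u1 where "orlicz_delta2 F D u1"
proof -
  interpret orlicz F using assms(1) by unfold_locales
  obtain C u0 where C: "C \<ge> 1" "u0 \<ge> 0" and d: "\<And>u. u \<ge> u0 \<Longrightarrow> F (2 * u) \<le> C * F u"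
    using assms(2) unfolding delta2_large_def by auto
  obtain v where v: "v > 0" "F v = 1" by (rule F_attains[of 1]) auto
  have "orlicz_delta2 F C (max u0 v)"
  proof unfold_locales
    show "0 < F (max u0 v)" using F_mono[of v "max u0 v"] v by simp
  qed (use C d v in \<open>auto simp: less_max_iff_disj\<close>)
  then show thesis by (rule that)
qed

lemma orlicz_weight_exists:
  assumes "orlicz_delta2 F D u1" "nontrivial_weight w" "level_enumeration w Mb"
  obtains \<sigma> where "orlicz_weight F D u1 Mb w \<sigma>"
proof -
  interpret orlicz_delta2 F D u1 by fact
  have w: "w \<in> borel_measurable unit_leb" "AE t in unit_leb. 0 < w t"
    using assms(2) by (auto simp: nontrivial_weight_def weight_def)
  obtain \<sigma> where \<sigma>: "bij_betw \<sigma> UNIV {k. measure lebesgue (level_set w k) > 0}"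
    and Mb: "\<And>r. Mb r = level_set w (\<sigma> r)"
    using assms(3) unfolding level_enumeration_def by blast
  have inj: "inj \<sigma>" using \<sigma> by (simp add: bij_betw_def)
  \<comment> \<open>The levels missed by the enumeration are null sets, and there are only countably
    many of them, so the listed cells cover almost everything.\<close>
  have null: "AE t in unit_leb. t \<in> level_set w k \<longrightarrow> k \<in> range \<sigma>" for k
  proof (cases "measure lebesgue (level_set w k) > 0")
    case True
    then have "k \<in> range \<sigma>" using \<sigma> by (auto simp: bij_betw_def)
    then show ?thesis by simp
  next
    case False
    then have m0: "measure lebesgue (level_set w k) = 0" by (simp add: zero_less_measure_iff)
    have "level_set w k \<in> lmeasurable"
      using level_set_sets[OF w(1)]
      by (intro bounded_set_imp_lmeasurable) (auto intro: bounded_subset[of "{0..1::real}"] simp: level_set_def)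
    then have "level_set w k \<in> null_sets lebesgue" using m0
      by (simp add: null_sets_def fmeasurableD emeasure_eq_measure2)
    then have "AE t in lebesgue. t \<notin> level_set w k" by (rule AE_not_in)
    then show ?thesis by (subst AE_lebesgue_on_iff) (auto elim!: eventually_mono)
  qed
  have "AE t in unit_leb. \<forall>k. t \<in> level_set w k \<longrightarrow> k \<in> range \<sigma>"
    using null by (simp add: AE_all_countable)
  moreover have "AE t in unit_leb. t \<in> {0..1}" by (rule AE_I2) auto
  ultimately have cover: "AE t in unit_leb. \<exists>r. t \<in> Mb r" using w(2)
  proof eventually_elim
    case (elim t)
    obtain k where k: "t \<in> level_set w k" using level_set_exists[of w t] elim by blast
    then obtain r where "k = \<sigma> r" using elim by blast
    then show ?case using k Mb by auto
  qed
  have "orlicz_weight F D u1 Mb w \<sigma>"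
  proof unfold_locales
    show "Mb k \<in> sets lebesgue" for k using level_set_sets[OF w(1)] by (simp add: Mb)
    show "Mb k \<subseteq> {0..1}" for k by (auto simp: Mb level_set_def)
    show "disjoint_family Mb" unfolding disjoint_family_on_def
      using level_set_disjoint injD[OF inj] by (fastforce simp: Mb)
    show "0 < measure lebesgue (Mb k)" for k using \<sigma> by (auto simp: Mb bij_betw_def)
  qed (use w cover Mb inj in auto)
  then show thesis by (rule that)
qed

theorem theorem5p1:
  fixes F w :: "real \<Rightarrow> real" and Mb :: "nat \<Rightarrow> real set"
  assumes "orlicz_function F"
    and "delta2_large (\<lambda>u. ereal (F u))"
    and "nontrivial_weight w"
    and "level_enumeration w Mb"
  shows "(w_decomposable w (orlicz_space F) (orlicz_norm F) \<longleftrightarrow>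
            (\<exists>p\<ge>1. lp_estimates F Mb p)) \<and>
         (delta2_large (complementary F) \<longrightarrow>
            w_decomposable w (orlicz_space F) (orlicz_norm F) \<longrightarrow>
            (\<forall>p\<ge>1. lp_estimates F Mb p \<longrightarrow>
               (\<exists>G. orlicz_function G \<and> regularly_varying G p \<and> equivalent_functions F G)))"
proof -
  obtain D u1 where "orlicz_delta2 F D u1" using orlicz_delta2_exists[OF assms(1,2)] by blast
  then obtain \<sigma> where "orlicz_weight F D u1 Mb w \<sigma>" using orlicz_weight_exists assms(3,4) by blast
  then interpret orlicz_weight F D u1 Mb w \<sigma> .
  have iff: "w_decomposable w (orlicz_space F) (orlicz_norm F) \<longleftrightarrow> (\<exists>p\<ge>1. lp_estimates F Mb p)"
  proof
    assume "w_decomposable w (orlicz_space F) (orlicz_norm F)"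
    then obtain p where p: "p \<ge> 1" "lp_like F W p" using decomposable_imp_lp_like by blast
    then show "\<exists>p\<ge>1. lp_estimates F Mb p" using lp_like_imp_lp_estimates[of p] by auto
  next
    assume "\<exists>p\<ge>1. lp_estimates F Mb p"
    then obtain p where p: "p \<ge> 1" "lp_estimates F Mb p" by blast
    then have "lp_like F W p" by (intro lp_estimates_imp_lp_like) auto
    then show "w_decomposable w (orlicz_space F) (orlicz_norm F)"
      using p by (intro lp_like_imp_decomposable) auto
  qed
  have "\<exists>G. orlicz_function G \<and> regularly_varying G p \<and> equivalent_functions F G"
    if d: "delta2_large (complementary F)" and p: "p \<ge> 1" and est: "lp_estimates F Mb p" for p
  proof -
    have lp: "lp_like F W p" using est p by (intro lp_estimates_imp_lp_like) auto
    \<comment> \<open>For \<open>p = 1\<close> no smoothing takes place: \<open>F\<close> itself is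
      the regularly varying function.\<close>
    show ?thesis
    proof (cases "p = 1")
      case True
      then obtain B where "\<forall>u>0. F u / u \<le> B" using lp_like_one_imp_linear[OF _ d] lp by blast
      then have "regularly_varying F p" using True regularly_varying_linear by blast
      then show ?thesis using assms(1) equivalent_functions_refl by blast
    next
      case False
      then show ?thesis using lp_like_imp_regularly_varying[OF lp] p by simp
    qed
  qed
  then show ?thesis using iff by blast
qed

end
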